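(* Let $G$ be an infinite countable discrete amenable group and let $(X,\mathcal{B}_X,\mu,G)$ be a $G$-MPS. Then the following conditions are equivalent: (1) $\mu$ has discrete spectrum; (2) $(X,\mathcal{B}_X,\mu,G)$ is null with respect to any F\o lner sequence $\mathbf{F}$; (3) $(X,\mathcal{B}_X,\mu,G)$ is null with respect to some F\o lner sequence $\mathbf{F}$. In particular, whether or not a $G$-MPS is null is independent of the choice of F\o lner sequence.
   Context: A F\o lner sequence of $G$ here means a sequence $\mathbf{F}=\{F_n\}_{n=1}^\infty$ of finite subsets of $G$ with $\lim_{n\to\infty}|gF_n\triangle F_n|/|F_n|=0$ for every $g\in G$, $e_G\in F_1\subseteq F_2\subseteq\cdots$ and $\bigcup_n F_n=G$. A $G$-system $(X,G)$ is a compact metric space $X$ with a continuous action of $G$. A $G$-MPS $(X,\mathcal{B}_X,\mu,G)$ consists of a $G$-system $(X,G)$, its Borel $\sigma$-algebra $\mathcal{B}_X$, and a $G$-invariant Borel probability measure $\mu$. For $f\in L^2(X,\mathcal{B}_X,\mu)$ and $g\in G$ put $U_gf=f\circ g$. Let $H_c$ be the closed subspace of $L^2(X,\mathcal{B}_X,\mu)$ generated by all finite-dimensional $G$-invariant subspaces; equivalently, $f\in H_c$ iff $\{U_gf:g\in G\}$ is precompact in $L^2$. The measure $\mu$ has discrete spectrum if $H_c=L^2(X,\mathcal{B}_X,\mu)$. For a finite measurable partition $\alpha$ of $X$, $H_\mu(\alpha)=-\sum_{A\in\alpha}\mu(A)\log\mu(A)$ (with $0\log 0=0$), $g^{-1}\alpha=\{g^{-1}A:A\in\alpha\}$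 and $\bigvee$ denotes the common refinement. For an infinite subset $S\subset G$, $$h_\mu^{S,\mathbf{F}}(G,\alpha)=\limsup_{n\to\infty}\frac{1}{|S\cap F_n|}H_\mu\Big(\bigvee_{g\in S\cap F_n}g^{-1}\alpha\Big),\qquad h_\mu^{S,\mathbf{F}}(G)=\sup_\alpha h_\mu^{S,\mathbf{F}}(G,\alpha),$$ the supremum being over all finite measurable partitions of $X$. The $G$-MPS is null with respect to $\mathbf{F}$ if $h_\mu^{S,\mathbf{F}}(G)=0$ for every infinite subset $S$ of $G$. *)

theory Defs
  imports "HOL-Probability.Probability" "HOL-Algebra.Group_Action"
begin

section \<open>Amenable groups and Folner sequences\<close>

text \<open>For countable discrete groups, amenability is taken to be the Folner condition: finite
  nonempty sets that are almost invariant under any given finite set of translations. No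
  monotonicity or exhaustion is required of these sets, unlike in the Folner sequences below.\<close>

locale amenable_group = group G for G (structure) +
  assumes folner_condition:
    "\<lbrakk>finite K; K \<subseteq> carrier G; (0::real) < \<epsilon>\<rbrakk> \<Longrightarrow>
      \<exists>F. finite F \<and> F \<noteq> {} \<and> F \<subseteq> carrier G \<and>
        (\<forall>g\<in>K. real (card (sym_diff (g <# F) F)) < \<epsilon> * real (card F))"

text \<open>The sequence is indexed from 0, so that \<open>F 0\<close> is the first set.\<close>

definition folner_sequence :: "('g, 'b) monoid_scheme \<Rightarrow> (nat \<Rightarrow> 'g set) \<Rightarrow> bool" where
  "folner_sequence G F \<longleftrightarrow>
     (\<forall>n. finite (F n) \<and> F n \<subseteq> carrier G) \<and>
     (\<forall>g\<in>carrier G.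
        (\<lambda>n. real (card (sym_diff (g <#\<^bsub>G\<^esub> F n) (F n))) / real (card (F n))) \<longlonglongrightarrow> 0) \<and>
     \<one>\<^bsub>G\<^esub> \<in> F 0 \<and> incseq F \<and> (\<Union>n. F n) = carrier G"


section \<open>Systems and measure-preserving systems\<close>

text \<open>The space \<open>X\<close> is a whole type, and the element \<open>g\<close> acts by \<open>x \<mapsto> \<phi> g x\<close>. As \<open>G\<close> is discrete,
  the action is continuous iff every \<open>\<phi> g\<close> is.\<close>

locale G_system = group_action G UNIV \<phi>
  for G :: "('g, 'b) monoid_scheme" (structure)
    and \<phi> :: "'g \<Rightarrow> 'x::metric_space \<Rightarrow> 'x" +
  assumes compact_UNIV: "compact (UNIV :: 'x set)"
    and continuous_action: "g \<in> carrier G \<Longrightarrow> continuous_on UNIV (\<phi> g)"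

locale G_MPS = G_system G \<phi> + prob_space M
  for G :: "('g, 'b) monoid_scheme" (structure)
    and \<phi> :: "'g \<Rightarrow> 'x::metric_space \<Rightarrow> 'x"
    and M :: "'x measure" +
  assumes sets_eq_borel: "sets M = sets borel"
    and invariant_measure: "g \<in> carrier G \<Longrightarrow> distr M M (\<phi> g) = M"


section \<open>Discrete spectrum\<close>

text \<open>Elements of (complex) \<open>L\<^sup>2\<close> are represented by functions. Subspaces of \<open>L\<^sup>2\<close> are represented by
  the sets of all representatives of their members; these are closed under almost-everywhere
  equality, which is why the span below is taken modulo null sets.\<close>

definition L2 :: "'x measure \<Rightarrow> ('x \<Rightarrow> complex) set" where
  "L2 M = {f \<in> borel_measurable M. integrable M (\<lambda>x. (cmod (f x))\<^sup>2)}"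

definition L2_norm :: "'x measure \<Rightarrow> ('x \<Rightarrow> complex) \<Rightarrow> real" where
  "L2_norm M f = sqrt (\<integral>x. (cmod (f x))\<^sup>2 \<partial>M)"

definition L2_span :: "'x measure \<Rightarrow> ('x \<Rightarrow> complex) set \<Rightarrow> ('x \<Rightarrow> complex) set" where
  "L2_span M B = {f \<in> L2 M. \<exists>T c. finite T \<and> T \<subseteq> B \<and> (AE x in M. f x = (\<Sum>b\<in>T. c b * b x))}"

definition L2_closure :: "'x measure \<Rightarrow> ('x \<Rightarrow> complex) set \<Rightarrow> ('x \<Rightarrow> complex) set" where
  "L2_closure M V = {f \<in> L2 M. \<forall>\<epsilon>>0. \<exists>h\<in>V. L2_norm M (\<lambda>x. f x - h x) < \<epsilon>}"

definition finite_dim_L2_subspace :: "'x measure \<Rightarrow> ('x \<Rightarrow> complex) set \<Rightarrow> bool" where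
  "finite_dim_L2_subspace M V \<longleftrightarrow> (\<exists>B. finite B \<and> B \<subseteq> L2 M \<and> V = L2_span M B)"

definition invariant_under ::
    "('g, 'b) monoid_scheme \<Rightarrow> ('g \<Rightarrow> 'x \<Rightarrow> 'x) \<Rightarrow> ('x \<Rightarrow> complex) set \<Rightarrow> bool" where
  "invariant_under G \<phi> V \<longleftrightarrow> (\<forall>g\<in>carrier G. \<forall>f\<in>V. f \<circ> \<phi> g \<in> V)"

definition H_c ::
    "('g, 'b) monoid_scheme \<Rightarrow> ('g \<Rightarrow> 'x \<Rightarrow> 'x) \<Rightarrow> 'x measure \<Rightarrow> ('x \<Rightarrow> complex) set" where
  "H_c G \<phi> M =
     L2_closure M (L2_span M (\<Union>{V. finite_dim_L2_subspace M V \<and> invariant_under G \<phi> V}))"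

definition discrete_spectrum ::
    "('g, 'b) monoid_scheme \<Rightarrow> ('g \<Rightarrow> 'x \<Rightarrow> 'x) \<Rightarrow> 'x measure \<Rightarrow> bool" where
  "discrete_spectrum G \<phi> M \<longleftrightarrow> H_c G \<phi> M = L2 M"


section \<open>Sequence entropy\<close>

definition finite_measurable_partition :: "'x measure \<Rightarrow> 'x set set \<Rightarrow> bool" where
  "finite_measurable_partition M \<alpha> \<longleftrightarrow> finite \<alpha> \<and> \<alpha> \<subseteq> sets M \<and> partition_on (space M) \<alpha>"

text \<open>The convention \<open>0 log 0 = 0\<close> holds automatically.\<close>

definition partition_entropy :: "'x measure \<Rightarrow> 'x set set \<Rightarrow> real" where
  "partition_entropy M \<alpha> = - (\<Sum>A\<in>\<alpha>. measure M A * ln (measure M A))"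

definition preimage_partition :: "('x \<Rightarrow> 'x) \<Rightarrow> 'x set set \<Rightarrow> 'x set set" where
  "preimage_partition T \<alpha> = (\<lambda>A. T -` A) ` \<alpha>"

text \<open>If \<open>S \<inter> F n\<close> is empty, the \<open>n\<close>-th term is 0 (division by zero); for infinite \<open>S\<close> and a Folner
  sequence \<open>F\<close> this concerns only finitely many \<open>n\<close>.\<close>

definition sequence_entropy_partition ::
    "('g \<Rightarrow> 'x \<Rightarrow> 'x) \<Rightarrow> 'x measure \<Rightarrow> 'g set \<Rightarrow> (nat \<Rightarrow> 'g set) \<Rightarrow> 'x set set \<Rightarrow> ereal" where
  "sequence_entropy_partition \<phi> M S F \<alpha> =
     limsup (\<lambda>n. ereal
       (partition_entropy M (common_refinement ((\<lambda>g. preimage_partition (\<phi> g) \<alpha>) ` (S \<inter> F n)))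
        / real (card (S \<inter> F n))))"

definition sequence_entropy ::
    "('g \<Rightarrow> 'x \<Rightarrow> 'x) \<Rightarrow> 'x measure \<Rightarrow> 'g set \<Rightarrow> (nat \<Rightarrow> 'g set) \<Rightarrow> ereal" where
  "sequence_entropy \<phi> M S F =
     (SUP \<alpha>\<in>{\<alpha>. finite_measurable_partition M \<alpha>}. sequence_entropy_partition \<phi> M S F \<alpha>)"

definition null_wrt ::
    "('g, 'b) monoid_scheme \<Rightarrow> ('g \<Rightarrow> 'x \<Rightarrow> 'x) \<Rightarrow> 'x measure \<Rightarrow> (nat \<Rightarrow> 'g set) \<Rightarrow> bool" where
  "null_wrt G \<phi> M F \<longleftrightarrow> (\<forall>S. S \<subseteq> carrier G \<and> infinite S \<longrightarrow> sequence_entropy \<phi> M S F = 0)"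

end

theory Submission
  imports Defs
begin

text \<open>All conditions are equivalent to almost periodicity of every \<open>f \<in> L\<^sup>2\<close>, i.e. total boundedness of
  its orbit.

  If the orbit of the indicator of \<open>A\<close> is not totally bounded, then for every finite partition some
  translate of \<open>A\<close> is far from all unions of its cells, and joining that translate raises the entropy
  by a fixed amount. Iterating this greedily gives a set \<open>S\<close> of positive sequence entropy. Conversely, total
  boundedness of the orbits of all indicators means that finitely many translates of a partition
  nearly determine every other one, so joins over large sets have entropy growth at most \<open>\<epsilon>\<close> per element.

  That almost periodicity forces discrete spectrum is a Peter-Weyl argument. If \<open>f \<noteq> 0\<close> is orthogonal to
  all finite-dimensional invariant subspaces, consider a limit \<open>q(u)\<close> of the averages of
  \<open>\<bar>\<langle>u, f \<circ> h\<^sup>-\<^sup>1\<rangle>\<bar>\<^sup>2\<close> over \<open>h \<in> F n\<close>, taken along a filter that makes all bounded sequences converge. It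
  is an invariant quadratic form of finite trace, positive at \<open>f\<close>, whose maximum on the unit sphere is
  attained by total boundedness. The vectors attaining it span a finite-dimensional invariant subspace on
  which \<open>q\<close> vanishes by orthogonality, a contradiction.\<close>

section \<open>The inner product on square integrable functions\<close>

text \<open>What the classical Peter-Weyl argument has and this setting lacks is a compact group
  with Haar measure. Folner averages take the place of the Haar integral, and the filter takes the
  place of a proof that these averages converge. The operator behind the form is never constructed:
  the parallelogram law and homogeneity suffice to treat its eigenspace for the largest eigenvalue
  as a subspace. Total boundedness acts twice there: it makes the form positive at \<open>f\<close>,
  and it lets finitely many coefficients control the form, which is the compactness behind the
  existence of a maximizer.

  On the entropy side the fixed gain is a measure distance itself: entropy is in nats, and the
  entropy of a two-set split is at least the smaller of the two probabilities. In the converse,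
  Fano's inequality turns a small probability of mispredicting a label into a small entropy
  increment. Different Folner sequences are never compared with one another; each is compared with
  almost periodicity.\<close>

definition L2_inner :: "'x measure \<Rightarrow> ('x \<Rightarrow> complex) \<Rightarrow> ('x \<Rightarrow> complex) \<Rightarrow> complex" where
  "L2_inner M f g = (\<integral>x. f x * cnj (g x) \<partial>M)"

lemma L2_measurable: "f \<in> L2 M \<Longrightarrow> f \<in> borel_measurable M"
  by (simp add: L2_def)

lemma L2_integrable_sq: "f \<in> L2 M \<Longrightarrow> integrable M (\<lambda>x. (cmod (f x))\<^sup>2)"
  by (simp add: L2_def)

lemma cmod_add_sq_le: "(cmod (a + b))\<^sup>2 \<le> 2 * (cmod a)\<^sup>2 + 2 * (cmod b)\<^sup>2"
proof -
  have "(cmod (a + b))\<^sup>2 \<le> (cmod a + cmod b)\<^sup>2"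
    by (intro power_mono norm_triangle_ineq) auto
  also have "\<dots> \<le> 2 * (cmod a)\<^sup>2 + 2 * (cmod b)\<^sup>2"
    using sum_squares_bound[of "cmod a" "cmod b"] by (simp add: power2_sum)
  finally show ?thesis .
qed

lemma borel_measurable_cnj [measurable (raw)]:
  "f \<in> borel_measurable M \<Longrightarrow> (\<lambda>x. cnj (f x)) \<in> borel_measurable M"
  by (rule borel_measurable_continuous_on[of cnj]) (auto intro!: continuous_intros)

lemma L2_bounded:
  assumes "f \<in> borel_measurable M" "g \<in> L2 M" "\<And>x. x \<in> space M \<Longrightarrow> cmod (f x) \<le> C * cmod (g x)"
  shows "f \<in> L2 M"
proof -
  have "integrable M (\<lambda>x. C\<^sup>2 * (cmod (g x))\<^sup>2)"
    using L2_integrable_sq[OF assms(2)] by simp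
  then have "integrable M (\<lambda>x. (cmod (f x))\<^sup>2)"
  proof (rule Bochner_Integration.integrable_bound)
    show "AE x in M. norm ((cmod (f x))\<^sup>2) \<le> norm (C\<^sup>2 * (cmod (g x))\<^sup>2)"
    proof (rule AE_I2)
      fix x assume "x \<in> space M"
      then have "(cmod (f x))\<^sup>2 \<le> (C * cmod (g x))\<^sup>2"
        by (intro power_mono assms) auto
      then show "norm ((cmod (f x))\<^sup>2) \<le> norm (C\<^sup>2 * (cmod (g x))\<^sup>2)"
        by (simp add: power_mult_distrib)
    qed
  qed (use assms(1) in measurable)
  then show ?thesis using assms(1) by (simp add: L2_def)
qed

lemma L2_add:
  assumes "f \<in> L2 M" "g \<in> L2 M" shows "(\<lambda>x. f x + g x) \<in> L2 M"
proof -
  have [measurable]: "f \<in> borel_measurable M" "g \<in> borel_measurable M"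
    using assms by (auto intro: L2_measurable)
  have "integrable M (\<lambda>x. 2 * (cmod (f x))\<^sup>2 + 2 * (cmod (g x))\<^sup>2)"
    using L2_integrable_sq[OF assms(1)] L2_integrable_sq[OF assms(2)] by simp
  then have "integrable M (\<lambda>x. (cmod (f x + g x))\<^sup>2)"
    by (rule Bochner_Integration.integrable_bound) (auto simp: cmod_add_sq_le)
  then show ?thesis by (simp add: L2_def)
qed

lemma L2_scale:
  assumes "f \<in> L2 M" shows "(\<lambda>x. c * f x) \<in> L2 M"
  using assms L2_measurable[OF assms] by (intro L2_bounded[OF _ assms, of _ "cmod c"]) (auto simp: norm_mult)

lemma L2_uminus: "f \<in> L2 M \<Longrightarrow> (\<lambda>x. - f x) \<in> L2 M"
  using L2_scale[of f M "-1"] by simp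

lemma L2_diff:
  assumes "f \<in> L2 M" "g \<in> L2 M" shows "(\<lambda>x. f x - g x) \<in> L2 M"
  using L2_add[OF assms(1) L2_uminus[OF assms(2)]] by simp

lemma L2_zero [simp]: "(\<lambda>x. 0) \<in> L2 M"
  by (simp add: L2_def)

lemma L2_sum:
  assumes "\<And>i. i \<in> I \<Longrightarrow> f i \<in> L2 M" shows "(\<lambda>x. \<Sum>i\<in>I. f i x) \<in> L2 M"
  using assms by (induction I rule: infinite_finite_induct) (auto intro: L2_add)

lemma L2_inner_integrable:
  assumes "f \<in> L2 M" "g \<in> L2 M" shows "integrable M (\<lambda>x. f x * cnj (g x))"
proof -
  have [measurable]: "f \<in> borel_measurable M" "g \<in> borel_measurable M"
    using assms by (auto intro: L2_measurable)
  have "integrable M (\<lambda>x. (cmod (f x))\<^sup>2 + (cmod (g x))\<^sup>2)"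
    using L2_integrable_sq[OF assms(1)] L2_integrable_sq[OF assms(2)] by simp
  moreover have "cmod a * cmod b \<le> (cmod a)\<^sup>2 + (cmod b)\<^sup>2" for a b
    using sum_squares_bound[of "cmod a" "cmod b"] mult_nonneg_nonneg[OF norm_ge_zero[of a] norm_ge_zero[of b]]
    by linarith
  ultimately show ?thesis
    by (elim Bochner_Integration.integrable_bound) (measurable, auto simp: norm_mult)
qed

lemma L2_inner_add_left:
  assumes "f \<in> L2 M" "g \<in> L2 M" "h \<in> L2 M"
  shows "L2_inner M (\<lambda>x. f x + g x) h = L2_inner M f h + L2_inner M g h"
  using L2_inner_integrable[of f M h] L2_inner_integrable[of g M h] assms
  by (simp add: L2_inner_def distrib_right)

lemma L2_inner_diff_left:
  assumes "f \<in> L2 M" "g \<in> L2 M" "h \<in> L2 M"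
  shows "L2_inner M (\<lambda>x. f x - g x) h = L2_inner M f h - L2_inner M g h"
  using L2_inner_integrable[of f M h] L2_inner_integrable[of g M h] assms
  by (simp add: L2_inner_def left_diff_distrib)

lemma L2_inner_scale_left: "L2_inner M (\<lambda>x. c * f x) h = c * L2_inner M f h"
  by (simp add: L2_inner_def mult.assoc)

lemma L2_inner_commute: "L2_inner M g f = cnj (L2_inner M f g)"
  by (simp add: L2_inner_def mult.commute flip: Bochner_Integration.integral_cnj)

lemma L2_inner_sum_left:
  assumes "\<And>i. i \<in> I \<Longrightarrow> f i \<in> L2 M" "h \<in> L2 M"
  shows "L2_inner M (\<lambda>x. \<Sum>i\<in>I. f i x) h = (\<Sum>i\<in>I. L2_inner M (f i) h)"
  using assms
proof (induction I rule: infinite_finite_induct)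
  case (insert i I)
  then have "L2_inner M (\<lambda>x. f i x + (\<Sum>i\<in>I. f i x)) h = L2_inner M (f i) h + (\<Sum>i\<in>I. L2_inner M (f i) h)"
    by (subst L2_inner_add_left) (auto intro: L2_sum)
  with insert.hyps show ?case by simp
qed (auto simp: L2_inner_def)

lemma L2_inner_cong_AE:
  assumes "f \<in> L2 M" "g \<in> L2 M" "f' \<in> L2 M" "AE x in M. f x = f' x"
  shows "L2_inner M f g = L2_inner M f' g"
proof -
  have [measurable]: "f \<in> borel_measurable M" "g \<in> borel_measurable M" "f' \<in> borel_measurable M"
    using assms by (auto intro: L2_measurable)
  show ?thesis unfolding L2_inner_def using assms(4) by (intro integral_cong_AE) (measurable, auto)
qed

lemma L2_norm_nonneg [simp]: "0 \<le> L2_norm M f"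
  by (simp add: L2_norm_def)

lemma L2_norm_sq: "(L2_norm M f)\<^sup>2 = (\<integral>x. (cmod (f x))\<^sup>2 \<partial>M)"
  by (simp add: L2_norm_def)

lemma L2_inner_self: "L2_inner M f f = of_real ((L2_norm M f)\<^sup>2)"
  by (simp only: L2_inner_def L2_norm_sq complex_norm_square[symmetric] integral_complex_of_real)

lemma L2_norm_zero_iff:
  assumes "f \<in> L2 M" shows "L2_norm M f = 0 \<longleftrightarrow> (AE x in M. f x = 0)"
  using integral_nonneg_eq_0_iff_AE[OF L2_integrable_sq[OF assms]]
  by (simp add: L2_norm_def)

lemma L2_norm_cong_AE:
  assumes "f \<in> borel_measurable M" "f' \<in> borel_measurable M" "AE x in M. f x = f' x"
  shows "L2_norm M f = L2_norm M f'"
proof -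
  have "(\<integral>x. (cmod (f x))\<^sup>2 \<partial>M) = (\<integral>x. (cmod (f' x))\<^sup>2 \<partial>M)"
    using assms by (intro integral_cong_AE) auto
  then show ?thesis by (simp add: L2_norm_def)
qed

lemma L2_norm_scale: "L2_norm M (\<lambda>x. c * f x) = cmod c * L2_norm M f"
  by (simp add: L2_norm_def norm_mult power_mult_distrib real_sqrt_mult)

lemma L2_norm_minus_commute: "L2_norm M (\<lambda>x. f x - g x) = L2_norm M (\<lambda>x. g x - f x)"
  by (simp add: L2_norm_def norm_minus_commute)

lemma L2_norm_add_sq:
  assumes "f \<in> L2 M" "g \<in> L2 M"
  shows "(L2_norm M (\<lambda>x. f x + g x))\<^sup>2 = (L2_norm M f)\<^sup>2 + 2 * Re (L2_inner M f g) + (L2_norm M g)\<^sup>2"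
proof -
  have "of_real ((L2_norm M (\<lambda>x. f x + g x))\<^sup>2) = L2_inner M (\<lambda>x. f x + g x) (\<lambda>x. f x + g x)"
    by (simp add: L2_inner_self)
  also have "\<dots> = L2_inner M f (\<lambda>x. f x + g x) + L2_inner M g (\<lambda>x. f x + g x)"
    using assms by (intro L2_inner_add_left L2_add)
  also have "\<dots> = cnj (L2_inner M (\<lambda>x. f x + g x) f) + cnj (L2_inner M (\<lambda>x. f x + g x) g)"
    by (metis L2_inner_commute)
  also have "\<dots> = cnj (L2_inner M f f + L2_inner M g f) + cnj (L2_inner M f g + L2_inner M g g)"
    using assms by (simp add: L2_inner_add_left)
  also have "L2_inner M g f = cnj (L2_inner M f g)"
    by (rule L2_inner_commute)
  finally have "Re (of_real ((L2_norm M (\<lambda>x. f x + g x))\<^sup>2)) =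
     Re (cnj (L2_inner M f f + cnj (L2_inner M f g)) + cnj (L2_inner M f g + L2_inner M g g))"
    by simp
  then show ?thesis by (simp add: L2_inner_self)
qed

lemma L2_norm_diff_sq:
  assumes "f \<in> L2 M" "g \<in> L2 M"
  shows "(L2_norm M (\<lambda>x. f x - g x))\<^sup>2 = (L2_norm M f)\<^sup>2 - 2 * Re (L2_inner M f g) + (L2_norm M g)\<^sup>2"
proof -
  have "L2_inner M f (\<lambda>x. - 1 * g x) = cnj (- 1 * L2_inner M g f)"
    by (subst L2_inner_commute) (simp only: L2_inner_scale_left)
  moreover have "L2_norm M (\<lambda>x. - 1 * g x) = L2_norm M g"
    by (simp only: L2_norm_scale) simp
  moreover have "L2_inner M g f = cnj (L2_inner M f g)" by (rule L2_inner_commute)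
  ultimately show ?thesis
    using L2_norm_add_sq[OF assms(1) L2_scale[OF assms(2), of "-1"]] by simp
qed

lemma L2_parallelogram:
  assumes "f \<in> L2 M" "g \<in> L2 M"
  shows "(L2_norm M (\<lambda>x. f x + g x))\<^sup>2 + (L2_norm M (\<lambda>x. f x - g x))\<^sup>2
    = 2 * (L2_norm M f)\<^sup>2 + 2 * (L2_norm M g)\<^sup>2"
  using assms by (simp add: L2_norm_add_sq L2_norm_diff_sq)

lemma L2_Cauchy_Schwarz:
  assumes "f \<in> L2 M" "g \<in> L2 M"
  shows "cmod (L2_inner M f g) \<le> L2_norm M f * L2_norm M g"
proof (cases "L2_norm M g = 0")
  case True
  then have "AE x in M. g x = 0" using L2_norm_zero_iff[OF assms(2)] by simp
  then have "L2_inner M g f = L2_inner M (\<lambda>x. 0) f"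
    using assms by (intro L2_inner_cong_AE) auto
  then have "L2_inner M f g = 0"
    using L2_inner_commute[of M f g] by (simp add: L2_inner_def)
  with True show ?thesis by simp
next
  case False
  then have pos: "L2_norm M g > 0" using L2_norm_nonneg[of M g] by linarith
  define i where "i = L2_inner M f g"
  \<comment> \<open>The function \<open>c * g\<close> is the orthogonal projection of
    \<open>f\<close> onto the line through \<open>g\<close>; the inequality is the nonnegativity of
    the squared norm of the residual.\<close>
  define c where "c = i / of_real ((L2_norm M g)\<^sup>2)"
  have "L2_inner M f (\<lambda>x. c * g x) = cnj c * i"
    by (subst L2_inner_commute, subst L2_inner_scale_left, subst L2_inner_commute) (simp add: i_def)
  also have "\<dots> = of_real ((cmod i)\<^sup>2 / (L2_norm M g)\<^sup>2)"
    by (simp add: c_def complex_norm_square[of i] mult.commute del: of_real_power)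
  finally have inn: "L2_inner M f (\<lambda>x. c * g x) = of_real ((cmod i)\<^sup>2 / (L2_norm M g)\<^sup>2)" .
  have "cmod c = cmod i / (L2_norm M g)\<^sup>2"
    by (simp add: c_def norm_divide norm_power)
  then have nn: "(L2_norm M (\<lambda>x. c * g x))\<^sup>2 = (cmod i)\<^sup>2 / (L2_norm M g)\<^sup>2"
    using pos by (simp add: L2_norm_scale power_mult_distrib power_divide field_simps power2_eq_square)
  have "0 \<le> (L2_norm M (\<lambda>x. f x - c * g x))\<^sup>2" by simp
  also have "\<dots> = (L2_norm M f)\<^sup>2 - (cmod i)\<^sup>2 / (L2_norm M g)\<^sup>2"
    using L2_norm_diff_sq[OF assms(1) L2_scale[OF assms(2), of c]] inn nn by simp
  finally have "(cmod i)\<^sup>2 \<le> (L2_norm M f * L2_norm M g)\<^sup>2"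
    using pos by (simp add: field_simps power_mult_distrib)
  then show ?thesis unfolding i_def by (rule power2_le_imp_le) simp
qed

lemma L2_norm_triangle:
  assumes "f \<in> L2 M" "g \<in> L2 M"
  shows "L2_norm M (\<lambda>x. f x + g x) \<le> L2_norm M f + L2_norm M g"
proof (rule power2_le_imp_le)
  have "Re (L2_inner M f g) \<le> L2_norm M f * L2_norm M g"
    using complex_Re_le_cmod[of "L2_inner M f g"] L2_Cauchy_Schwarz[OF assms] by linarith
  then show "(L2_norm M (\<lambda>x. f x + g x))\<^sup>2 \<le> (L2_norm M f + L2_norm M g)\<^sup>2"
    using assms by (simp add: L2_norm_add_sq power2_sum)
qed simp

lemma L2_norm_triangle_diff:
  assumes "f \<in> L2 M" "g \<in> L2 M" "h \<in> L2 M"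
  shows "L2_norm M (\<lambda>x. f x - h x) \<le> L2_norm M (\<lambda>x. f x - g x) + L2_norm M (\<lambda>x. g x - h x)"
  using L2_norm_triangle[OF L2_diff[OF assms(1,2)] L2_diff[OF assms(2,3)]] by simp

lemma L2_norm_diff_le:
  assumes "f \<in> L2 M" "g \<in> L2 M"
  shows "L2_norm M f \<le> L2_norm M (\<lambda>x. f x - g x) + L2_norm M g"
  using L2_norm_triangle_diff[OF assms L2_zero] by simp

text \<open>Cauchy-Schwarz against the constant 1, which has norm 1 on a probability space. It
  supplies the summable L1 bounds in the completeness proof.\<close>

lemma (in prob_space) integral_cmod_le_L2_norm:
  assumes "f \<in> L2 M"
  shows "integrable M (\<lambda>x. cmod (f x))" "(\<integral>x. cmod (f x) \<partial>M) \<le> L2_norm M f"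
proof -
  have [measurable]: "f \<in> borel_measurable M" by (rule L2_measurable[OF assms])
  have one: "(\<lambda>x. 1) \<in> L2 M" by (simp add: L2_def)
  have abs: "(\<lambda>x. of_real (cmod (f x))) \<in> L2 M"
    using assms by (intro L2_bounded[OF _ assms, of _ 1]) auto
  have "integrable M (\<lambda>x. norm (f x * cnj 1))"
    by (intro integrable_norm L2_inner_integrable assms one)
  then show "integrable M (\<lambda>x. cmod (f x))" by simp
  have "L2_inner M (\<lambda>x. of_real (cmod (f x))) (\<lambda>x. 1) = of_real (\<integral>x. cmod (f x) \<partial>M)"
    by (simp add: L2_inner_def)
  moreover have "L2_norm M (\<lambda>x. of_real (cmod (f x))) = L2_norm M f"
    by (simp add: L2_norm_def)
  moreover have "L2_norm M (\<lambda>x. 1) = 1" by (simp add: L2_norm_def prob_space)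
  ultimately show "(\<integral>x. cmod (f x) \<partial>M) \<le> L2_norm M f"
    using L2_Cauchy_Schwarz[OF abs one] by simp
qed

text \<open>Riesz-Fischer for representatives: a subsequence whose successive distances are below a
  geometric sequence converges almost everywhere, and Fatou's lemma shows that the pointwise limit
  is also the norm limit of the full sequence.\<close>

lemma (in prob_space) L2_complete:
  assumes u: "\<And>n. u n \<in> L2 M"
    and Cauchy: "\<And>e. e > 0 \<Longrightarrow> \<exists>N. \<forall>m\<ge>N. \<forall>n\<ge>N. L2_norm M (\<lambda>x. u m x - u n x) < e"
  obtains v where "v \<in> L2 M" "(\<lambda>n. L2_norm M (\<lambda>x. u n x - v x)) \<longlonglongrightarrow> 0"
proof -
  have [measurable]: "u n \<in> borel_measurable M" for n by (rule L2_measurable[OF u])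
  have "\<exists>r. \<forall>k. (\<forall>m\<ge>r k. \<forall>n\<ge>r k. L2_norm M (\<lambda>x. u m x - u n x) < (1/2)^k) \<and> r k < r (Suc k)"
  proof (rule dependent_nat_choice)
    show "\<exists>N. \<forall>m\<ge>N. \<forall>n\<ge>N. L2_norm M (\<lambda>x. u m x - u n x) < (1/2)^0"
      using Cauchy[of 1] by simp
    fix y k
    obtain N where N: "\<forall>m\<ge>N. \<forall>n\<ge>N. L2_norm M (\<lambda>x. u m x - u n x) < (1/2)^Suc k"
      using Cauchy[of "(1/2)^Suc k"] by (meson half_gt_zero zero_less_one zero_less_power)
    then show "\<exists>N. (\<forall>m\<ge>N. \<forall>n\<ge>N. L2_norm M (\<lambda>x. u m x - u n x) < (1/2)^Suc k) \<and> y < N"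
      by (intro exI[of _ "max N (Suc y)"]) auto
  qed
  then obtain r where r: "\<And>k m n. m \<ge> r k \<Longrightarrow> n \<ge> r k \<Longrightarrow> L2_norm M (\<lambda>x. u m x - u n x) < (1/2)^k"
    and mono: "strict_mono r"
    by (auto simp: strict_mono_Suc_iff)
  define d where "d k x = u (r (Suc k)) x - u (r k) x" for k x
  have d: "d k \<in> L2 M" for k unfolding d_def by (intro L2_diff u)
  have [measurable]: "d k \<in> borel_measurable M" for k by (rule L2_measurable[OF d])
  have d_le: "(\<integral>\<^sup>+x. ennreal (cmod (d k x)) \<partial>M) \<le> ennreal ((1/2)^k)" for k
  proof -
    have "L2_norm M (d k) < (1/2)^k"
      unfolding d_def using strict_mono_less_eq[OF mono, of k "Suc k"] by (intro r) auto
    then show ?thesis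
      using integral_cmod_le_L2_norm[OF d, of k]
      by (subst nn_integral_eq_integral) (auto intro!: ennreal_leI)
  qed
  have "(\<integral>\<^sup>+x. (\<Sum>k. ennreal (cmod (d k x))) \<partial>M) = (\<Sum>k. \<integral>\<^sup>+x. ennreal (cmod (d k x)) \<partial>M)"
    by (intro nn_integral_suminf) auto
  also have "\<dots> \<le> (\<Sum>k. ennreal ((1/2)^k))"
    by (intro suminf_le d_le) auto
  also have "\<dots> < \<infinity>"
    unfolding infinity_ennreal_def less_top[symmetric]
    by (rule ennreal_suminf_neq_top) (auto intro: summable_geometric)
  finally have "(\<integral>\<^sup>+x. (\<Sum>k. ennreal (cmod (d k x))) \<partial>M) \<noteq> \<infinity>"
    by (auto simp: top_unique)
  then have "AE x in M. (\<Sum>k. ennreal (cmod (d k x))) \<noteq> \<infinity>"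
    by (intro nn_integral_noteq_infinite) auto
  then have conv: "AE x in M. convergent (\<lambda>k. u (r k) x)"
  proof eventually_elim
    fix x assume "(\<Sum>k. ennreal (cmod (d k x))) \<noteq> \<infinity>"
    then have "summable (\<lambda>k. cmod (d k x))"
      by (intro summable_suminf_not_top) auto
    then have "summable (\<lambda>k. d k x)" by (rule summable_norm_cancel)
    then have "convergent (\<lambda>n. \<Sum>k<n. d k x)" by (simp add: summable_iff_convergent)
    moreover have "(\<Sum>k<n. d k x) = u (r n) x - u (r 0) x" for n
      unfolding d_def by (rule sum_lessThan_telescope)
    ultimately have "convergent (\<lambda>n. u (r n) x - u (r 0) x)" by simp
    from convergent_add[OF this convergent_const[of "u (r 0) x"]]
    show "convergent (\<lambda>k. u (r k) x)" by simp
  qed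
  \<comment> \<open>On the null set where the subsequence diverges, \<open>lim\<close> has some
    unspecified value; \<open>v\<close> is measurable all the same.\<close>
  define v where "v x = lim (\<lambda>k. u (r k) x)" for x
  have [measurable]: "v \<in> borel_measurable M" unfolding v_def by measurable
  have lim: "AE x in M. (\<lambda>k. u (r k) x) \<longlonglongrightarrow> v x"
    using conv by eventually_elim (simp add: v_def convergent_LIMSEQ_iff)
  \<comment> \<open>Fatou along the subsequence carries a bound on the tail distances over to the
    distance from \<open>v\<close>. Both \<open>v \<in> L2 M\<close> and the convergence are read
    off from it.\<close>
  have bound: "(\<integral>\<^sup>+x. ennreal ((cmod (u n x - v x))\<^sup>2) \<partial>M) \<le> ennreal (e\<^sup>2)"
    if e: "e > 0" and N: "\<And>m. m \<ge> N \<Longrightarrow> L2_norm M (\<lambda>x. u n x - u m x) < e" for n N e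
  proof -
    have "(\<integral>\<^sup>+x. ennreal ((cmod (u n x - v x))\<^sup>2) \<partial>M)
        = (\<integral>\<^sup>+x. liminf (\<lambda>k. ennreal ((cmod (u n x - u (r k) x))\<^sup>2)) \<partial>M)"
    proof (rule nn_integral_cong_AE)
      show "AE x in M. ennreal ((cmod (u n x - v x))\<^sup>2) = liminf (\<lambda>k. ennreal ((cmod (u n x - u (r k) x))\<^sup>2))"
        using lim
      proof eventually_elim
        fix x assume "(\<lambda>k. u (r k) x) \<longlonglongrightarrow> v x"
        then have "(\<lambda>k. ennreal ((cmod (u n x - u (r k) x))\<^sup>2)) \<longlonglongrightarrow> ennreal ((cmod (u n x - v x))\<^sup>2)"
          by (intro tendsto_intros)
        then show "ennreal ((cmod (u n x - v x))\<^sup>2) = liminf (\<lambda>k. ennreal ((cmod (u n x - u (r k) x))\<^sup>2))"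
          by (intro lim_imp_Liminf[symmetric]) auto
      qed
    qed
    also have "\<dots> \<le> liminf (\<lambda>k. \<integral>\<^sup>+x. ennreal ((cmod (u n x - u (r k) x))\<^sup>2) \<partial>M)"
      by (intro nn_integral_liminf) auto
    also have "\<dots> \<le> liminf (\<lambda>k. ennreal (e\<^sup>2))"
    proof (rule Liminf_mono)
      show "\<forall>\<^sub>F k in sequentially. (\<integral>\<^sup>+x. ennreal ((cmod (u n x - u (r k) x))\<^sup>2) \<partial>M) \<le> ennreal (e\<^sup>2)"
        using eventually_ge_at_top[of N]
      proof eventually_elim
        fix k assume "k \<ge> N"
        then have "r k \<ge> N" using strict_mono_imp_increasing[OF mono, of k] by linarith
        from N[OF this] have "(L2_norm M (\<lambda>x. u n x - u (r k) x))\<^sup>2 \<le> e\<^sup>2"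
          by (intro power_mono) auto
        then show "(\<integral>\<^sup>+x. ennreal ((cmod (u n x - u (r k) x))\<^sup>2) \<partial>M) \<le> ennreal (e\<^sup>2)"
          using L2_integrable_sq[OF L2_diff[OF u u]]
          by (subst nn_integral_eq_integral) (auto simp: L2_norm_sq intro!: ennreal_leI)
      qed
    qed
    finally show ?thesis by (simp add: Liminf_const)
  qed
  have mem: "(\<lambda>x. u n x - v x) \<in> L2 M" and le: "L2_norm M (\<lambda>x. u n x - v x) \<le> e"
    if "e > 0" and "\<And>m. m \<ge> N \<Longrightarrow> L2_norm M (\<lambda>x. u n x - u m x) < e" for n N e
  proof -
    have int: "integrable M (\<lambda>x. (cmod (u n x - v x))\<^sup>2)"
      using order_le_less_trans[OF bound[OF that] ennreal_less_top]
      by (intro integrableI_bounded) auto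
    then show "(\<lambda>x. u n x - v x) \<in> L2 M" by (simp add: L2_def)
    have "ennreal (\<integral>x. (cmod (u n x - v x))\<^sup>2 \<partial>M) \<le> ennreal (e\<^sup>2)"
      using bound[OF that] int by (subst (asm) nn_integral_eq_integral) auto
    then have "(L2_norm M (\<lambda>x. u n x - v x))\<^sup>2 \<le> e\<^sup>2"
      by (simp add: L2_norm_sq)
    then show "L2_norm M (\<lambda>x. u n x - v x) \<le> e"
      by (rule power2_le_imp_le) (use that(1) in simp)
  qed
  show thesis
  proof (rule that)
    obtain N where N: "\<forall>m\<ge>N. \<forall>n\<ge>N. L2_norm M (\<lambda>x. u m x - u n x) < 1"
      using Cauchy[of 1] by auto
    have "(\<lambda>x. u N x - v x) \<in> L2 M" using N by (intro mem[of 1 N]) auto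
    from L2_diff[OF u[of N] this] show "v \<in> L2 M" by simp
    show "(\<lambda>n. L2_norm M (\<lambda>x. u n x - v x)) \<longlonglongrightarrow> 0"
    proof (rule LIMSEQ_I)
      fix e :: real assume "e > 0"
      then obtain N where N: "\<forall>m\<ge>N. \<forall>n\<ge>N. L2_norm M (\<lambda>x. u m x - u n x) < e/2"
        using Cauchy[of "e/2"] by auto
      have le_half: "L2_norm M (\<lambda>x. u n x - v x) \<le> e/2" if "n \<ge> N" for n
        using N that \<open>e > 0\<close> by (intro le[of "e/2" N]) auto
      have "norm (L2_norm M (\<lambda>x. u n x - v x) - 0) < e" if "n \<ge> N" for n
        using le_half[OF that] \<open>e > 0\<close> by simp
      then show "\<exists>N. \<forall>n\<ge>N. norm (L2_norm M (\<lambda>x. u n x - v x) - 0) < e" by blast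
    qed
  qed
qed

section \<open>Orthonormal families and orthogonal vectors\<close>

lemma L2_norm_diff_abs_le:
  assumes "f \<in> L2 M" "g \<in> L2 M"
  shows "\<bar>L2_norm M f - L2_norm M g\<bar> \<le> L2_norm M (\<lambda>x. f x - g x)"
  using L2_norm_diff_le[OF assms] L2_norm_diff_le[OF assms(2,1)] L2_norm_minus_commute[of M f g]
  by linarith

lemma L2_norm_tendsto:
  assumes "\<And>n. u n \<in> L2 M" "v \<in> L2 M" "((\<lambda>n. L2_norm M (\<lambda>x. u n x - v x)) \<longlongrightarrow> 0) F"
  shows "((\<lambda>n. L2_norm M (u n)) \<longlongrightarrow> L2_norm M v) F"
proof -
  have "((\<lambda>n. L2_norm M (u n) - L2_norm M v) \<longlongrightarrow> 0) F"
    by (rule Lim_null_comparison[OF always_eventually assms(3)])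
       (use L2_norm_diff_abs_le[OF assms(1,2)] in auto)
  then show ?thesis by (simp add: LIM_zero_iff)
qed

text \<open>The test \<open>b = b'\<close> is equality of functions, not equality almost everywhere.
  Two different representatives of one class would have inner product 1, so they cannot both belong
  to the set, and its cardinality is a true dimension count.\<close>

definition L2_orthonormal :: "'x measure \<Rightarrow> ('x \<Rightarrow> complex) set \<Rightarrow> bool" where
  "L2_orthonormal M B \<longleftrightarrow> B \<subseteq> L2 M \<and> (\<forall>b\<in>B. \<forall>b'\<in>B. L2_inner M b b' = (if b = b' then 1 else 0))"

lemma L2_orthonormal_combination:
  assumes "L2_orthonormal M B" "finite B"
  shows "(\<lambda>x. \<Sum>b\<in>B. c b * b x) \<in> L2 M"
    and "b' \<in> B \<Longrightarrow> L2_inner M (\<lambda>x. \<Sum>b\<in>B. c b * b x) b' = c b'"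
    and "(L2_norm M (\<lambda>x. \<Sum>b\<in>B. c b * b x))\<^sup>2 = (\<Sum>b\<in>B. (cmod (c b))\<^sup>2)"
proof -
  have B: "b \<in> B \<Longrightarrow> b \<in> L2 M" for b using assms by (auto simp: L2_orthonormal_def)
  show mem: "(\<lambda>x. \<Sum>b\<in>B. c b * b x) \<in> L2 M"
    using B by (intro L2_sum L2_scale)
  show inn: "L2_inner M (\<lambda>x. \<Sum>b\<in>B. c b * b x) b' = c b'" if "b' \<in> B" for b'
  proof -
    have "L2_inner M (\<lambda>x. \<Sum>b\<in>B. c b * b x) b' = (\<Sum>b\<in>B. c b * L2_inner M b b')"
      using B that by (subst L2_inner_sum_left) (auto intro: L2_scale simp: L2_inner_scale_left)
    also have "\<dots> = (\<Sum>b\<in>B. if b' = b then c b else 0)"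
      using assms(1) that by (intro sum.cong) (auto simp: L2_orthonormal_def)
    also have "\<dots> = c b'" using that assms(2) by simp
    finally show ?thesis .
  qed
  let ?f = "\<lambda>x. \<Sum>b\<in>B. c b * b x"
  have "of_real ((L2_norm M ?f)\<^sup>2) = L2_inner M ?f ?f" by (simp add: L2_inner_self)
  also have "\<dots> = (\<Sum>b\<in>B. L2_inner M (\<lambda>x. c b * b x) ?f)"
    using B mem by (intro L2_inner_sum_left L2_scale)
  also have "\<dots> = (\<Sum>b\<in>B. c b * L2_inner M b ?f)"
    by (simp only: L2_inner_scale_left)
  also have "\<dots> = (\<Sum>b\<in>B. c b * cnj (c b))"
  proof (intro sum.cong refl)
    fix b assume "b \<in> B"
    then show "c b * L2_inner M b ?f = c b * cnj (c b)"
      by (subst L2_inner_commute) (simp add: inn)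
  qed
  also have "\<dots> = of_real (\<Sum>b\<in>B. (cmod (c b))\<^sup>2)"
    by (simp only: complex_norm_square[symmetric] of_real_sum)
  finally show "(L2_norm M ?f)\<^sup>2 = (\<Sum>b\<in>B. (cmod (c b))\<^sup>2)"
    using of_real_eq_iff by blast
qed

lemma L2_orthonormal_residual:
  assumes "L2_orthonormal M B" "finite B" "f \<in> L2 M" "b \<in> B"
  shows "L2_inner M (\<lambda>x. f x - (\<Sum>b\<in>B. L2_inner M f b * b x)) b = 0"
  using assms L2_orthonormal_combination[OF assms(1,2), where c = "L2_inner M f"]
  by (subst L2_inner_diff_left) (auto simp: L2_orthonormal_def)

text \<open>Pythagoras: \<open>f\<close> is the sum of its projection \<open>?p\<close> and a
  residual orthogonal to it.\<close>

lemma L2_Bessel: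
  assumes "L2_orthonormal M B" "finite B" "f \<in> L2 M"
  shows "(\<Sum>b\<in>B. (cmod (L2_inner M f b))\<^sup>2) \<le> (L2_norm M f)\<^sup>2"
proof -
  let ?p = "\<lambda>x. \<Sum>b\<in>B. L2_inner M f b * b x"
  note p = L2_orthonormal_combination[OF assms(1,2), where c = "L2_inner M f"]
  have B: "b \<in> B \<Longrightarrow> b \<in> L2 M" for b using assms by (auto simp: L2_orthonormal_def)
  have r: "(\<lambda>x. f x - ?p x) \<in> L2 M" using assms p by (intro L2_diff)
  have "L2_inner M ?p (\<lambda>x. f x - ?p x) = (\<Sum>b\<in>B. L2_inner M f b * L2_inner M b (\<lambda>x. f x - ?p x))"
    using B r by (subst L2_inner_sum_left) (auto intro: L2_scale simp: L2_inner_scale_left)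
  also have "\<dots> = 0"
  proof (intro sum.neutral ballI)
    fix b assume "b \<in> B"
    then have "L2_inner M (\<lambda>x. f x - ?p x) b = 0"
      by (rule L2_orthonormal_residual[OF assms])
    then show "L2_inner M f b * L2_inner M b (\<lambda>x. f x - ?p x) = 0"
      by (subst (2) L2_inner_commute) simp
  qed
  finally have "L2_inner M ?p (\<lambda>x. f x - ?p x) = 0" .
  with L2_norm_add_sq[OF p(1) r]
  have "(L2_norm M f)\<^sup>2 = (L2_norm M ?p)\<^sup>2 + (L2_norm M (\<lambda>x. f x - ?p x))\<^sup>2"
    by simp
  then show ?thesis using p(3) by simp
qed

section \<open>Linear spans modulo null sets\<close>

lemma L2_spanI:
  assumes "f \<in> L2 M" "finite T" "T \<subseteq> B" "AE x in M. f x = (\<Sum>b\<in>T. c b * b x)"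
  shows "f \<in> L2_span M B"
  using assms unfolding L2_span_def by blast

lemma L2_spanE:
  assumes "f \<in> L2_span M B"
  obtains T c where "f \<in> L2 M" "finite T" "T \<subseteq> B" "AE x in M. f x = (\<Sum>b\<in>T. c b * b x)"
  using assms unfolding L2_span_def by blast

lemma L2_span_superset: "B \<subseteq> L2 M \<Longrightarrow> B \<subseteq> L2_span M B"
proof
  fix b assume "B \<subseteq> L2 M" "b \<in> B"
  then show "b \<in> L2_span M B" by (intro L2_spanI[of b M "{b}" B "\<lambda>_. 1"]) auto
qed

lemma L2_span_mono: "B \<subseteq> B' \<Longrightarrow> L2_span M B \<subseteq> L2_span M B'"
  unfolding L2_span_def by blast

lemma L2_span_zero: "(\<lambda>x. 0) \<in> L2_span M B"
  by (intro L2_spanI[of _ _ "{}"]) auto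

lemma L2_span_cong_AE:
  "f \<in> L2_span M B \<Longrightarrow> g \<in> L2 M \<Longrightarrow> AE x in M. g x = f x \<Longrightarrow> g \<in> L2_span M B"
  by (erule L2_spanE, rule L2_spanI) auto

lemma L2_span_scale:
  assumes "f \<in> L2_span M B" shows "(\<lambda>x. c * f x) \<in> L2_span M B"
proof -
  obtain T d where T: "f \<in> L2 M" "finite T" "T \<subseteq> B" "AE x in M. f x = (\<Sum>b\<in>T. d b * b x)"
    using assms by (rule L2_spanE)
  show ?thesis
    by (rule L2_spanI[of _ _ T B "\<lambda>b. c * d b"])
       (use T in \<open>auto intro: L2_scale simp: sum_distrib_left mult.assoc\<close>)
qed

lemma L2_span_add:
  assumes "f \<in> L2_span M B" "g \<in> L2_span M B" shows "(\<lambda>x. f x + g x) \<in> L2_span M B"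
proof -
  obtain T c where T: "f \<in> L2 M" "finite T" "T \<subseteq> B" "AE x in M. f x = (\<Sum>b\<in>T. c b * b x)"
    using assms(1) by (rule L2_spanE)
  obtain U d where U: "g \<in> L2 M" "finite U" "U \<subseteq> B" "AE x in M. g x = (\<Sum>b\<in>U. d b * b x)"
    using assms(2) by (rule L2_spanE)
  define e where "e b = (if b \<in> T then c b else 0) + (if b \<in> U then d b else 0)" for b
  have e: "(\<Sum>b\<in>T \<union> U. e b * b x) = (\<Sum>b\<in>T. c b * b x) + (\<Sum>b\<in>U. d b * b x)" for x
  proof -
    have "(\<Sum>b\<in>T \<union> U. e b * b x) = (\<Sum>b\<in>T \<union> U. (if b \<in> T then c b * b x else 0)) + (\<Sum>b\<in>T \<union> U. (if b \<in> U then d b * b x else 0))"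
      unfolding sum.distrib[symmetric] by (intro sum.cong) (auto simp: e_def distrib_right)
    also have "(\<Sum>b\<in>T \<union> U. (if b \<in> T then c b * b x else 0)) = (\<Sum>b\<in>T. c b * b x)"
      using T(2) U(2) by (subst sum.inter_restrict[symmetric]) (auto simp: Int_absorb1)
    also have "(\<Sum>b\<in>T \<union> U. (if b \<in> U then d b * b x else 0)) = (\<Sum>b\<in>U. d b * b x)"
      using T(2) U(2) by (subst sum.inter_restrict[symmetric]) (auto simp: Int_absorb1)
    finally show ?thesis .
  qed
  show ?thesis
    by (rule L2_spanI[of _ _ "T \<union> U" B e]) (use T U e in \<open>auto intro: L2_add\<close>)
qed

lemma L2_span_sum:
  assumes "\<And>i. i \<in> I \<Longrightarrow> f i \<in> L2_span M B" shows "(\<lambda>x. \<Sum>i\<in>I. f i x) \<in> L2_span M B"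
  using assms
  by (induction I rule: infinite_finite_induct) (auto intro: L2_span_add L2_span_zero)

lemma L2_span_subset: "L2_span M B \<subseteq> L2 M"
  by (auto simp: L2_span_def)

lemma L2_span_minimal:
  assumes "B \<subseteq> L2_span M B'" shows "L2_span M B \<subseteq> L2_span M B'"
proof
  fix f assume "f \<in> L2_span M B"
  then obtain T c where T: "f \<in> L2 M" "finite T" "T \<subseteq> B" "AE x in M. f x = (\<Sum>b\<in>T. c b * b x)"
    by (rule L2_spanE)
  have "(\<lambda>x. \<Sum>b\<in>T. c b * b x) \<in> L2_span M B'"
    using T assms by (intro L2_span_sum L2_span_scale) auto
  then show "f \<in> L2_span M B'" using T(1,4) by (rule L2_span_cong_AE)
qed

lemma L2_span_orthonormal:
  assumes "L2_orthonormal M B" "finite B" "f \<in> L2_span M B"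
  shows "AE x in M. f x = (\<Sum>b\<in>B. L2_inner M f b * b x)"
    and "(L2_norm M f)\<^sup>2 = (\<Sum>b\<in>B. (cmod (L2_inner M f b))\<^sup>2)"
proof -
  have B: "b \<in> B \<Longrightarrow> b \<in> L2 M" for b using assms by (auto simp: L2_orthonormal_def)
  obtain T c where T: "f \<in> L2 M" "finite T" "T \<subseteq> B" "AE x in M. f x = (\<Sum>b\<in>T. c b * b x)"
    using assms(3) by (rule L2_spanE)
  define d where "d b = (if b \<in> T then c b else 0)" for b
  have "(\<Sum>b\<in>B. d b * b x) = (\<Sum>b\<in>T. c b * b x)" for x
    using T assms(2) by (intro sum.mono_neutral_cong_right) (auto simp: d_def)
  with T have AE: "AE x in M. f x = (\<Sum>b\<in>B. d b * b x)" by simp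
  note comb = L2_orthonormal_combination[OF assms(1,2), where c = d]
  have d: "L2_inner M f b = d b" if "b \<in> B" for b
    using L2_inner_cong_AE[OF T(1) B[OF that] comb(1) AE] comb(2)[OF that] by simp
  then show "AE x in M. f x = (\<Sum>b\<in>B. L2_inner M f b * b x)" using AE by simp
  show "(L2_norm M f)\<^sup>2 = (\<Sum>b\<in>B. (cmod (L2_inner M f b))\<^sup>2)"
    using L2_norm_cong_AE[OF L2_measurable[OF T(1)] L2_measurable[OF comb(1)] AE] comb(3) d by simp
qed

text \<open>One Gram-Schmidt step, with \<open>e\<close> the normalized residual of
  \<open>f\<close>. The membership of \<open>f\<close> in the new span builds orthonormal bases; the
  membership of \<open>e\<close> in the span of \<open>f\<close> and \<open>B\<close> keeps
  \<open>e\<close> inside any subspace containing them, as the maximality argument in the top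
  eigenspace requires.\<close>

lemma L2_orthonormal_extend:
  assumes "L2_orthonormal M B" "finite B" "f \<in> L2 M" "f \<notin> L2_span M B"
  obtains e where "e \<notin> B" "L2_orthonormal M (insert e B)" "f \<in> L2_span M (insert e B)"
    "e \<in> L2_span M (insert f B)"
proof -
  have B: "B \<subseteq> L2 M" using assms by (auto simp: L2_orthonormal_def)
  let ?p = "\<lambda>x. \<Sum>b\<in>B. L2_inner M f b * b x"
  note p = L2_orthonormal_combination[OF assms(1,2), where c = "L2_inner M f"]
  define r where "r x = f x - ?p x" for x
  have r: "r \<in> L2 M" unfolding r_def using assms p by (intro L2_diff)
  have rb: "L2_inner M r b = 0" if "b \<in> B" for b
    unfolding r_def by (rule L2_orthonormal_residual[OF assms(1,2,3) that])
  have n: "L2_norm M r \<noteq> 0"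
  proof
    assume "L2_norm M r = 0"
    then have "AE x in M. r x = 0" using L2_norm_zero_iff[OF r] by simp
    then have "AE x in M. f x = ?p x" by eventually_elim (simp add: r_def)
    then have "f \<in> L2_span M B" using assms by (intro L2_spanI) auto
    with assms show False by simp
  qed
  define e where "e x = of_real (1 / L2_norm M r) * r x" for x
  have e: "e \<in> L2 M" unfolding e_def by (rule L2_scale[OF r])
  have eb: "L2_inner M e b = 0" if "b \<in> B" for b
    unfolding e_def using rb[OF that] by (simp only: L2_inner_scale_left) simp
  have be: "L2_inner M b e = 0" if "b \<in> B" for b
    using eb[OF that] L2_inner_commute[of M b e] by simp
  have "L2_norm M e = cmod (of_real (1 / L2_norm M r)) * L2_norm M r"
    unfolding e_def by (rule L2_norm_scale)
  also have "\<dots> = 1" using n by (simp add: norm_divide)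
  finally have ee: "L2_inner M e e = 1" by (simp add: L2_inner_self)
  have "e \<notin> B" using ee eb by auto
  moreover have "L2_orthonormal M (insert e B)"
    using assms(1) e ee eb be \<open>e \<notin> B\<close> by (auto simp: L2_orthonormal_def)
  moreover have "f \<in> L2_span M (insert e B)"
  proof -
    have "(\<lambda>x. of_real (L2_norm M r) * e x + ?p x) \<in> L2_span M (insert e B)"
      using L2_span_superset[of "insert e B" M] B e
      by (intro L2_span_add L2_span_scale L2_span_sum) auto
    moreover have "(\<lambda>x. of_real (L2_norm M r) * e x + ?p x) = f"
      using n by (auto simp: e_def r_def)
    ultimately show ?thesis by simp
  qed
  moreover have "e \<in> L2_span M (insert f B)"
  proof -
    have "(\<lambda>x. of_real (1 / L2_norm M r) * (f x + (-1) * ?p x)) \<in> L2_span M (insert f B)"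
      using L2_span_superset[of "insert f B" M] B assms
      by (intro L2_span_add L2_span_scale L2_span_sum) auto
    moreover have "(\<lambda>x. of_real (1 / L2_norm M r) * (f x + (-1) * ?p x)) = e"
      using n by (auto simp: e_def r_def)
    ultimately show ?thesis by simp
  qed
  ultimately show thesis by (rule that)
qed

lemma L2_orthonormal_basis_exists:
  assumes "finite B" "B \<subseteq> L2 M"
  shows "\<exists>B'. finite B' \<and> L2_orthonormal M B' \<and> L2_span M B \<subseteq> L2_span M B'"
  using assms
proof (induction B rule: finite_induct)
  case empty
  show ?case by (intro exI[of _ "{}"]) (auto simp: L2_orthonormal_def)
next
  case (insert f B)
  then obtain B' where B': "finite B'" "L2_orthonormal M B'" "L2_span M B \<subseteq> L2_span M B'" by auto
  have sub: "B \<subseteq> L2_span M B'" using insert.prems L2_span_superset[of B M] B'(3) by auto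
  show ?case
  proof (cases "f \<in> L2_span M B'")
    case True
    with sub have "L2_span M (insert f B) \<subseteq> L2_span M B'" by (intro L2_span_minimal) auto
    with B' show ?thesis by blast
  next
    case False
    from insert.prems have "f \<in> L2 M" by auto
    from L2_orthonormal_extend[OF B'(2,1) this False]
    obtain e where e: "L2_orthonormal M (insert e B')" "f \<in> L2_span M (insert e B')" by metis
    have "B \<subseteq> L2_span M (insert e B')" using sub L2_span_mono[of B' "insert e B'" M] by auto
    with e have "L2_span M (insert f B) \<subseteq> L2_span M (insert e B')" by (intro L2_span_minimal) auto
    with e B' show ?thesis by (intro exI[of _ "insert e B'"]) auto
  qed
qed

text \<open>The projection theorem for a subspace \<open>S\<close> that need not be closed: a
  minimizing sequence in \<open>S\<close> is Cauchy and has a limit \<open>p\<close> in L2, and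
  \<open>f - p\<close> is the vector sought. Its norm is the distance from \<open>f\<close> to
  \<open>S\<close>, positive because \<open>f\<close> lies outside the closure.\<close>

lemma (in prob_space) L2_orthogonal_vector_exists:
  assumes S: "S \<subseteq> L2 M" "(\<lambda>x. 0) \<in> S" "\<And>c v. v \<in> S \<Longrightarrow> (\<lambda>x. c * v x) \<in> S"
      "\<And>v w. v \<in> S \<Longrightarrow> w \<in> S \<Longrightarrow> (\<lambda>x. v x + w x) \<in> S"
    and f: "f \<in> L2 M" "f \<notin> L2_closure M S"
  obtains h where "h \<in> L2 M" "L2_norm M h > 0" "\<And>v. v \<in> S \<Longrightarrow> L2_inner M h v = 0"
proof -
  define D where "D = (\<lambda>v. L2_norm M (\<lambda>x. f x - v x)) ` S"
  define d where "d = Inf D"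
  have D: "D \<noteq> {}" "bdd_below D" using S(2) by (auto simp: D_def intro!: bdd_belowI[of _ 0])
  have d_le: "d \<le> L2_norm M (\<lambda>x. f x - v x)" if "v \<in> S" for v
    unfolding d_def using D that by (intro cInf_lower) (auto simp: D_def)
  have d0: "d \<ge> 0" unfolding d_def using D by (intro cInf_greatest) (auto simp: D_def)
  have ex: "\<exists>v\<in>S. L2_norm M (\<lambda>x. f x - v x) < d + e" if "e > 0" for e
    using cInf_lessD[OF D(1), of "d + e"] that by (auto simp: D_def d_def)
  have dpos: "d > 0"
  proof (rule ccontr)
    assume "\<not> d > 0"
    with d0 have "d = 0" by simp
    with ex f(1) have "f \<in> L2_closure M S" by (auto simp: L2_closure_def)
    with f show False by simp
  qed
  obtain h where h: "\<And>n. h n \<in> S" "\<And>n. L2_norm M (\<lambda>x. f x - h n x) < d + 1 / real (Suc n)"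
    using ex[of "1 / real (Suc n)" for n] by (metis of_nat_0_less_iff zero_less_Suc zero_less_divide_1_iff)
  have hL: "h n \<in> L2 M" for n using h S by auto
  \<comment> \<open>The midpoint of \<open>h m\<close> and \<open>h n\<close> is in
    \<open>S\<close>, so its distance from \<open>f\<close> is at least \<open>d\<close>; the
    parallelogram law then leaves little room for \<open>h m - h n\<close>.\<close>
  have diff: "(L2_norm M (\<lambda>x. h m x - h n x))\<^sup>2 \<le> 4 * (d + 1 / real (Suc N))\<^sup>2 - 4 * d\<^sup>2"
    if "m \<ge> N" "n \<ge> N" for m n N
  proof -
    have le: "(L2_norm M (\<lambda>x. f x - h k x))\<^sup>2 \<le> (d + 1 / real (Suc N))\<^sup>2" if "k \<ge> N" for k
    proof (rule power_mono)
      have "1 / real (Suc k) \<le> 1 / real (Suc N)" using that by (intro divide_left_mono) auto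
      with h(2)[of k] show "L2_norm M (\<lambda>x. f x - h k x) \<le> d + 1 / real (Suc N)" by linarith
    qed simp
    have mid: "(\<lambda>x. (1/2) * (h m x + h n x)) \<in> S" by (intro S h)
    have "d\<^sup>2 \<le> (L2_norm M (\<lambda>x. f x - (1/2) * (h m x + h n x)))\<^sup>2"
      using d_le[OF mid] d0 by (intro power_mono)
    also have "\<dots> = (L2_norm M (\<lambda>x. (1/2) * ((f x - h m x) + (f x - h n x))))\<^sup>2"
      by (intro arg_cong[where f="\<lambda>g. (L2_norm M g)\<^sup>2"] ext) (simp add: algebra_simps)
    also have "\<dots> = (L2_norm M (\<lambda>x. (f x - h m x) + (f x - h n x)))\<^sup>2 / 4"
      by (simp only: L2_norm_scale) (simp add: power_mult_distrib power2_eq_square)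
    finally have "4 * d\<^sup>2 \<le> (L2_norm M (\<lambda>x. (f x - h m x) + (f x - h n x)))\<^sup>2" by simp
    moreover have "L2_norm M (\<lambda>x. h m x - h n x) = L2_norm M (\<lambda>x. (f x - h n x) - (f x - h m x))"
      by (intro arg_cong[where f="L2_norm M"] ext) simp
    ultimately show ?thesis
      using L2_parallelogram[OF L2_diff[OF f(1) hL[of n]] L2_diff[OF f(1) hL[of m]]] le[of m] le[of n] that
      by (simp add: add.commute)
  qed
  have Cauchy: "\<exists>N. \<forall>m\<ge>N. \<forall>n\<ge>N. L2_norm M (\<lambda>x. h m x - h n x) < e" if "e > 0" for e
  proof -
    have "(\<lambda>N. 4 * (d + 1 / real (Suc N))\<^sup>2 - 4 * d\<^sup>2) \<longlonglongrightarrow> 4 * (d + 0)\<^sup>2 - 4 * d\<^sup>2"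
      by (intro tendsto_intros LIMSEQ_Suc[OF lim_1_over_n])
    then have "\<forall>\<^sub>F N in sequentially. 4 * (d + 1 / real (Suc N))\<^sup>2 - 4 * d\<^sup>2 < e\<^sup>2"
      using that by (intro order_tendstoD) auto
    then obtain N where N: "4 * (d + 1 / real (Suc N))\<^sup>2 - 4 * d\<^sup>2 < e\<^sup>2"
      by (auto simp: eventually_sequentially)
    show ?thesis
    proof (intro exI allI impI)
      fix m n assume "m \<ge> N" "n \<ge> N"
      then have "(L2_norm M (\<lambda>x. h m x - h n x))\<^sup>2 < e\<^sup>2" using order_le_less_trans[OF diff N] by blast
      then show "L2_norm M (\<lambda>x. h m x - h n x) < e"
        by (rule power2_less_imp_less) (use that in simp)
    qed
  qed
  from L2_complete[OF hL Cauchy] obtain p where p: "p \<in> L2 M"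
    and lim: "(\<lambda>n. L2_norm M (\<lambda>x. h n x - p x)) \<longlonglongrightarrow> 0" by auto
  define r where "r x = f x - p x" for x
  have r: "r \<in> L2 M" unfolding r_def by (intro L2_diff f p)
  \<comment> \<open>Since \<open>h n + v\<close> is again in \<open>S\<close>, its distance from
    \<open>f\<close> is at least \<open>d\<close>. In the limit this says that moving
    \<open>r\<close> by an element of \<open>S\<close> cannot bring its norm below
    \<open>d\<close>.\<close>
  have min: "L2_norm M r \<le> d" and ge: "v \<in> S \<Longrightarrow> d \<le> L2_norm M (\<lambda>x. r x - v x)" for v
  proof -
    have *: "(\<lambda>n. L2_norm M (\<lambda>x. f x - (h n x + v x))) \<longlonglongrightarrow> L2_norm M (\<lambda>x. r x - v x)"
      if "v \<in> S" for v
    proof (rule L2_norm_tendsto)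
      have vL: "v \<in> L2 M" using that S by auto
      show "(\<lambda>x. f x - (h n x + v x)) \<in> L2 M" for n by (intro L2_diff L2_add f hL vL)
      show "(\<lambda>x. r x - v x) \<in> L2 M" by (intro L2_diff r vL)
      have "L2_norm M (\<lambda>x. f x - (h n x + v x) - (r x - v x)) = L2_norm M (\<lambda>x. h n x - p x)" for n
        by (subst L2_norm_minus_commute) (simp add: r_def)
      with lim show "(\<lambda>n. L2_norm M (\<lambda>x. f x - (h n x + v x) - (r x - v x))) \<longlonglongrightarrow> 0" by simp
    qed
    have "(\<lambda>n. L2_norm M (\<lambda>x. f x - h n x)) \<longlonglongrightarrow> L2_norm M r"
      using *[OF S(2)] by simp
    moreover have "(\<lambda>n. d + 1 / real (Suc n)) \<longlonglongrightarrow> d + 0"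
      by (intro tendsto_intros LIMSEQ_Suc[OF lim_1_over_n])
    ultimately show "L2_norm M r \<le> d"
      using h(2) by (intro LIMSEQ_le[where Y="\<lambda>n. d + 1 / real (Suc n)"]) (auto intro: less_imp_le)
    show "d \<le> L2_norm M (\<lambda>x. r x - v x)" if "v \<in> S"
      using *[OF that] d_le S(4)[OF h(1) that] by (intro LIMSEQ_le_const) auto
  qed
  show thesis
  proof (rule that[OF r])
    from ge[OF S(2)] dpos show "0 < L2_norm M r" by simp
    fix v assume v: "v \<in> S"
    then have vL: "v \<in> L2 M" using S by auto
    define i where "i = L2_inner M r v"
    \<comment> \<open>A step length so short that the quadratic term in the expansion of the norm of
      \<open>r - c * v\<close> is at most half the linear gain
      \<open>2 * (t * (cmod i)\<^sup>2)\<close>. The summand 1 covers \<open>v\<close> of norm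
      0.\<close>
    define t where "t = 1 / ((L2_norm M v)\<^sup>2 + 1)"
    have "(L2_norm M v)\<^sup>2 + 1 > 0" by (intro add_nonneg_pos) auto
    then have t: "t > 0" "t * (L2_norm M v)\<^sup>2 < 1"
      unfolding t_def by (simp_all add: divide_less_eq)
    define c where "c = of_real t * i"
    have "L2_inner M r (\<lambda>x. c * v x) = cnj c * i"
      by (subst L2_inner_commute, subst L2_inner_scale_left, subst L2_inner_commute) (simp add: i_def)
    also have "\<dots> = of_real (t * (cmod i)\<^sup>2)"
      by (simp add: c_def complex_norm_square[of i] mult.commute mult.left_commute del: of_real_power)
    finally have inn: "L2_inner M r (\<lambda>x. c * v x) = of_real (t * (cmod i)\<^sup>2)" .
    have "(L2_norm M r)\<^sup>2 \<le> (L2_norm M (\<lambda>x. r x - c * v x))\<^sup>2"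
      using min ge[OF S(3)[OF v, of c]] by (intro power_mono) auto
    also have "\<dots> = (L2_norm M r)\<^sup>2 - 2 * (t * (cmod i)\<^sup>2) + (t * cmod i * L2_norm M v)\<^sup>2"
      using L2_norm_diff_sq[OF r L2_scale[OF vL, of c]] inn t
      by (simp add: L2_norm_scale c_def norm_mult)
    also have "(t * cmod i * L2_norm M v)\<^sup>2 = (t * (cmod i)\<^sup>2) * (t * (L2_norm M v)\<^sup>2)"
      by (simp add: power2_eq_square)
    also have "\<dots> \<le> (t * (cmod i)\<^sup>2) * 1"
      using t by (intro mult_left_mono) auto
    finally have "t * (cmod i)\<^sup>2 \<le> 0" by simp
    with t have "i = 0" by (simp add: mult_le_0_iff)
    then show "L2_inner M r v = 0" by (simp add: i_def)
  qed
qed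

section \<open>Almost periodic functions\<close>

lemma compact_bounded_functions:
  fixes b :: "'i \<Rightarrow> real"
  shows "compact (Pi\<^sub>E UNIV (\<lambda>i. cball (0::'a::{heine_borel,real_normed_vector}) (b i)))"
proof -
  have "compactin (product_topology (\<lambda>i::'i. euclidean :: 'a topology) UNIV) (Pi\<^sub>E UNIV (\<lambda>i. cball 0 (b i)))"
    unfolding compactin_PiE by auto
  then show ?thesis by (simp add: euclidean_product_topology)
qed

text \<open>By Tychonoff's theorem the sequence \<open>n \<mapsto> (s \<mapsto> s n)\<close> has a cluster point in a product of
  compact intervals.\<close>

lemma universal_filter_exists:
  obtains FF :: "nat filter" where "FF \<noteq> bot" "FF \<le> sequentially"
    "\<And>s::nat \<Rightarrow> real. Bseq s \<Longrightarrow> \<exists>l. (s \<longlongrightarrow> l) FF"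
proof -
  have "\<exists>b. Bseq s \<longrightarrow> (\<forall>n. norm (s n) \<le> b)" for s :: "nat \<Rightarrow> real"
    by (auto simp: Bseq_def)
  then obtain b where b: "\<And>(s :: nat \<Rightarrow> real) n. Bseq s \<Longrightarrow> norm (s n) \<le> b s" by metis
  define K where "K = Pi\<^sub>E UNIV (\<lambda>s::nat \<Rightarrow> real. cball (0::real) (if Bseq s then b s else 0))"
  \<comment> \<open>Unbounded sequences get the constant coordinate 0, matching the radius 0 in
    \<open>K\<close>, so that all points \<open>p n\<close> lie in the compact set.\<close>
  define p where "p n = (\<lambda>s::nat \<Rightarrow> real. if Bseq s then s n else 0)" for n
  have "compact K" unfolding K_def by (rule compact_bounded_functions)
  moreover have "p n \<in> K" for n unfolding p_def K_def using b by auto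
  then have "eventually (\<lambda>x. x \<in> K) (filtermap p sequentially)" by (simp add: eventually_filtermap)
  ultimately obtain x where x: "inf (nhds x) (filtermap p sequentially) \<noteq> bot"
    unfolding compact_filter by (metis filtermap_bot_iff sequentially_bot)
  \<comment> \<open>Generated by the tails and the preimages under \<open>p\<close> of
    neighbourhoods of \<open>x\<close>. It is nontrivial because \<open>x\<close> is a cluster
    point, and convergence of \<open>s\<close> along it is convergence of the coordinate of
    \<open>p\<close> with index \<open>s\<close>.\<close>
  define FF where "FF = inf (filtercomap p (nhds x)) sequentially"
  show thesis
  proof (rule that)
    show "FF \<noteq> bot"
    proof
      assume "FF = bot"
      then have "eventually (\<lambda>_. False) FF" by simp
      then obtain A B where AB: "eventually A (nhds x)" "eventually B sequentially"
        "\<And>n. A (p n) \<Longrightarrow> \<not> B n"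
        unfolding FF_def eventually_inf eventually_filtercomap by blast
      from AB(2) have "eventually (\<lambda>y. \<not> A y) (filtermap p sequentially)"
        unfolding eventually_filtermap by (rule eventually_mono) (use AB(3) in blast)
      with AB(1) have "eventually (\<lambda>_. False) (inf (nhds x) (filtermap p sequentially))"
        unfolding eventually_inf by blast
      with x show False by (simp add: trivial_limit_def)
    qed
    show "FF \<le> sequentially" by (simp add: FF_def)
    have lim: "filterlim p (nhds x) FF"
      unfolding FF_def by (rule filterlim_mono[OF filterlim_filtercomap order_refl inf_le1])
    show "\<exists>l. (s \<longlongrightarrow> l) FF" if "Bseq s" for s :: "nat \<Rightarrow> real"
    proof (intro exI topological_tendstoI)
      fix U :: "real set" assume U: "open U" "x s \<in> U"
      have "open ((\<lambda>y. y s) -` U)" by (rule open_vimage[OF U(1) continuous_on_product_coordinates])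
      then have "\<forall>\<^sub>F n in FF. p n \<in> (\<lambda>y. y s) -` U"
        using U(2) by (intro topological_tendstoD[OF lim]) auto
      with that show "\<forall>\<^sub>F n in FF. s n \<in> U" by (simp add: p_def)
    qed
  qed
qed

section \<open>The unitary action on L2 and its almost periodic vectors\<close>

context G_MPS
begin

lemma space_eq_UNIV [simp]: "space M = UNIV"
  using sets_eq_imp_space_eq[OF sets_eq_borel] by simp

lemma action_measurable: "g \<in> carrier G \<Longrightarrow> \<phi> g \<in> measurable M M"
  using borel_measurable_continuous_onI[OF continuous_action] measurable_cong_sets[OF sets_eq_borel sets_eq_borel]
  by blast

lemma is_group: "group G"
  using group_hom group_hom_def by blast

lemma action_mult:
  assumes "g \<in> carrier G" "h \<in> carrier G" shows "\<phi> (g \<otimes> h) x = \<phi> g (\<phi> h x)"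
  using composition_rule[OF _ assms] by simp

lemma action_one: "\<phi> \<one> x = x"
  using id_eq_one by (metis UNIV_I restrict_apply')

lemma action_inv:
  assumes "g \<in> carrier G"
  shows "\<phi> (inv g) (\<phi> g x) = x" and "\<phi> g (\<phi> (inv g) x) = x"
  using action_mult[of "inv g" g x] action_mult[of g "inv g" x] assms is_group
  by (simp_all add: action_one group.l_inv group.r_inv)

lemma integral_action:
  assumes "g \<in> carrier G" and [measurable]: "f \<in> borel_measurable M"
  shows "(\<integral>x. f (\<phi> g x) \<partial>M) = (\<integral>x. (f x :: 'c::{banach,second_countable_topology}) \<partial>M)"
  using integral_distr[OF action_measurable[OF assms(1)] assms(2)] invariant_measure[OF assms(1)]
  by simp

lemma sets_action: "g \<in> carrier G \<Longrightarrow> A \<in> sets M \<Longrightarrow> \<phi> g -` A \<in> sets M"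
  using measurable_sets[OF action_measurable] by auto

lemma L2_action:
  assumes "g \<in> carrier G" "f \<in> L2 M" shows "(\<lambda>x. f (\<phi> g x)) \<in> L2 M"
proof -
  note [measurable] = action_measurable[OF assms(1)] L2_measurable[OF assms(2)]
  have "integrable (distr M M (\<phi> g)) (\<lambda>x. (cmod (f x))\<^sup>2)"
    using L2_integrable_sq[OF assms(2)] invariant_measure[OF assms(1)] by simp
  then have "integrable M (\<lambda>x. (cmod (f (\<phi> g x)))\<^sup>2)"
    by (rule integrable_distr[rotated]) measurable
  then show ?thesis by (simp add: L2_def)
qed

lemma L2_norm_action:
  assumes "g \<in> carrier G" "f \<in> L2 M" shows "L2_norm M (\<lambda>x. f (\<phi> g x)) = L2_norm M f"
proof -
  note [measurable] = L2_measurable[OF assms(2)]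
  show ?thesis
    using integral_action[OF assms(1), of "\<lambda>x. (cmod (f x))\<^sup>2"] by (simp add: L2_norm_def)
qed

lemma L2_inner_action:
  assumes "g \<in> carrier G" "f \<in> L2 M" "h \<in> L2 M"
  shows "L2_inner M (\<lambda>x. f (\<phi> g x)) (\<lambda>x. h (\<phi> g x)) = L2_inner M f h"
proof -
  note [measurable] = L2_measurable[OF assms(2)] L2_measurable[OF assms(3)]
  show ?thesis
    using integral_action[OF assms(1), of "\<lambda>x. f x * cnj (h x)"] by (simp add: L2_inner_def)
qed

lemma L2_inner_action_left:
  assumes "g \<in> carrier G" "f \<in> L2 M" "h \<in> L2 M"
  shows "L2_inner M (\<lambda>x. f (\<phi> g x)) h = L2_inner M f (\<lambda>x. h (\<phi> (inv g) x))"
  using L2_inner_action[OF assms(1,2) L2_action[OF _ assms(3), of "inv g"]] assms(1) is_group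
  by (simp add: action_inv group.inv_closed)

text \<open>Total boundedness is encoded by a finite colouring of the group whose colour classes
  move \<open>f\<close> to nearby functions. No centres are mentioned, so colourings can be combined
  by pairing and tupling, or obtained by rounding coordinates.\<close>

definition almost_periodic :: "('x \<Rightarrow> complex) \<Rightarrow> bool" where
  "almost_periodic f \<longleftrightarrow> (\<forall>e>0. \<exists>c::'g \<Rightarrow> nat. finite (c ` carrier G) \<and>
     (\<forall>g\<in>carrier G. \<forall>h\<in>carrier G. c g = c h \<longrightarrow> L2_norm M (\<lambda>x. f (\<phi> g x) - f (\<phi> h x)) < e))"

text \<open>Finitely many colours of any type inject into the naturals, so pairs, tuples of integers
  or sets may serve as colours.\<close>

lemma almost_periodicI:
  assumes "\<And>e. e > 0 \<Longrightarrow> \<exists>c::'g \<Rightarrow> 'c. finite (c ` carrier G) \<and>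
     (\<forall>g\<in>carrier G. \<forall>h\<in>carrier G. c g = c h \<longrightarrow> L2_norm M (\<lambda>x. f (\<phi> g x) - f (\<phi> h x)) < e)"
  shows "almost_periodic f"
  unfolding almost_periodic_def
proof (intro allI impI)
  fix e :: real assume "e > 0"
  then obtain c :: "'g \<Rightarrow> 'c" where c: "finite (c ` carrier G)"
    "\<And>g h. g \<in> carrier G \<Longrightarrow> h \<in> carrier G \<Longrightarrow> c g = c h \<Longrightarrow> L2_norm M (\<lambda>x. f (\<phi> g x) - f (\<phi> h x)) < e"
    using assms by metis
  obtain n :: "'c \<Rightarrow> nat" where n: "inj_on n (c ` carrier G)"
    using c(1) finite_imp_inj_to_nat_seg by metis
  show "\<exists>c::'g \<Rightarrow> nat. finite (c ` carrier G) \<and>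
     (\<forall>g\<in>carrier G. \<forall>h\<in>carrier G. c g = c h \<longrightarrow> L2_norm M (\<lambda>x. f (\<phi> g x) - f (\<phi> h x)) < e)"
  proof (intro exI[of _ "n \<circ> c"] conjI ballI impI)
    show "finite ((n \<circ> c) ` carrier G)" using finite_imageI[OF c(1), of n] by (simp add: image_comp)
    fix g h assume "g \<in> carrier G" "h \<in> carrier G" "(n \<circ> c) g = (n \<circ> c) h"
    then show "L2_norm M (\<lambda>x. f (\<phi> g x) - f (\<phi> h x)) < e"
      using n c(2)[of g h] by (auto simp: inj_on_def)
  qed
qed

lemma almost_periodicD:
  assumes "almost_periodic f" "e > 0"
  obtains c :: "'g \<Rightarrow> nat" where "finite (c ` carrier G)"
    "\<And>g h. g \<in> carrier G \<Longrightarrow> h \<in> carrier G \<Longrightarrow> c g = c h \<Longrightarrow> L2_norm M (\<lambda>x. f (\<phi> g x) - f (\<phi> h x)) < e"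
  using assms unfolding almost_periodic_def by metis

lemma almost_periodic_net:
  assumes "almost_periodic f" "e > 0"
  obtains K where "finite K" "K \<subseteq> carrier G"
    "\<And>g. g \<in> carrier G \<Longrightarrow> \<exists>k\<in>K. L2_norm M (\<lambda>x. f (\<phi> g x) - f (\<phi> k x)) < e"
proof -
  obtain c :: "'g \<Rightarrow> nat" where c: "finite (c ` carrier G)"
    "\<And>g h. g \<in> carrier G \<Longrightarrow> h \<in> carrier G \<Longrightarrow> c g = c h \<Longrightarrow> L2_norm M (\<lambda>x. f (\<phi> g x) - f (\<phi> h x)) < e"
    using assms by (rule almost_periodicD) blast
  define s where "s y = (SOME g. g \<in> carrier G \<and> c g = y)" for y
  have s: "s (c g) \<in> carrier G \<and> c (s (c g)) = c g" if "g \<in> carrier G" for g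
    unfolding s_def using that by (intro someI_ex[of "\<lambda>h. h \<in> carrier G \<and> c h = c g"]) auto
  show thesis
  proof (rule that[of "s ` (c ` carrier G)"])
    show "finite (s ` (c ` carrier G))" using c(1) by simp
    show "s ` (c ` carrier G) \<subseteq> carrier G" using s by auto
    show "\<exists>k\<in>s ` (c ` carrier G). L2_norm M (\<lambda>x. f (\<phi> g x) - f (\<phi> k x)) < e" if "g \<in> carrier G" for g
      using c(2)[OF that, of "s (c g)"] s[OF that] that by auto
  qed
qed

text \<open>Almost periodicity is closed in norm: by invariance an approximation of \<open>f\<close>
  is equally good along the whole orbit, and \<open>e\<close> splits into three thirds.\<close>

lemma almost_periodic_approx:
  assumes f: "f \<in> L2 M"
    and approx: "\<And>e. e > 0 \<Longrightarrow> \<exists>h. h \<in> L2 M \<and> almost_periodic h \<and> L2_norm M (\<lambda>x. f x - h x) < e"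
  shows "almost_periodic f"
proof (rule almost_periodicI)
  fix e :: real assume "e > 0"
  then obtain u where u: "u \<in> L2 M" "almost_periodic u" "L2_norm M (\<lambda>x. f x - u x) < e/3"
    using approx[of "e/3"] by auto
  have "e/3 > 0" using \<open>e > 0\<close> by simp
  with u(2) obtain c :: "'g \<Rightarrow> nat" where c: "finite (c ` carrier G)"
    "\<And>g h. g \<in> carrier G \<Longrightarrow> h \<in> carrier G \<Longrightarrow> c g = c h \<Longrightarrow> L2_norm M (\<lambda>x. u (\<phi> g x) - u (\<phi> h x)) < e/3"
    by (rule almost_periodicD) blast
  show "\<exists>c::'g \<Rightarrow> nat. finite (c ` carrier G) \<and>
     (\<forall>g\<in>carrier G. \<forall>h\<in>carrier G. c g = c h \<longrightarrow> L2_norm M (\<lambda>x. f (\<phi> g x) - f (\<phi> h x)) < e)"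
  proof (intro exI[of _ c] conjI ballI impI c(1))
    fix g h assume gh: "g \<in> carrier G" "h \<in> carrier G" "c g = c h"
    have d: "L2_norm M (\<lambda>x. f (\<phi> k x) - u (\<phi> k x)) < e/3" if "k \<in> carrier G" for k
      using L2_norm_action[OF that L2_diff[OF f u(1)]] u(3) by simp
    have "L2_norm M (\<lambda>x. f (\<phi> g x) - f (\<phi> h x)) \<le> L2_norm M (\<lambda>x. f (\<phi> g x) - u (\<phi> g x)) +
        L2_norm M (\<lambda>x. u (\<phi> g x) - f (\<phi> h x))"
      using gh f u by (intro L2_norm_triangle_diff L2_action)
    also have "L2_norm M (\<lambda>x. u (\<phi> g x) - f (\<phi> h x)) \<le> L2_norm M (\<lambda>x. u (\<phi> g x) - u (\<phi> h x)) +
        L2_norm M (\<lambda>x. u (\<phi> h x) - f (\<phi> h x))"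
      using gh f u by (intro L2_norm_triangle_diff L2_action)
    also have "L2_norm M (\<lambda>x. u (\<phi> h x) - f (\<phi> h x)) = L2_norm M (\<lambda>x. f (\<phi> h x) - u (\<phi> h x))"
      by (rule L2_norm_minus_commute)
    finally show "L2_norm M (\<lambda>x. f (\<phi> g x) - f (\<phi> h x)) < e"
      using d[OF gh(1)] d[OF gh(2)] c(2)[OF gh] by simp
  qed
qed

lemma almost_periodic_add:
  assumes "u \<in> L2 M" "v \<in> L2 M" "almost_periodic u" "almost_periodic v"
  shows "almost_periodic (\<lambda>x. u x + v x)"
proof (rule almost_periodicI)
  fix e :: real assume "e > 0"
  then have "e/2 > 0" by simp
  obtain c :: "'g \<Rightarrow> nat" where c: "finite (c ` carrier G)"
    "\<And>g h. g \<in> carrier G \<Longrightarrow> h \<in> carrier G \<Longrightarrow> c g = c h \<Longrightarrow> L2_norm M (\<lambda>x. u (\<phi> g x) - u (\<phi> h x)) < e/2"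
    using assms(3) \<open>e/2 > 0\<close> by (rule almost_periodicD) blast
  obtain d :: "'g \<Rightarrow> nat" where d: "finite (d ` carrier G)"
    "\<And>g h. g \<in> carrier G \<Longrightarrow> h \<in> carrier G \<Longrightarrow> d g = d h \<Longrightarrow> L2_norm M (\<lambda>x. v (\<phi> g x) - v (\<phi> h x)) < e/2"
    using assms(4) \<open>e/2 > 0\<close> by (rule almost_periodicD) blast
  show "\<exists>c::'g \<Rightarrow> nat \<times> nat. finite (c ` carrier G) \<and>
     (\<forall>g\<in>carrier G. \<forall>h\<in>carrier G. c g = c h \<longrightarrow>
        L2_norm M (\<lambda>x. u (\<phi> g x) + v (\<phi> g x) - (u (\<phi> h x) + v (\<phi> h x))) < e)"
  proof (intro exI[of _ "\<lambda>g. (c g, d g)"] conjI ballI impI)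
    show "finite ((\<lambda>g. (c g, d g)) ` carrier G)"
      using c(1) d(1) by (auto intro: finite_subset[of _ "c ` carrier G \<times> d ` carrier G"])
    fix g h assume gh: "g \<in> carrier G" "h \<in> carrier G" "(c g, d g) = (c h, d h)"
    have "L2_norm M (\<lambda>x. (u (\<phi> g x) - u (\<phi> h x)) + (v (\<phi> g x) - v (\<phi> h x)))
      \<le> L2_norm M (\<lambda>x. u (\<phi> g x) - u (\<phi> h x)) + L2_norm M (\<lambda>x. v (\<phi> g x) - v (\<phi> h x))"
      using gh assms by (intro L2_norm_triangle L2_diff L2_action)
    also have "\<dots> < e" using c(2)[OF gh(1,2)] d(2)[OF gh(1,2)] gh(3) by simp
    finally show "L2_norm M (\<lambda>x. u (\<phi> g x) + v (\<phi> g x) - (u (\<phi> h x) + v (\<phi> h x))) < e"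
      by (simp add: algebra_simps)
  qed
qed

lemma almost_periodic_scale:
  assumes "almost_periodic u"
  shows "almost_periodic (\<lambda>x. a * u x)"
proof (rule almost_periodicI)
  fix e :: real assume e: "e > 0"
  have pos: "e / (cmod a + 1) > 0" using e by (simp add: add_nonneg_pos)
  obtain c :: "'g \<Rightarrow> nat" where c: "finite (c ` carrier G)"
    "\<And>g h. g \<in> carrier G \<Longrightarrow> h \<in> carrier G \<Longrightarrow> c g = c h \<Longrightarrow> L2_norm M (\<lambda>x. u (\<phi> g x) - u (\<phi> h x)) < e / (cmod a + 1)"
    using assms pos by (rule almost_periodicD) blast
  show "\<exists>c::'g \<Rightarrow> nat. finite (c ` carrier G) \<and>
     (\<forall>g\<in>carrier G. \<forall>h\<in>carrier G. c g = c h \<longrightarrow> L2_norm M (\<lambda>x. a * u (\<phi> g x) - a * u (\<phi> h x)) < e)"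
  proof (intro exI[of _ c] conjI ballI impI c(1))
    fix g h assume gh: "g \<in> carrier G" "h \<in> carrier G" "c g = c h"
    have "L2_norm M (\<lambda>x. a * u (\<phi> g x) - a * u (\<phi> h x)) = cmod a * L2_norm M (\<lambda>x. u (\<phi> g x) - u (\<phi> h x))"
      by (simp add: L2_norm_scale flip: right_diff_distrib)
    also have "\<dots> \<le> cmod a * (e / (cmod a + 1))"
      using c(2)[OF gh] by (intro mult_left_mono) auto
    also have "\<dots> = e * (cmod a / (cmod a + 1))" by simp
    also have "\<dots> < e * 1"
      using e by (intro mult_strict_left_mono) (auto simp: divide_less_eq add_nonneg_pos)
    finally show "L2_norm M (\<lambda>x. a * u (\<phi> g x) - a * u (\<phi> h x)) < e" by simp
  qed
qed

lemma almost_periodic_zero: "almost_periodic (\<lambda>x. 0)"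
  by (rule almost_periodicI[where 'c = unit]) (auto simp: L2_norm_def)

lemma almost_periodic_sum:
  assumes "\<And>i. i \<in> I \<Longrightarrow> u i \<in> L2 M" "\<And>i. i \<in> I \<Longrightarrow> almost_periodic (u i)"
  shows "almost_periodic (\<lambda>x. \<Sum>i\<in>I. u i x)"
  using assms
proof (induction I rule: infinite_finite_induct)
  case (insert i I)
  then have "almost_periodic (\<lambda>x. u i x + (\<Sum>i\<in>I. u i x))"
    by (intro almost_periodic_add L2_sum) auto
  with insert.hyps show ?case by simp
qed (simp_all add: almost_periodic_zero)

lemma almost_periodic_cong_AE:
  assumes "u \<in> L2 M" "v \<in> L2 M" "AE x in M. u x = v x" "almost_periodic v"
  shows "almost_periodic u"
proof (rule almost_periodic_approx[OF assms(1)])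
  fix e :: real assume "e > 0"
  have "L2_norm M (\<lambda>x. u x - v x) = 0"
    using L2_norm_zero_iff[OF L2_diff[OF assms(1,2)]] assms(3) by simp
  with \<open>e > 0\<close> assms show "\<exists>h. h \<in> L2 M \<and> almost_periodic h \<and> L2_norm M (\<lambda>x. u x - h x) < e"
    by (intro exI[of _ v]) auto
qed

end

section \<open>The averaged quadratic form\<close>

locale averaged_form = G_MPS G \<phi> M
  for G :: "('g, 'b) monoid_scheme" (structure)
    and \<phi> :: "'g \<Rightarrow> 'x::metric_space \<Rightarrow> 'x"
    and M :: "'x measure" +
  fixes F :: "nat \<Rightarrow> 'g set" and FF :: "nat filter" and f :: "'x \<Rightarrow> complex"
  assumes folner: "folner_sequence G F"
    and FF: "FF \<noteq> bot" "FF \<le> sequentially" "\<And>s::nat \<Rightarrow> real. Bseq s \<Longrightarrow> \<exists>l. (s \<longlongrightarrow> l) FF"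
    and f: "f \<in> L2 M"
begin

definition coefficient :: "('x \<Rightarrow> complex) \<Rightarrow> 'g \<Rightarrow> complex" where
  "coefficient u g = L2_inner M u (\<lambda>x. f (\<phi> g x))"

definition average_form :: "nat \<Rightarrow> ('x \<Rightarrow> complex) \<Rightarrow> real" where
  "average_form n u = (\<Sum>h\<in>F n. (cmod (coefficient u (inv h)))\<^sup>2) / card (F n)"

definition limit_form :: "('x \<Rightarrow> complex) \<Rightarrow> real" where
  "limit_form u = Lim FF (\<lambda>n. average_form n u)"

lemma F_finite: "finite (F n)" and F_carrier: "h \<in> F n \<Longrightarrow> h \<in> carrier G"
  using folner by (auto simp: folner_sequence_def)

lemma F_card_pos: "card (F n) > 0"
proof -
  have "\<one> \<in> F n"
    using folner incseqD[of F 0 n] by (auto simp: folner_sequence_def)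
  then show ?thesis using F_finite card_gt_0_iff by blast
qed

lemma inv_carrier: "h \<in> carrier G \<Longrightarrow> inv h \<in> carrier G"
  using is_group by (rule group.inv_closed)

lemma coefficient_le:
  assumes "u \<in> L2 M" "g \<in> carrier G"
  shows "cmod (coefficient u g) \<le> L2_norm M u * L2_norm M f"
  using L2_Cauchy_Schwarz[OF assms(1) L2_action[OF assms(2) f]] L2_norm_action[OF assms(2) f]
  by (simp add: coefficient_def)

lemma coefficient_add:
  assumes "u \<in> L2 M" "v \<in> L2 M" "g \<in> carrier G"
  shows "coefficient (\<lambda>x. u x + v x) g = coefficient u g + coefficient v g"
  unfolding coefficient_def using assms f by (intro L2_inner_add_left L2_action)

lemma coefficient_diff:
  assumes "u \<in> L2 M" "v \<in> L2 M" "g \<in> carrier G"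
  shows "coefficient (\<lambda>x. u x - v x) g = coefficient u g - coefficient v g"
  unfolding coefficient_def using assms f by (intro L2_inner_diff_left L2_action)

lemma average_form_mono:
  assumes "\<And>h. h \<in> carrier G \<Longrightarrow> (cmod (coefficient u h))\<^sup>2 \<le> C"
  shows "average_form n u \<le> C"
proof -
  have "(\<Sum>h\<in>F n. (cmod (coefficient u (inv h)))\<^sup>2) \<le> of_nat (card (F n)) * C"
    using assms by (intro sum_bounded_above) (auto intro: inv_carrier F_carrier)
  then show ?thesis using F_card_pos[of n] by (simp add: average_form_def divide_le_eq mult.commute)
qed

lemma average_form_nonneg: "0 \<le> average_form n u"
  by (simp add: average_form_def sum_nonneg)

lemma average_form_le:
  assumes "u \<in> L2 M" shows "average_form n u \<le> (L2_norm M u * L2_norm M f)\<^sup>2"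
  using assms by (intro average_form_mono power_mono coefficient_le) auto

lemma average_form_tendsto:
  assumes "u \<in> L2 M" shows "((\<lambda>n. average_form n u) \<longlongrightarrow> limit_form u) FF"
proof -
  have "Bseq (\<lambda>n. average_form n u)"
    using average_form_le[OF assms] average_form_nonneg by (intro BseqI'[of _ "(L2_norm M u * L2_norm M f)\<^sup>2"]) simp
  then show ?thesis using FF(3) tendsto_Lim[OF FF(1)] unfolding limit_form_def by metis
qed

lemma limit_form_eqI:
  assumes "u \<in> L2 M" "((\<lambda>n. average_form n u) \<longlongrightarrow> l) FF" shows "limit_form u = l"
  using tendsto_unique[OF FF(1) average_form_tendsto[OF assms(1)] assms(2)] .

lemma limit_form_nonneg: "u \<in> L2 M \<Longrightarrow> 0 \<le> limit_form u"
  using tendsto_lowerbound[OF average_form_tendsto always_eventually FF(1)] average_form_nonneg by blast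

lemma limit_form_mono:
  assumes "u \<in> L2 M" "\<And>h. h \<in> carrier G \<Longrightarrow> (cmod (coefficient u h))\<^sup>2 \<le> C"
  shows "limit_form u \<le> C"
  using average_form_mono[OF assms(2)] by (intro tendsto_upperbound[OF average_form_tendsto[OF assms(1)] always_eventually FF(1)]) auto

lemma limit_form_le: "u \<in> L2 M \<Longrightarrow> limit_form u \<le> (L2_norm M u * L2_norm M f)\<^sup>2"
  by (intro limit_form_mono power_mono coefficient_le) auto

text \<open>With \<open>limit_form_scale\<close> this is all that is used of the quadratic form; it
  stands in for the associated sesquilinear form, which is not introduced.\<close>

lemma limit_form_parallelogram:
  assumes "u \<in> L2 M" "v \<in> L2 M"
  shows "limit_form (\<lambda>x. u x + v x) + limit_form (\<lambda>x. u x - v x) = 2 * limit_form u + 2 * limit_form v"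
proof -
  have p: "(cmod (a + b))\<^sup>2 + (cmod (a - b))\<^sup>2 = 2 * (cmod a)\<^sup>2 + 2 * (cmod b)\<^sup>2" for a b
    unfolding cmod_power2 by (simp add: power2_eq_square algebra_simps)
  have "average_form n (\<lambda>x. u x + v x) + average_form n (\<lambda>x. u x - v x) = 2 * average_form n u + 2 * average_form n v" for n
  proof -
    have "(\<Sum>h\<in>F n. (cmod (coefficient (\<lambda>x. u x + v x) (inv h)))\<^sup>2) + (\<Sum>h\<in>F n. (cmod (coefficient (\<lambda>x. u x - v x) (inv h)))\<^sup>2)
      = (\<Sum>h\<in>F n. 2 * (cmod (coefficient u (inv h)))\<^sup>2 + 2 * (cmod (coefficient v (inv h)))\<^sup>2)"
      unfolding sum.distrib[symmetric]
      using assms by (intro sum.cong) (auto simp: coefficient_add coefficient_diff inv_carrier F_carrier p)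
    also have "\<dots> = 2 * (\<Sum>h\<in>F n. (cmod (coefficient u (inv h)))\<^sup>2) + 2 * (\<Sum>h\<in>F n. (cmod (coefficient v (inv h)))\<^sup>2)"
      by (simp add: sum.distrib sum_distrib_left)
    finally show ?thesis unfolding average_form_def by (simp flip: add_divide_distrib)
  qed
  moreover have "((\<lambda>n. average_form n (\<lambda>x. u x + v x) + average_form n (\<lambda>x. u x - v x)) \<longlongrightarrow> limit_form (\<lambda>x. u x + v x) + limit_form (\<lambda>x. u x - v x)) FF"
    using assms by (intro tendsto_add average_form_tendsto L2_add L2_diff)
  moreover have "((\<lambda>n. 2 * average_form n u + 2 * average_form n v) \<longlongrightarrow> 2 * limit_form u + 2 * limit_form v) FF"
    using assms by (intro tendsto_intros average_form_tendsto)
  ultimately show ?thesis using tendsto_unique[OF FF(1)] by simp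
qed

lemma limit_form_scale:
  assumes "u \<in> L2 M" shows "limit_form (\<lambda>x. c * u x) = (cmod c)\<^sup>2 * limit_form u"
proof (rule limit_form_eqI[OF L2_scale[OF assms]])
  have "average_form n (\<lambda>x. c * u x) = (cmod c)\<^sup>2 * average_form n u" for n
    by (simp add: average_form_def coefficient_def L2_inner_scale_left norm_mult power_mult_distrib sum_distrib_left)
  then show "((\<lambda>n. average_form n (\<lambda>x. c * u x)) \<longlongrightarrow> (cmod c)\<^sup>2 * limit_form u) FF"
    using assms by (auto intro!: tendsto_intros average_form_tendsto)
qed

lemma limit_form_cong_AE:
  assumes "u \<in> L2 M" "v \<in> L2 M" "AE x in M. u x = v x" shows "limit_form u = limit_form v"
proof -
  have "coefficient u (inv h) = coefficient v (inv h)" if "h \<in> F n" for n h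
    unfolding coefficient_def
    using that assms f by (intro L2_inner_cong_AE L2_action inv_carrier F_carrier)
  then show ?thesis by (simp add: limit_form_def average_form_def)
qed

lemma limit_form_action:
  assumes "u \<in> L2 M" "k \<in> carrier G" shows "limit_form (\<lambda>x. u (\<phi> k x)) = limit_form u"
proof -
  interpret G: group G by (rule is_group)
  define C where "C = (L2_norm M u * L2_norm M f)\<^sup>2"
  define a where "a h = (cmod (coefficient u (inv h)))\<^sup>2" for h
  have a: "0 \<le> a h" "h \<in> carrier G \<Longrightarrow> a h \<le> C" for h
    unfolding a_def C_def using coefficient_le[OF assms(1)] by (auto intro: power_mono)
  have coeff: "coefficient (\<lambda>x. u (\<phi> k x)) (inv h) = coefficient u (inv (k \<otimes> h))" if "h \<in> carrier G" for h
  proof -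
    have "L2_inner M (\<lambda>x. u (\<phi> k x)) (\<lambda>x. f (\<phi> (inv h) x)) = L2_inner M u (\<lambda>x. f (\<phi> (inv h) (\<phi> (inv k) x)))"
      using assms that f by (intro L2_inner_action_left L2_action) auto
    also have "(\<lambda>x. f (\<phi> (inv h) (\<phi> (inv k) x))) = (\<lambda>x. f (\<phi> (inv (k \<otimes> h)) x))"
      using assms that by (simp add: action_mult[symmetric] G.inv_mult_group)
    finally show ?thesis by (simp add: coefficient_def)
  qed
  have average_form_k: "average_form n (\<lambda>x. u (\<phi> k x)) = (\<Sum>h\<in>k <#\<^bsub>G\<^esub> F n. a h) / card (F n)" for n
  proof -
    have "k <#\<^bsub>G\<^esub> F n = (\<lambda>h. k \<otimes> h) ` F n" by (auto simp: l_coset_def)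
    moreover have "inj_on (\<lambda>h. k \<otimes> h) (F n)"
      using assms F_carrier by (intro inj_onI) (metis G.Units_eq G.Units_l_cancel)
    ultimately have "(\<Sum>h\<in>k <#\<^bsub>G\<^esub> F n. a h) = (\<Sum>h\<in>F n. a (k \<otimes> h))"
      by (simp add: sum.reindex)
    also have "\<dots> = (\<Sum>h\<in>F n. (cmod (coefficient (\<lambda>x. u (\<phi> k x)) (inv h)))\<^sup>2)"
      by (intro sum.cong refl) (simp add: a_def coeff F_carrier)
    finally show ?thesis by (simp add: average_form_def)
  qed
  have bound: "norm (average_form n (\<lambda>x. u (\<phi> k x)) - average_form n u)
      \<le> C * (real (card (sym_diff (k <#\<^bsub>G\<^esub> F n) (F n))) / real (card (F n)))" for n
  proof -
    let ?A = "k <#\<^bsub>G\<^esub> F n" and ?B = "F n"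
    have sub: "?A \<subseteq> carrier G" using assms(2) F_carrier by (auto simp: l_coset_def)
    have fin: "finite ?A" "finite ?B" using F_finite by (auto simp: l_coset_def)
    have "sum a ?A - sum a ?B = sum a (?A - ?B) - sum a (?B - ?A)"
      using fin sum.Int_Diff[of ?A a ?B] sum.Int_Diff[of ?B a ?A] by (simp add: Int_commute)
    then have "\<bar>sum a ?A - sum a ?B\<bar> \<le> sum a (?A - ?B) + sum a (?B - ?A)"
      using sum_nonneg[of "?A - ?B" a] sum_nonneg[of "?B - ?A" a] a(1) by simp
    also have "\<dots> = sum a (sym_diff ?A ?B)"
      using fin by (intro sum.union_disjoint[symmetric]) auto
    also have "\<dots> \<le> of_nat (card (sym_diff ?A ?B)) * C"
      using sub F_carrier by (intro sum_bounded_above a) auto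
    finally have *: "\<bar>sum a ?A - sum a ?B\<bar> \<le> of_nat (card (sym_diff ?A ?B)) * C" .
    have "average_form n (\<lambda>x. u (\<phi> k x)) - average_form n u = (sum a ?A - sum a ?B) / card (F n)"
      unfolding average_form_k by (simp add: average_form_def a_def diff_divide_distrib)
    then have "norm (average_form n (\<lambda>x. u (\<phi> k x)) - average_form n u) = \<bar>sum a ?A - sum a ?B\<bar> / card (F n)"
      by simp
    also have "\<dots> \<le> of_nat (card (sym_diff ?A ?B)) * C / card (F n)"
      using * by (intro divide_right_mono) auto
    finally show ?thesis by (simp add: mult.commute)
  qed
  have "(\<lambda>n. C * (real (card (sym_diff (k <#\<^bsub>G\<^esub> F n) (F n))) / real (card (F n)))) \<longlonglongrightarrow> C * 0"
    using folner assms(2) by (intro tendsto_intros) (auto simp: folner_sequence_def)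
  then have "((\<lambda>n. C * (real (card (sym_diff (k <#\<^bsub>G\<^esub> F n) (F n))) / real (card (F n)))) \<longlongrightarrow> 0) FF"
    using tendsto_mono[OF FF(2)] by simp
  then have "((\<lambda>n. average_form n (\<lambda>x. u (\<phi> k x)) - average_form n u) \<longlongrightarrow> 0) FF"
    by (rule Lim_null_comparison[rotated]) (use bound in auto)
  from tendsto_add[OF this average_form_tendsto[OF assms(1)]]
  have "((\<lambda>n. average_form n (\<lambda>x. u (\<phi> k x))) \<longlongrightarrow> limit_form u) FF" by simp
  then show ?thesis by (intro limit_form_eqI L2_action assms)
qed

text \<open>Bessel's inequality for each translate of \<open>f\<close>, whose norm is that of
  \<open>f\<close>; averaging and passing to the limit preserve the bound.\<close>

lemma limit_form_trace_le:
  assumes "L2_orthonormal M B" "finite B"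
  shows "(\<Sum>e\<in>B. limit_form e) \<le> (L2_norm M f)\<^sup>2"
proof (rule tendsto_upperbound[OF _ always_eventually FF(1)])
  have B: "e \<in> B \<Longrightarrow> e \<in> L2 M" for e using assms by (auto simp: L2_orthonormal_def)
  show "((\<lambda>n. \<Sum>e\<in>B. average_form n e) \<longlongrightarrow> (\<Sum>e\<in>B. limit_form e)) FF"
    by (intro tendsto_sum average_form_tendsto B)
  show "\<forall>n. (\<Sum>e\<in>B. average_form n e) \<le> (L2_norm M f)\<^sup>2"
  proof
    fix n
    have "(\<Sum>e\<in>B. average_form n e) = (\<Sum>h\<in>F n. \<Sum>e\<in>B. (cmod (coefficient e (inv h)))\<^sup>2) / card (F n)"
      unfolding average_form_def sum_divide_distrib[symmetric] by (subst sum.swap) simp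
    also have "(\<Sum>h\<in>F n. \<Sum>e\<in>B. (cmod (coefficient e (inv h)))\<^sup>2) \<le> of_nat (card (F n)) * (L2_norm M f)\<^sup>2"
    proof (rule sum_bounded_above)
      fix h assume "h \<in> F n"
      then have h: "inv h \<in> carrier G" by (intro inv_carrier F_carrier)
      have "(\<Sum>e\<in>B. (cmod (coefficient e (inv h)))\<^sup>2) = (\<Sum>e\<in>B. (cmod (L2_inner M (\<lambda>x. f (\<phi> (inv h) x)) e))\<^sup>2)"
        unfolding coefficient_def by (subst L2_inner_commute) simp
      also have "\<dots> \<le> (L2_norm M (\<lambda>x. f (\<phi> (inv h) x)))\<^sup>2"
        by (rule L2_Bessel[OF assms L2_action[OF h f]])
      finally show "(\<Sum>e\<in>B. (cmod (coefficient e (inv h)))\<^sup>2) \<le> (L2_norm M f)\<^sup>2"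
        using L2_norm_action[OF h f] by simp
    qed
    finally show "(\<Sum>e\<in>B. average_form n e) \<le> (L2_norm M f)\<^sup>2"
      using F_card_pos[of n] by (simp add: divide_right_mono field_simps)
  qed
qed

text \<open>Take a finite net \<open>K\<close> of the orbit at scale \<open>N/2\<close>. Each
  translate of \<open>f\<close> is so close to one indexed by \<open>K\<close> that their inner
  product has modulus at least \<open>N\<^sup>2/2\<close>. Hence the values of the form at the
  translates indexed by \<open>K\<close> have a positive sum, and by invariance they all equal
  \<open>limit_form f\<close>.\<close>

lemma limit_form_self_pos:
  assumes ap: "almost_periodic f" and pos: "L2_norm M f > 0"
  shows "limit_form f > 0"
proof -
  define N where "N = L2_norm M f"
  have "N/2 > 0" using pos by (simp add: N_def)
  from almost_periodic_net[OF ap this] obtain K where K: "finite K" "K \<subseteq> carrier G"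
    "\<And>g. g \<in> carrier G \<Longrightarrow> \<exists>k\<in>K. L2_norm M (\<lambda>x. f (\<phi> g x) - f (\<phi> k x)) < N/2" by metis
  have fK: "(\<lambda>x. f (\<phi> k x)) \<in> L2 M" if "k \<in> K" for k using that K f by (intro L2_action) auto
  have low: "(N\<^sup>2/2)\<^sup>2 \<le> (\<Sum>k\<in>K. (cmod (coefficient (\<lambda>x. f (\<phi> k x)) g))\<^sup>2)" if g: "g \<in> carrier G" for g
  proof -
    obtain k where k: "k \<in> K" "L2_norm M (\<lambda>x. f (\<phi> g x) - f (\<phi> k x)) < N/2" using K(3)[OF g] by auto
    let ?g = "\<lambda>x. f (\<phi> g x)" and ?k = "\<lambda>x. f (\<phi> k x)"
    have gL: "?g \<in> L2 M" by (rule L2_action[OF g f])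
    have "L2_inner M (\<lambda>x. ?g x - ?k x) ?g = L2_inner M ?g ?g - coefficient ?k g"
      unfolding coefficient_def using gL fK[OF k(1)] by (intro L2_inner_diff_left)
    then have "of_real (N\<^sup>2) - coefficient ?k g = L2_inner M (\<lambda>x. ?g x - ?k x) ?g"
      using L2_norm_action[OF g f] by (simp add: L2_inner_self N_def)
    then have "cmod (of_real (N\<^sup>2) - coefficient ?k g) \<le> L2_norm M (\<lambda>x. ?g x - ?k x) * N"
      using L2_Cauchy_Schwarz[OF L2_diff[OF gL fK[OF k(1)]] gL] L2_norm_action[OF g f] by (simp add: N_def)
    also have "\<dots> \<le> N/2 * N" using k(2) pos by (intro mult_right_mono) (auto simp: N_def)
    finally have "cmod (of_real (N\<^sup>2)) - cmod (coefficient ?k g) \<le> N/2 * N"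
      using norm_triangle_ineq2[of "of_real (N\<^sup>2)" "coefficient ?k g"] by linarith
    then have "N\<^sup>2/2 \<le> cmod (coefficient ?k g)"
      by (simp only: norm_of_real) (simp add: power2_eq_square)
    then have "(N\<^sup>2/2)\<^sup>2 \<le> (cmod (coefficient ?k g))\<^sup>2" by (intro power_mono) auto
    also have "\<dots> \<le> (\<Sum>k\<in>K. (cmod (coefficient (\<lambda>x. f (\<phi> k x)) g))\<^sup>2)"
      using K(1) k(1) by (intro member_le_sum) auto
    finally show ?thesis .
  qed
  have "(N\<^sup>2/2)\<^sup>2 \<le> (\<Sum>k\<in>K. limit_form (\<lambda>x. f (\<phi> k x)))"
  proof (rule tendsto_lowerbound[OF _ always_eventually FF(1)])
    show "((\<lambda>n. \<Sum>k\<in>K. average_form n (\<lambda>x. f (\<phi> k x))) \<longlongrightarrow> (\<Sum>k\<in>K. limit_form (\<lambda>x. f (\<phi> k x)))) FF"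
      by (intro tendsto_sum average_form_tendsto fK)
    show "\<forall>n. (N\<^sup>2/2)\<^sup>2 \<le> (\<Sum>k\<in>K. average_form n (\<lambda>x. f (\<phi> k x)))"
    proof
      fix n
      have "of_nat (card (F n)) * (N\<^sup>2/2)\<^sup>2 \<le> (\<Sum>h\<in>F n. \<Sum>k\<in>K. (cmod (coefficient (\<lambda>x. f (\<phi> k x)) (inv h)))\<^sup>2)"
        by (intro sum_bounded_below low inv_carrier F_carrier)
      then have "(N\<^sup>2/2)\<^sup>2 \<le> (\<Sum>h\<in>F n. \<Sum>k\<in>K. (cmod (coefficient (\<lambda>x. f (\<phi> k x)) (inv h)))\<^sup>2) / card (F n)"
        using F_card_pos[of n] by (simp add: le_divide_eq mult.commute)
      also have "\<dots> = (\<Sum>k\<in>K. average_form n (\<lambda>x. f (\<phi> k x)))"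
        unfolding average_form_def sum_divide_distrib[symmetric] by (subst sum.swap) simp
      finally show "(N\<^sup>2/2)\<^sup>2 \<le> (\<Sum>k\<in>K. average_form n (\<lambda>x. f (\<phi> k x)))" .
    qed
  qed
  also have "\<dots> = card K * limit_form f" using K(2) by (simp add: limit_form_action f subset_iff)
  finally have "(N\<^sup>2/2)\<^sup>2 \<le> card K * limit_form f" .
  moreover have "(N\<^sup>2/2)\<^sup>2 > 0" using pos by (simp add: N_def)
  ultimately have "limit_form f \<noteq> 0" by auto
  then show ?thesis using limit_form_nonneg[OF f] by simp
qed

end

section \<open>The top eigenspace\<close>

text \<open>Sequential compactness of a countable product of discs; it does the work of weak
  compactness of the unit ball.\<close>

lemma bounded_coordinates_convergent_subsequence:
  fixes x :: "nat \<Rightarrow> nat \<Rightarrow> complex"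
  assumes "\<And>n j. cmod (x n j) \<le> C"
  obtains r where "strict_mono r" "\<And>j. convergent (\<lambda>n. x (r n) j)"
proof -
  have "seq_compact (Pi\<^sub>E UNIV (\<lambda>j::nat. cball (0::complex) C))"
    using compact_bounded_functions[of "\<lambda>_. C"] by (rule compact_imp_seq_compact)
  moreover have "\<forall>n. x n \<in> Pi\<^sub>E UNIV (\<lambda>j. cball 0 C)" using assms by auto
  ultimately obtain l r where r: "strict_mono r" "(x \<circ> r) \<longlonglongrightarrow> l"
    unfolding seq_compact_def by metis
  have "(\<lambda>n. x (r n) j) \<longlonglongrightarrow> l j" for j
  proof (rule topological_tendstoI)
    fix U :: "complex set" assume "open U" "l j \<in> U"
    then have "\<forall>\<^sub>F n in sequentially. (x \<circ> r) n \<in> (\<lambda>y. y j) -` U"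
      using open_vimage[OF _ continuous_on_product_coordinates[of j]]
      by (intro topological_tendstoD[OF r(2)]) auto
    then show "\<forall>\<^sub>F n in sequentially. x (r n) j \<in> U" by simp
  qed
  with r(1) show thesis by (intro that) (auto simp: convergent_def)
qed

context averaged_form
begin

text \<open>Compactness of the hidden operator: up to an error of \<open>2 * e\<close>, the
  coefficient at any \<open>g\<close> is the coefficient at a member of a finite net, whence the
  constant 3. The norm bound 2 is meant for differences of unit vectors.\<close>

lemma limit_form_small:
  assumes ap: "almost_periodic f" and e: "e > 0"
  obtains K where "finite K" "K \<subseteq> carrier G"
    "\<And>u. u \<in> L2 M \<Longrightarrow> L2_norm M u \<le> 2 \<Longrightarrow> (\<And>k. k \<in> K \<Longrightarrow> cmod (coefficient u k) \<le> e) \<Longrightarrow> limit_form u \<le> (3 * e)\<^sup>2"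
proof -
  from almost_periodic_net[OF ap e] obtain K where K: "finite K" "K \<subseteq> carrier G"
    "\<And>g. g \<in> carrier G \<Longrightarrow> \<exists>k\<in>K. L2_norm M (\<lambda>x. f (\<phi> g x) - f (\<phi> k x)) < e" by metis
  show thesis
  proof (rule that[OF K(1,2)])
    fix u assume u: "u \<in> L2 M" "L2_norm M u \<le> 2" "\<And>k. k \<in> K \<Longrightarrow> cmod (coefficient u k) \<le> e"
    show "limit_form u \<le> (3 * e)\<^sup>2"
    proof (rule limit_form_mono[OF u(1)], rule power_mono)
      fix g assume g: "g \<in> carrier G"
      then obtain k where k: "k \<in> K" "L2_norm M (\<lambda>x. f (\<phi> g x) - f (\<phi> k x)) < e" using K(3) by auto
      have kc: "k \<in> carrier G" using k K by auto
      note fg = L2_action[OF g f] and fk = L2_action[OF kc f]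
      have "L2_inner M (\<lambda>x. f (\<phi> g x) - f (\<phi> k x)) u = cnj (coefficient u g) - cnj (coefficient u k)"
        unfolding coefficient_def L2_inner_commute[symmetric] using fg fk u(1) by (rule L2_inner_diff_left)
      then have "cmod (coefficient u g - coefficient u k) = cmod (L2_inner M (\<lambda>x. f (\<phi> g x) - f (\<phi> k x)) u)"
        by (metis complex_cnj_diff complex_mod_cnj)
      also have "\<dots> \<le> L2_norm M (\<lambda>x. f (\<phi> g x) - f (\<phi> k x)) * L2_norm M u"
        by (intro L2_Cauchy_Schwarz L2_diff fg fk u)
      also have "\<dots> \<le> e * 2" using k u e by (intro mult_mono) auto
      finally show "cmod (coefficient u g) \<le> 3 * e"
        using u(3)[OF k(1)] norm_triangle_ineq2[of "coefficient u g" "coefficient u k"] by linarith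
    qed simp
  qed
qed

text \<open>The norm of the positive operator represented by \<open>limit_form\<close>, later seen
  to be its largest eigenvalue.\<close>

definition top_value :: real where
  "top_value = Sup (limit_form ` {u \<in> L2 M. L2_norm M u = 1})"

lemma bdd_above_limit_form: "bdd_above (limit_form ` {u \<in> L2 M. L2_norm M u = 1})"
  using limit_form_le by (intro bdd_aboveI[of _ "(L2_norm M f)\<^sup>2"]) fastforce

lemma limit_form_le_top: assumes "u \<in> L2 M" shows "limit_form u \<le> top_value * (L2_norm M u)\<^sup>2"
proof (cases "L2_norm M u = 0")
  case True
  then show ?thesis using limit_form_le[OF assms] by simp
next
  case False
  define v where "v x = of_real (1 / L2_norm M u) * u x" for x
  have v: "v \<in> L2 M" unfolding v_def by (rule L2_scale[OF assms])
  have "L2_norm M v = cmod (of_real (1 / L2_norm M u)) * L2_norm M u"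
    unfolding v_def by (rule L2_norm_scale)
  also have "\<dots> = 1" using False by (simp add: norm_divide)
  finally have "limit_form v \<le> top_value"
    unfolding top_value_def using v by (intro cSup_upper bdd_above_limit_form) auto
  moreover have "limit_form v = (cmod (of_real (1 / L2_norm M u)))\<^sup>2 * limit_form u"
    unfolding v_def by (rule limit_form_scale[OF assms])
  ultimately show ?thesis using False
    by (simp add: norm_divide power_divide divide_le_eq)
qed

text \<open>The quadratic form of \<open>top_value\<close> minus the hidden operator. It is
  nonnegative, so its zeros are the eigenvectors for \<open>top_value\<close> (and 0), and the
  parallelogram law makes them a subspace.\<close>

definition defect :: "('x \<Rightarrow> complex) \<Rightarrow> real" where
  "defect u = top_value * (L2_norm M u)\<^sup>2 - limit_form u"

lemma defect_nonneg: "u \<in> L2 M \<Longrightarrow> 0 \<le> defect u"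
  using limit_form_le_top by (simp add: defect_def)

lemma defect_parallelogram:
  assumes "u \<in> L2 M" "v \<in> L2 M"
  shows "defect (\<lambda>x. u x + v x) + defect (\<lambda>x. u x - v x) = 2 * defect u + 2 * defect v"
proof -
  have "defect (\<lambda>x. u x + v x) + defect (\<lambda>x. u x - v x)
    = top_value * ((L2_norm M (\<lambda>x. u x + v x))\<^sup>2 + (L2_norm M (\<lambda>x. u x - v x))\<^sup>2)
      - (limit_form (\<lambda>x. u x + v x) + limit_form (\<lambda>x. u x - v x))"
    by (simp add: defect_def algebra_simps)
  also have "\<dots> = 2 * defect u + 2 * defect v"
    unfolding L2_parallelogram[OF assms] limit_form_parallelogram[OF assms] by (simp add: defect_def algebra_simps)
  finally show ?thesis .
qed

lemma defect_add_le:
  assumes "u \<in> L2 M" "v \<in> L2 M"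
  shows "defect (\<lambda>x. u x + v x) \<le> 2 * defect u + 2 * defect v"
  using defect_parallelogram[OF assms] defect_nonneg[OF L2_diff[OF assms]] by linarith

lemma defect_scale: "u \<in> L2 M \<Longrightarrow> defect (\<lambda>x. c * u x) = (cmod c)\<^sup>2 * defect u"
  by (simp add: defect_def L2_norm_scale limit_form_scale power_mult_distrib algebra_simps)

lemma top_value_pos:
  assumes "almost_periodic f" "L2_norm M f > 0" shows "top_value > 0"
proof -
  have "0 < top_value * (L2_norm M f)\<^sup>2" using limit_form_self_pos[OF assms] limit_form_le_top[OF f] by simp
  then show ?thesis by (simp add: zero_less_mult_iff)
qed

definition top_space :: "('x \<Rightarrow> complex) set" where
  "top_space = {u \<in> L2 M. defect u = 0}"

lemma top_space_add:
  assumes "u \<in> top_space" "v \<in> top_space" shows "(\<lambda>x. u x + v x) \<in> top_space"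
  using assms defect_add_le[of u v] defect_nonneg[OF L2_add, of u v] L2_add[of u M v]
  by (simp add: top_space_def)

lemma top_space_scale: "u \<in> top_space \<Longrightarrow> (\<lambda>x. c * u x) \<in> top_space"
  by (simp add: top_space_def defect_scale L2_scale)

lemma top_space_zero: "(\<lambda>x. 0) \<in> top_space"
  using defect_scale[of "\<lambda>x. 0" 0] by (simp add: top_space_def)

lemma top_space_cong_AE:
  assumes "u \<in> L2 M" "v \<in> top_space" "AE x in M. u x = v x" shows "u \<in> top_space"
proof -
  have v: "v \<in> L2 M" "defect v = 0" using assms by (auto simp: top_space_def)
  have "defect u = defect v"
    unfolding defect_def limit_form_cong_AE[OF assms(1) v(1) assms(3)]
    using L2_norm_cong_AE[OF L2_measurable[OF assms(1)] L2_measurable[OF v(1)] assms(3)] by simp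
  with v assms show ?thesis by (simp add: top_space_def)
qed

lemma top_space_invariant:
  assumes "u \<in> top_space" "k \<in> carrier G" shows "(\<lambda>x. u (\<phi> k x)) \<in> top_space"
  using assms by (simp add: top_space_def defect_def L2_action L2_norm_action limit_form_action)

lemma span_subset_top_space:
  assumes "B \<subseteq> top_space" shows "L2_span M B \<subseteq> top_space"
proof
  fix u assume "u \<in> L2_span M B"
  then obtain T c where T: "u \<in> L2 M" "finite T" "T \<subseteq> B" "AE x in M. u x = (\<Sum>b\<in>T. c b * b x)"
    by (rule L2_spanE)
  have "(\<lambda>x. \<Sum>b\<in>T. c b * b x) \<in> top_space"
    using T(2) T(3)
  proof (induction T rule: finite_induct)
    case (insert b T)
    then have "(\<lambda>x. c b * b x + (\<Sum>b\<in>T. c b * b x)) \<in> top_space"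
      using assms by (intro top_space_add top_space_scale) auto
    with insert.hyps show ?case by simp
  qed (simp add: top_space_zero)
  then show "u \<in> top_space" using T by (intro top_space_cong_AE[OF T(1) _ T(4)])
qed

text \<open>An orthonormal family in the top eigenspace has at most \<open>\<parallel>f\<parallel>\<^sup>2 / top_value\<close> members, since the
  trace of the form is at most \<open>\<parallel>f\<parallel>\<^sup>2\<close>.\<close>

lemma top_space_finite_dim:
  assumes "almost_periodic f" "L2_norm M f > 0"
  shows "finite_dim_L2_subspace M top_space"
proof -
  define P where "P B \<longleftrightarrow> finite B \<and> L2_orthonormal M B \<and> B \<subseteq> top_space" for B
  note pos = top_value_pos[OF assms]
  have card_le: "card B \<le> nat \<lceil>(L2_norm M f)\<^sup>2 / top_value\<rceil>" if "P B" for B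
  proof -
    have "limit_form e = top_value" if "e \<in> B" for e
    proof -
      have "L2_inner M e e = 1" "defect e = 0"
        using that \<open>P B\<close> by (auto simp: P_def L2_orthonormal_def top_space_def)
      then have "of_real ((L2_norm M e)\<^sup>2) = (1::complex)" by (simp only: L2_inner_self)
      then have "(L2_norm M e)\<^sup>2 = 1" using of_real_eq_1_iff by blast
      with \<open>defect e = 0\<close> show ?thesis by (simp add: defect_def)
    qed
    then have "(\<Sum>e\<in>B. limit_form e) = card B * top_value" by simp
    then have "card B * top_value \<le> (L2_norm M f)\<^sup>2"
      using limit_form_trace_le[of B] that by (simp add: P_def)
    then have "real (card B) \<le> (L2_norm M f)\<^sup>2 / top_value"
      using pos by (simp add: le_divide_eq)
    then show ?thesis by linarith
  qed
  \<comment> \<open>The cardinality bound yields an orthonormal family of maximal size in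
    \<open>top_space\<close>. It spans, since a Gram-Schmidt step would otherwise enlarge it without
    leaving \<open>top_space\<close>.\<close>
  have "P {}" by (simp add: P_def L2_orthonormal_def)
  moreover have "\<forall>B. P B \<longrightarrow> card B < Suc (nat \<lceil>(L2_norm M f)\<^sup>2 / top_value\<rceil>)"
    using card_le by (simp add: less_Suc_eq_le)
  ultimately have "\<exists>B. P B \<and> (\<forall>B'. P B' \<longrightarrow> card B' \<le> card B)" by (rule ex_has_greatest_nat[of P])
  then obtain B where B: "P B" "\<And>B'. P B' \<Longrightarrow> card B' \<le> card B" by auto
  have "top_space \<subseteq> L2_span M B"
  proof
    fix u assume u: "u \<in> top_space"
    then have uL: "u \<in> L2 M" by (simp add: top_space_def)
    show "u \<in> L2_span M B"
    proof (rule ccontr)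
      assume "u \<notin> L2_span M B"
      with uL B(1) obtain e where e: "e \<notin> B" "L2_orthonormal M (insert e B)" "e \<in> L2_span M (insert u B)"
        using L2_orthonormal_extend[of M B u] unfolding P_def by metis
      have "insert u B \<subseteq> top_space" using u B(1) by (auto simp: P_def)
      from span_subset_top_space[OF this] e have "e \<in> top_space" by auto
      then have "P (insert e B)" using B(1) e by (auto simp: P_def)
      from B(2)[OF this] e(1) B(1) show False by (simp add: P_def)
    qed
  qed
  moreover have "L2_span M B \<subseteq> top_space" using B(1) by (intro span_subset_top_space) (simp add: P_def)
  ultimately show ?thesis unfolding finite_dim_L2_subspace_def
    using B(1) by (intro exI[of _ B]) (auto simp: P_def L2_orthonormal_def)
qed

text \<open>A maximizing sequence of unit vectors has a subsequence along which all coefficients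
  converge. Differences of its late members have small defect by the parallelogram law and small
  \<open>limit_form\<close> by the control through finitely many coefficients. The two add up to
  \<open>top_value\<close> times the squared norm, so the subsequence is Cauchy in norm.\<close>

lemma top_space_nontrivial:
  assumes countable: "countable (carrier G)" and ap: "almost_periodic f" and pos: "L2_norm M f > 0"
  obtains u where "u \<in> top_space" "L2_norm M u = 1"
proof -
  note lpos = top_value_pos[OF ap pos]
  let ?U = "{u \<in> L2 M. L2_norm M u = 1}"
  have "?U \<noteq> {}"
  proof -
    have "L2_norm M (\<lambda>x. of_real (1 / L2_norm M f) * f x) = 1"
      unfolding L2_norm_scale using pos by (simp add: norm_divide)
    then show ?thesis using L2_scale[OF f] by blast
  qed
  then have "\<exists>u\<in>?U. top_value - e < limit_form u" if "e > 0" for e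
    using less_cSupD[of "limit_form ` ?U" "top_value - e"] that by (auto simp: top_value_def)
  then have "\<exists>u. \<forall>n. u n \<in> ?U \<and> top_value - 1 / real (Suc n) < limit_form (u n)"
    by (intro choice) (metis of_nat_0_less_iff zero_less_Suc zero_less_divide_1_iff)
  then obtain w where w: "\<And>n. w n \<in> L2 M" "\<And>n. L2_norm M (w n) = 1"
    "\<And>n. top_value - 1 / real (Suc n) < limit_form (w n)"
    by auto
  have carrier_ne: "carrier G \<noteq> {}" using is_group group.is_monoid monoid.one_closed by fastforce
  let ?g = "from_nat_into (carrier G)"
  have g: "?g j \<in> carrier G" for j by (rule from_nat_into[OF carrier_ne])
  have "cmod (coefficient (w n) (?g j)) \<le> L2_norm M f" for n j
    using coefficient_le[OF w(1) g, of n j] w(2) by simp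
  from bounded_coordinates_convergent_subsequence[of "\<lambda>n j. coefficient (w n) (?g j)", OF this]
  obtain r where r: "strict_mono r" "\<And>j. convergent (\<lambda>n. coefficient (w (r n)) (?g j))"
    by blast
  define u where "u n = w (r n)" for n
  have u: "u n \<in> L2 M" "L2_norm M (u n) = 1" for n using w by (auto simp: u_def)
  \<comment> \<open>The rate survives the passage to the subsequence because \<open>r n\<close> is
    at least \<open>n\<close>.\<close>
  have def: "defect (u n) < 1 / real (Suc n)" for n
  proof -
    have "1 / real (Suc (r n)) \<le> 1 / real (Suc n)"
      using strict_mono_imp_increasing[OF r(1), of n] by (intro divide_left_mono) auto
    then show ?thesis using w(2) w(3)[of "r n"] by (simp add: defect_def u_def)
  qed
  have conv: "convergent (\<lambda>n. coefficient (u n) k)" if "k \<in> carrier G" for k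
    using r(2)[of "to_nat_on (carrier G) k"] that countable by (simp add: u_def)
  have Cauchy: "\<exists>N. \<forall>m\<ge>N. \<forall>n\<ge>N. L2_norm M (\<lambda>x. u m x - u n x) < e" if e: "e > 0" for e
  proof -
    \<comment> \<open>The bound \<open>top_value * e\<^sup>2\<close> is shared equally:
      \<open>d\<close> makes the \<open>limit_form\<close> part at most one half, and
      \<open>N1\<close> makes the defect part, at most twice the sum of two defects, less than the
      other.\<close>
    define d where "d = sqrt (top_value * e\<^sup>2 / 2) / 3"
    have d: "d > 0" "(3 * d)\<^sup>2 = top_value * e\<^sup>2 / 2" using e lpos by (auto simp: d_def)
    obtain K where K: "finite K" "K \<subseteq> carrier G"
      "\<And>u. u \<in> L2 M \<Longrightarrow> L2_norm M u \<le> 2 \<Longrightarrow> (\<And>k. k \<in> K \<Longrightarrow> cmod (coefficient u k) \<le> d) \<Longrightarrow> limit_form u \<le> (3 * d)\<^sup>2"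
      using limit_form_small[OF ap d(1)] by metis
    have "\<exists>N. \<forall>m\<ge>N. \<forall>n\<ge>N. cmod (coefficient (u m) k - coefficient (u n) k) < d" if "k \<in> K" for k
      using conv[of k] that K(2) d(1) Cauchy_iff[of "\<lambda>n. coefficient (u n) k"]
      by (auto simp: Cauchy_convergent_iff[symmetric])
    then obtain N where N: "\<And>k m n. k \<in> K \<Longrightarrow> m \<ge> N k \<Longrightarrow> n \<ge> N k \<Longrightarrow> cmod (coefficient (u m) k - coefficient (u n) k) < d"
      by metis
    obtain N1 where N1: "4 / real (Suc N1) < top_value * e\<^sup>2 / 2"
    proof -
      have pos: "top_value * e\<^sup>2 / 8 > 0" using e lpos by simp
      obtain n where "inverse (of_nat (Suc n)) < top_value * e\<^sup>2 / 8"
        using reals_Archimedean[OF pos] by auto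
      then show thesis by (intro that[of n]) (simp add: field_simps)
    qed
    define N' where "N' = Max (insert N1 (N ` K))"
    have N': "N1 \<le> N'" "k \<in> K \<Longrightarrow> N k \<le> N'" for k using K(1) by (auto simp: N'_def)
    show ?thesis
    proof (intro exI allI impI)
      fix m n assume mn: "m \<ge> N'" "n \<ge> N'"
      let ?d = "\<lambda>x. u m x - u n x" and ?s = "\<lambda>x. u m x + u n x"
      have dL: "?d \<in> L2 M" and sL: "?s \<in> L2 M" using u by (auto intro: L2_diff L2_add)
      have "L2_norm M ?d \<le> 2"
        using L2_norm_triangle[OF u(1)[of m] L2_uminus[OF u(1)[of n]]] u(2)
          L2_norm_scale[of M "-1" "u n"] by simp
      moreover have "cmod (coefficient ?d k) \<le> d" if "k \<in> K" for k
        using N[OF that, of m n] N'(2)[OF that] mn that K(2) u by (auto simp: coefficient_diff)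
      ultimately have qd: "limit_form ?d \<le> top_value * e\<^sup>2 / 2" using K(3)[OF dL] d(2) by simp
      have "top_value * (L2_norm M ?d)\<^sup>2 = defect ?d + limit_form ?d" by (simp add: defect_def)
      also have "defect ?d \<le> 2 * defect (u m) + 2 * defect (u n)"
        using defect_parallelogram[OF u(1)[of m] u(1)[of n]] defect_nonneg[OF sL] by linarith
      also have "\<dots> < 4 / real (Suc N1)"
      proof -
        have "defect (u k) < 1 / real (Suc N1)" if "k \<ge> N'" for k
        proof -
          have "1 / real (Suc k) \<le> 1 / real (Suc N1)"
            using that N'(1) by (intro divide_left_mono) auto
          with def[of k] show ?thesis by linarith
        qed
        from this[OF mn(1)] this[OF mn(2)] show ?thesis by simp
      qed
      finally have "top_value * (L2_norm M ?d)\<^sup>2 < top_value * e\<^sup>2" using qd N1 by linarith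
      then have "(L2_norm M ?d)\<^sup>2 < e\<^sup>2" using lpos by simp
      then show "L2_norm M ?d < e" by (rule power2_less_imp_less) (use e in simp)
    qed
  qed
  from L2_complete[OF u(1) Cauchy] obtain v where v: "v \<in> L2 M"
    and lim: "(\<lambda>n. L2_norm M (\<lambda>x. u n x - v x)) \<longlonglongrightarrow> 0" by auto
  have "(\<lambda>n. L2_norm M (u n)) \<longlonglongrightarrow> L2_norm M v" by (rule L2_norm_tendsto[OF u(1) v lim])
  then have nv: "L2_norm M v = 1" using u(2) by (simp add: LIMSEQ_const_iff)
  have "defect v \<le> 0"
  proof (rule LIMSEQ_le_const)
    have "(\<lambda>n. 2 * (1 / real (Suc n)) + 2 * (top_value * (L2_norm M (\<lambda>x. u n x - v x))\<^sup>2)) \<longlonglongrightarrow> 2 * 0 + 2 * (top_value * 0\<^sup>2)"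
      by (intro tendsto_intros lim LIMSEQ_Suc[OF lim_1_over_n])
    then show "(\<lambda>n. 2 * (1 / real (Suc n)) + 2 * (top_value * (L2_norm M (\<lambda>x. u n x - v x))\<^sup>2)) \<longlonglongrightarrow> 0" by simp
    have "defect v \<le> 2 * (1 / real (Suc n)) + 2 * (top_value * (L2_norm M (\<lambda>x. u n x - v x))\<^sup>2)" for n
    proof -
      have d: "(\<lambda>x. v x - u n x) \<in> L2 M" by (intro L2_diff v u)
      have "defect v \<le> 2 * defect (u n) + 2 * defect (\<lambda>x. v x - u n x)"
        using defect_add_le[OF u(1)[of n] d] by simp
      moreover have "defect (\<lambda>x. v x - u n x) \<le> top_value * (L2_norm M (\<lambda>x. u n x - v x))\<^sup>2"
        using limit_form_nonneg[OF d] by (simp add: defect_def L2_norm_minus_commute[of M v])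
      ultimately show ?thesis using def[of n] by linarith
    qed
    then show "\<exists>N. \<forall>n\<ge>N. defect v \<le> 2 * (1 / real (Suc n)) + 2 * (top_value * (L2_norm M (\<lambda>x. u n x - v x))\<^sup>2)"
      by blast
  qed
  with defect_nonneg[OF v] v have "v \<in> top_space" by (simp add: top_space_def)
  then show thesis using nv by (rule that)
qed

end

context G_MPS
begin

lemma discrete_spectrum_if_almost_periodic:
  assumes F: "folner_sequence G F" and countable: "countable (carrier G)"
    and ap: "\<And>u. u \<in> L2 M \<Longrightarrow> almost_periodic u"
  shows "discrete_spectrum G \<phi> M"
proof (rule ccontr)
  define \<V> where "\<V> = {V. finite_dim_L2_subspace M V \<and> invariant_under G \<phi> V}"
  define S where "S = L2_span M (\<Union>\<V>)"
  assume "\<not> discrete_spectrum G \<phi> M"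
  then obtain f0 where f0: "f0 \<in> L2 M" "f0 \<notin> L2_closure M S"
    unfolding discrete_spectrum_def H_c_def L2_closure_def S_def \<V>_def by blast
  have S: "S \<subseteq> L2 M" "(\<lambda>x. 0) \<in> S" "\<And>c v. v \<in> S \<Longrightarrow> (\<lambda>x. c * v x) \<in> S"
    "\<And>v w. v \<in> S \<Longrightarrow> w \<in> S \<Longrightarrow> (\<lambda>x. v x + w x) \<in> S"
    unfolding S_def by (rule L2_span_subset L2_span_zero L2_span_scale L2_span_add; assumption?)+
  obtain f where fL: "f \<in> L2 M" "L2_norm M f > 0" and orth: "\<And>v. v \<in> S \<Longrightarrow> L2_inner M f v = 0"
    using L2_orthogonal_vector_exists[OF S f0] by metis
  obtain FF :: "nat filter" where FF: "FF \<noteq> bot" "FF \<le> sequentially"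
    "\<And>s::nat \<Rightarrow> real. Bseq s \<Longrightarrow> \<exists>l. (s \<longlongrightarrow> l) FF"
    using universal_filter_exists by metis
  interpret averaged_form G \<phi> M F FF f
    by unfold_locales (use F FF fL in auto)
  obtain u where u: "u \<in> top_space" "L2_norm M u = 1"
    using top_space_nontrivial[OF countable ap[OF fL(1)] fL(2)] by metis
  then have uL: "u \<in> L2 M" by (simp add: top_space_def)
  have "top_space \<in> \<V>"
    unfolding \<V>_def invariant_under_def
    using top_space_finite_dim[OF ap[OF fL(1)] fL(2)] top_space_invariant by (auto simp: comp_def)
  moreover have "V \<subseteq> L2 M" if "V \<in> \<V>" for V
    using that L2_span_subset by (auto simp: \<V>_def finite_dim_L2_subspace_def)
  ultimately have top_S: "top_space \<subseteq> S"
    using L2_span_superset[of "\<Union>\<V>" M] unfolding S_def by blast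
  \<comment> \<open>The translation is moved from \<open>f\<close> to \<open>u\<close>, where it
    stays inside \<open>top_space\<close> and hence inside \<open>S\<close>, to which
    \<open>f\<close> is orthogonal.\<close>
  have "coefficient u g = 0" if g: "g \<in> carrier G" for g
  proof -
    have "coefficient u g = cnj (L2_inner M f (\<lambda>x. u (\<phi> (inv g) x)))"
      unfolding coefficient_def
      by (subst L2_inner_commute, subst L2_inner_action_left[OF g fL(1) uL]) simp
    moreover have "(\<lambda>x. u (\<phi> (inv g) x)) \<in> S"
      using top_S top_space_invariant[OF u(1) inv_carrier[OF g]] by auto
    ultimately show ?thesis using orth by simp
  qed
  then have "limit_form u \<le> 0" by (intro limit_form_mono[OF uL]) simp
  moreover have "limit_form u = top_value" using u by (simp add: top_space_def defect_def)
  ultimately show False using top_value_pos[OF ap[OF fL(1)] fL(2)] by simp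
qed

end

section \<open>Discrete spectrum and almost periodicity\<close>

context G_MPS
begin

lemma indicator_L2: "A \<in> sets M \<Longrightarrow> (indicator A :: 'x \<Rightarrow> complex) \<in> L2 M"
proof -
  assume [measurable]: "A \<in> sets M"
  have "(\<lambda>x. 1) \<in> L2 M" by (simp add: L2_def)
  then show ?thesis by (rule L2_bounded[rotated, of _ _ _ 1]) (auto simp: indicator_def)
qed

text \<open>Simple functions are dense in L2, and they are finite linear combinations of
  indicators.\<close>

lemma almost_periodic_if_sets:
  assumes sets: "\<And>A. A \<in> sets M \<Longrightarrow> almost_periodic (indicator A)" and u: "u \<in> L2 M"
  shows "almost_periodic u"
proof (rule almost_periodic_approx[OF u])
  fix e :: real assume e: "e > 0"
  note [measurable] = L2_measurable[OF u]
  \<comment> \<open>The bound by \<open>2 * cmod (u x)\<close> gives the error at most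
    \<open>3 * cmod (u x)\<close>, hence the dominating function with factor 9.\<close>
  obtain s where s: "\<And>i. simple_function M (s i)" "\<And>x. (\<lambda>i. s i x) \<longlonglongrightarrow> u x"
    "\<And>i x. cmod (s i x) \<le> 2 * cmod (u x)"
    using borel_measurable_implies_sequence_metric[OF L2_measurable[OF u], of 0] by auto
  have [measurable]: "s i \<in> borel_measurable M" for i
    using s(1) by (rule borel_measurable_simple_function)
  have "(\<lambda>i. \<integral>x. (cmod (u x - s i x))\<^sup>2 \<partial>M) \<longlonglongrightarrow> (\<integral>x. 0 \<partial>M)"
  proof (rule integral_dominated_convergence[where w = "\<lambda>x. 9 * (cmod (u x))\<^sup>2"])
    show "AE x in M. (\<lambda>i. (cmod (u x - s i x))\<^sup>2) \<longlonglongrightarrow> 0"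
    proof (rule AE_I2)
      fix x
      have "(\<lambda>i. (cmod (u x - s i x))\<^sup>2) \<longlonglongrightarrow> (cmod (u x - u x))\<^sup>2"
        by (intro tendsto_intros s(2))
      then show "(\<lambda>i. (cmod (u x - s i x))\<^sup>2) \<longlonglongrightarrow> 0" by simp
    qed
    show "AE x in M. norm ((cmod (u x - s i x))\<^sup>2) \<le> 9 * (cmod (u x))\<^sup>2" for i
    proof (rule AE_I2)
      fix x
      have "cmod (u x - s i x) \<le> 3 * cmod (u x)"
        using norm_triangle_ineq4[of "u x" "s i x"] s(3)[of i x] by linarith
      then have "(cmod (u x - s i x))\<^sup>2 \<le> (3 * cmod (u x))\<^sup>2" by (intro power_mono) auto
      then show "norm ((cmod (u x - s i x))\<^sup>2) \<le> 9 * (cmod (u x))\<^sup>2" by (simp add: power_mult_distrib)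
    qed
  qed (use L2_integrable_sq[OF u] in auto)
  then have "(\<lambda>i. sqrt (\<integral>x. (cmod (u x - s i x))\<^sup>2 \<partial>M)) \<longlonglongrightarrow> sqrt 0"
    by (intro tendsto_real_sqrt) simp
  then have "(\<lambda>i. L2_norm M (\<lambda>x. u x - s i x)) \<longlonglongrightarrow> 0" by (simp add: L2_norm_def)
  from order_tendstoD(2)[OF this e] obtain i where i: "L2_norm M (\<lambda>x. u x - s i x) < e"
    by (auto simp: eventually_sequentially)
  have sL: "s i \<in> L2 M" by (rule L2_bounded[OF _ u, of _ 2]) (use s(3) in auto)
  have fin: "finite (range (s i))" using s(1)[of i] by (simp add: simple_function_def)
  have meas: "s i -` {y} \<in> sets M" for y
    using measurable_sets[of "s i" M borel "{y}"] by simp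
  have "s i = (\<lambda>x. \<Sum>y\<in>range (s i). y * indicator (s i -` {y}) x)"
  proof
    fix x
    have "(\<Sum>y\<in>range (s i). y * indicator (s i -` {y}) x) = (\<Sum>y\<in>range (s i). if y = s i x then y else 0)"
      by (intro sum.cong) (auto simp: indicator_def)
    also have "\<dots> = s i x" using fin by simp
    finally show "s i x = (\<Sum>y\<in>range (s i). y * indicator (s i -` {y}) x)" by simp
  qed
  moreover have "almost_periodic (\<lambda>x. \<Sum>y\<in>range (s i). y * indicator (s i -` {y}) x)"
    by (intro almost_periodic_sum almost_periodic_scale L2_scale indicator_L2 sets meas)
  ultimately have "almost_periodic (s i)" by simp
  with sL i show "\<exists>h. h \<in> L2 M \<and> almost_periodic h \<and> L2_norm M (\<lambda>x. u x - h x) < e" by blast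
qed

text \<open>The orbit stays in a bounded part of a finite-dimensional space. Rounding the
  coordinates in an orthonormal basis to a grid of width \<open>d\<close> is the finite
  colouring.\<close>

lemma almost_periodic_finite_dim:
  assumes V: "finite_dim_L2_subspace M V" "invariant_under G \<phi> V" and v: "v \<in> V"
  shows "almost_periodic v"
proof (rule almost_periodicI)
  obtain B0 where B0: "finite B0" "B0 \<subseteq> L2 M" "V = L2_span M B0"
    using V(1) by (auto simp: finite_dim_L2_subspace_def)
  obtain B where B: "finite B" "L2_orthonormal M B" "V \<subseteq> L2_span M B"
    using L2_orthonormal_basis_exists[OF B0(1,2)] B0(3) by auto
  have BL: "b \<in> L2 M" "L2_norm M b = 1" if "b \<in> B" for b
  proof -
    show "b \<in> L2 M" using that B(2) by (auto simp: L2_orthonormal_def)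
    have "L2_inner M b b = 1" using that B(2) by (auto simp: L2_orthonormal_def)
    then have "of_real ((L2_norm M b)\<^sup>2) = (1::complex)" by (simp only: L2_inner_self)
    then have "(L2_norm M b)\<^sup>2 = 1\<^sup>2" using of_real_eq_1_iff by fastforce
    then show "L2_norm M b = 1" by (rule power2_eq_imp_eq) auto
  qed
  have vL: "v \<in> L2 M" using v B0(3) L2_span_subset by auto
  define N where "N = L2_norm M v"
  fix e :: real assume e: "e > 0"
  \<comment> \<open>Chosen so that \<open>card B\<close> squared coordinate errors of at most
    \<open>4 * d\<^sup>2\<close> sum to less than \<open>e\<^sup>2\<close>; the added 1 makes this
    strict and covers an empty basis.\<close>
  define d where "d = e / (2 * sqrt (card B + 1))"
  have d: "d > 0" "d\<^sup>2 * (4 * (card B + 1)) = e\<^sup>2"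
    using e by (auto simp: d_def power_divide power_mult_distrib add_nonneg_pos)
  define a where "a g b = L2_inner M (\<lambda>x. v (\<phi> g x)) b" for g b
  have a: "cmod (a g b) \<le> N" if "g \<in> carrier G" "b \<in> B" for g b
    using L2_Cauchy_Schwarz[OF L2_action[OF that(1) vL] BL(1)[OF that(2)]] BL(2)[OF that(2)]
      L2_norm_action[OF that(1) vL] by (simp add: a_def N_def)
  define c where "c g = (\<lambda>b\<in>B. (\<lfloor>Re (a g b) / d\<rfloor>, \<lfloor>Im (a g b) / d\<rfloor>))" for g
  show "\<exists>c::'g \<Rightarrow> ('x \<Rightarrow> complex) \<Rightarrow> int \<times> int. finite (c ` carrier G) \<and>
     (\<forall>g\<in>carrier G. \<forall>h\<in>carrier G. c g = c h \<longrightarrow> L2_norm M (\<lambda>x. v (\<phi> g x) - v (\<phi> h x)) < e)"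
  proof (intro exI[of _ c] conjI ballI impI)
    let ?I = "{\<lfloor>- N / d\<rfloor>..\<lfloor>N / d\<rfloor>}"
    have I: "\<lfloor>t / d\<rfloor> \<in> ?I" if "\<bar>t\<bar> \<le> N" for t
    proof -
      have "- N / d \<le> t / d" "t / d \<le> N / d" using that d(1) by (intro divide_right_mono; simp)+
      then show ?thesis by (simp add: floor_mono)
    qed
    have "c g \<in> (\<Pi>\<^sub>E b\<in>B. ?I \<times> ?I)" if "g \<in> carrier G" for g
      unfolding c_def restrict_PiE_iff
      using a[OF that] abs_Re_le_cmod abs_Im_le_cmod order_trans
      by (intro ballI SigmaI I) blast+
    then have "c ` carrier G \<subseteq> (\<Pi>\<^sub>E b\<in>B. ?I \<times> ?I)" by auto
    then show "finite (c ` carrier G)"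
      by (rule finite_subset) (intro finite_PiE B(1) finite_SigmaI finite_atLeastAtMost_int)
    fix g h assume gh: "g \<in> carrier G" "h \<in> carrier G" "c g = c h"
    let ?w = "\<lambda>x. v (\<phi> g x) - v (\<phi> h x)"
    have "(\<lambda>x. v (\<phi> k x)) \<in> L2_span M B" if "k \<in> carrier G" for k
      using V(2) v that B(3) by (auto simp: invariant_under_def comp_def)
    then have "(\<lambda>x. v (\<phi> g x) + (-1) * v (\<phi> h x)) \<in> L2_span M B"
      using gh by (intro L2_span_add L2_span_scale)
    then have "(L2_norm M ?w)\<^sup>2 = (\<Sum>b\<in>B. (cmod (L2_inner M ?w b))\<^sup>2)"
      using L2_span_orthonormal(2)[OF B(2,1), of ?w] by simp
    also have "\<dots> = (\<Sum>b\<in>B. (cmod (a g b - a h b))\<^sup>2)"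
      unfolding a_def using gh BL vL by (intro sum.cong refl) (simp add: L2_inner_diff_left L2_action)
    also have "\<dots> \<le> of_nat (card B) * (4 * d\<^sup>2)"
    proof (rule sum_bounded_above)
      fix b assume b: "b \<in> B"
      have close: "(s - t)\<^sup>2 \<le> d\<^sup>2" if "\<lfloor>s / d\<rfloor> = \<lfloor>t / d\<rfloor>" for s t
      proof -
        have "\<bar>s / d - t / d\<bar> < 1" using that by linarith
        then have "\<bar>s - t\<bar> < d" using d(1) by (simp flip: diff_divide_distrib)
        then show ?thesis using power_mono[of "\<bar>s - t\<bar>" d 2] by simp
      qed
      have "c g b = c h b" using gh by simp
      then have "\<lfloor>Re (a g b) / d\<rfloor> = \<lfloor>Re (a h b) / d\<rfloor>" "\<lfloor>Im (a g b) / d\<rfloor> = \<lfloor>Im (a h b) / d\<rfloor>"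
        using b by (simp_all add: c_def)
      from this[THEN close] have "(cmod (a g b - a h b))\<^sup>2 \<le> 2 * d\<^sup>2" by (simp add: cmod_power2)
      then show "(cmod (a g b - a h b))\<^sup>2 \<le> 4 * d\<^sup>2" using zero_le_power2[of d] by linarith
    qed
    also have "\<dots> < e\<^sup>2" unfolding d(2)[symmetric] using d(1) by (simp add: algebra_simps)
    finally show "L2_norm M ?w < e" by (rule power2_less_imp_less) (use e in simp)
  qed
qed

lemma almost_periodic_if_discrete_spectrum:
  assumes "discrete_spectrum G \<phi> M" "u \<in> L2 M"
  shows "almost_periodic u"
proof (rule almost_periodic_approx[OF assms(2)])
  define \<V> where "\<V> = {V. finite_dim_L2_subspace M V \<and> invariant_under G \<phi> V}"
  fix e :: real assume "e > 0"
  have "u \<in> L2_closure M (L2_span M (\<Union>\<V>))"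
    using assms by (simp add: discrete_spectrum_def H_c_def \<V>_def)
  with \<open>e > 0\<close> obtain h where h: "h \<in> L2_span M (\<Union>\<V>)" "L2_norm M (\<lambda>x. u x - h x) < e"
    by (auto simp: L2_closure_def)
  from h(1) obtain T c where T: "h \<in> L2 M" "finite T" "T \<subseteq> \<Union>\<V>" "AE x in M. h x = (\<Sum>b\<in>T. c b * b x)"
    by (rule L2_spanE)
  have b: "b \<in> L2 M" "almost_periodic b" if "b \<in> T" for b
  proof -
    from that T obtain V where V: "V \<in> \<V>" "b \<in> V" by auto
    then show "b \<in> L2 M" using L2_span_subset by (auto simp: \<V>_def finite_dim_L2_subspace_def)
    from V show "almost_periodic b" by (auto simp: \<V>_def intro: almost_periodic_finite_dim)
  qed
  have "almost_periodic (\<lambda>x. \<Sum>b\<in>T. c b * b x)"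
    using b by (intro almost_periodic_sum almost_periodic_scale L2_scale)
  then have "almost_periodic h"
    by (rule almost_periodic_cong_AE[OF T(1) _ T(4), rotated]) (use b in \<open>intro L2_sum L2_scale\<close>)
  with T(1) h(2) show "\<exists>h. h \<in> L2 M \<and> almost_periodic h \<and> L2_norm M (\<lambda>x. u x - h x) < e" by blast
qed

end

section \<open>Existence of Folner sequences\<close>

text \<open>Adjoining \<open>A\<close> to an almost invariant set adds at most
  \<open>2 * card A\<close> points to the symmetric difference, which is negligible once the set is
  large. Half of \<open>e\<close> pays for the original set and half for these points.\<close>

lemma (in amenable_group) folner_set_extending:
  assumes inf: "infinite (carrier G)" and A: "finite A" "A \<subseteq> carrier G"
    and K: "finite K" "K \<subseteq> carrier G" and e: "(0::real) < e"
  obtains F where "finite F" "F \<subseteq> carrier G" "A \<subseteq> F"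
    "\<And>g. g \<in> K \<Longrightarrow> real (card (sym_diff (g <#\<^bsub>G\<^esub> F) F)) \<le> e * real (card F)"
proof -
  define N where "N = Suc (nat \<lceil>4 * real (card A) / e\<rceil>)"
  have N: "4 * real (card A) / e \<le> real N" "N > 0" unfolding N_def by linarith+
  obtain L where L: "finite L" "card L = N" "L \<subseteq> carrier G"
    using infinite_arbitrarily_large[OF inf] by blast
  \<comment> \<open>If the Folner set had fewer than \<open>N\<close> elements, an error below
    \<open>d\<close> per element would mean fewer than one point of difference. The set would then
    be mapped into itself by \<open>L\<close> and contain \<open>N\<close> translates of any of its
    points.\<close>
  define d where "d = min (e/2) (1 / real N)"
  have d: "d > 0" "d \<le> e/2" "d * real N \<le> 1" using e N(2) by (auto simp: d_def min_def field_simps)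
  obtain F where F: "finite F" "F \<noteq> {}" "F \<subseteq> carrier G"
    "\<And>g. g \<in> K \<union> L \<Longrightarrow> real (card (sym_diff (g <#\<^bsub>G\<^esub> F) F)) < d * real (card F)"
    using folner_condition[of "K \<union> L" d] K L d(1) by blast
  have coset: "g <#\<^bsub>G\<^esub> B = (\<lambda>h. g \<otimes> h) ` B" for g B by (auto simp: l_coset_def)
  text \<open>Enlarging the set of translations by \<open>L\<close> forces the Folner set to be large.\<close>
  have large: "N \<le> card F"
  proof (rule ccontr)
    assume "\<not> N \<le> card F"
    then have lt: "card F < N" by simp
    have "g <#\<^bsub>G\<^esub> F \<subseteq> F" if "g \<in> L" for g
    proof -
      have "real (card (sym_diff (g <#\<^bsub>G\<^esub> F) F)) < d * real (card F)" using F(4) that by auto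
      also have "\<dots> \<le> d * real N" using lt d(1) by (intro mult_left_mono) auto
      also have "\<dots> \<le> 1" by (rule d(3))
      finally have "card (sym_diff (g <#\<^bsub>G\<^esub> F) F) = 0" by simp
      moreover have "finite (sym_diff (g <#\<^bsub>G\<^esub> F) F)" using F(1) by (auto simp: coset)
      ultimately show ?thesis by auto
    qed
    moreover obtain x where x: "x \<in> F" "x \<in> carrier G" using F by auto
    ultimately have "(\<lambda>g. g \<otimes> x) ` L \<subseteq> F" by (auto simp: coset)
    moreover have "inj_on (\<lambda>g. g \<otimes> x) L"
      using L(3) x(2) by (intro inj_onI) (metis right_cancel subsetD)
    ultimately have "card L \<le> card F" using F(1) by (metis card_image card_mono)
    with lt L(2) show False by simp
  qed
  show thesis
  proof (rule that[of "F \<union> A"])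
    show "finite (F \<union> A)" "F \<union> A \<subseteq> carrier G" "A \<subseteq> F \<union> A" using F A by auto
    fix g assume g: "g \<in> K"
    have fin: "finite (g <#\<^bsub>G\<^esub> B)" if "finite B" for B using that by (simp add: coset)
    have "sym_diff (g <#\<^bsub>G\<^esub> (F \<union> A)) (F \<union> A) \<subseteq> sym_diff (g <#\<^bsub>G\<^esub> F) F \<union> ((g <#\<^bsub>G\<^esub> A) \<union> A)"
      by (auto simp: coset)
    then have "card (sym_diff (g <#\<^bsub>G\<^esub> (F \<union> A)) (F \<union> A)) \<le> card (sym_diff (g <#\<^bsub>G\<^esub> F) F \<union> ((g <#\<^bsub>G\<^esub> A) \<union> A))"
      using F A fin by (intro card_mono) auto
    also have "\<dots> \<le> card (sym_diff (g <#\<^bsub>G\<^esub> F) F) + card ((g <#\<^bsub>G\<^esub> A) \<union> A)" by (rule card_Un_le)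
    also have "card ((g <#\<^bsub>G\<^esub> A) \<union> A) \<le> card (g <#\<^bsub>G\<^esub> A) + card A" by (rule card_Un_le)
    also have "card (g <#\<^bsub>G\<^esub> A) \<le> card A" using A(1) by (simp add: coset card_image_le)
    finally have "real (card (sym_diff (g <#\<^bsub>G\<^esub> (F \<union> A)) (F \<union> A)))
        \<le> real (card (sym_diff (g <#\<^bsub>G\<^esub> F) F)) + 2 * real (card A)" by linarith
    also have "\<dots> \<le> e/2 * real (card F) + e/2 * real (card F)"
    proof (rule add_mono)
      have "real (card (sym_diff (g <#\<^bsub>G\<^esub> F) F)) \<le> d * real (card F)" using F(4) g less_imp_le by blast
      also have "\<dots> \<le> e/2 * real (card F)" using d by (intro mult_right_mono) auto
      finally show "real (card (sym_diff (g <#\<^bsub>G\<^esub> F) F)) \<le> e/2 * real (card F)" .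
      have "4 * real (card A) \<le> real N * e" using N e by (simp add: field_simps)
      also have "\<dots> \<le> real (card F) * e" using large e by (intro mult_right_mono) auto
      finally show "2 * real (card A) \<le> e/2 * real (card F)" by (simp add: mult.commute)
    qed
    also have "\<dots> = e * real (card F)" by simp
    also have "\<dots> \<le> e * real (card (F \<union> A))"
      using e F A by (intro mult_left_mono) (auto intro: card_mono)
    finally show "real (card (sym_diff (g <#\<^bsub>G\<^esub> (F \<union> A)) (F \<union> A))) \<le> e * real (card (F \<union> A))" .
  qed
qed

text \<open>Along an enumeration of the group, stage \<open>n\<close> contains the previous stage
  and element \<open>n\<close>, and is invariant up to \<open>1 / real (Suc n)\<close> under the
  elements up to \<open>n\<close>.\<close>

lemma (in amenable_group) folner_sequence_exists:
  assumes inf: "infinite (carrier G)" and countable: "countable (carrier G)"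
  obtains F where "folner_sequence G F"
proof -
  let ?g = "from_nat_into (carrier G)"
  have g: "?g j \<in> carrier G" for j by (rule from_nat_into) (use inf in auto)
  define P where "P n F \<longleftrightarrow> finite F \<and> F \<subseteq> carrier G \<and> \<one> \<in> F \<and> ?g n \<in> F \<and>
    (\<forall>j\<le>n. real (card (sym_diff (?g j <#\<^bsub>G\<^esub> F) F)) \<le> 1 / real (Suc n) * real (card F))" for n F
  have ex: "\<exists>F. P n F \<and> A \<subseteq> F" if "finite A" "A \<subseteq> carrier G" for n A
  proof -
    have "finite (insert \<one> (insert (?g n) A))" "insert \<one> (insert (?g n) A) \<subseteq> carrier G"
      "finite (?g ` {..n})" "?g ` {..n} \<subseteq> carrier G" "0 < 1 / real (Suc n)"
      using that g by auto
    from folner_set_extending[OF inf this] show ?thesis unfolding P_def by (metis atMost_iff imageI insert_subset)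
  qed
  have "\<exists>F. \<forall>n. P n (F n) \<and> F n \<subseteq> F (Suc n)"
  proof (rule dependent_nat_choice)
    show "\<exists>F. P 0 F" using ex[of "{}" 0] by auto
    show "\<exists>F. P (Suc n) F \<and> A \<subseteq> F" if "P n A" for A n
      using ex[of A "Suc n"] that by (auto simp: P_def)
  qed
  then obtain F where F: "\<And>n. P n (F n)" "\<And>n. F n \<subseteq> F (Suc n)" by auto
  show thesis
  proof (rule that, unfold folner_sequence_def, intro conjI allI ballI)
    show "finite (F n)" "F n \<subseteq> carrier G" for n using F(1)[of n] by (auto simp: P_def)
    show "\<one> \<in> F 0" using F(1)[of 0] by (auto simp: P_def)
    show "incseq F" using F(2) by (rule incseq_SucI)
    show "(\<Union>n. F n) = carrier G"
    proof
      show "(\<Union>n. F n) \<subseteq> carrier G" using F(1) by (auto simp: P_def)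
      show "carrier G \<subseteq> (\<Union>n. F n)"
      proof
        fix h assume "h \<in> carrier G"
        then have "?g (to_nat_on (carrier G) h) = h" using countable by simp
        then show "h \<in> (\<Union>n. F n)" using F(1)[of "to_nat_on (carrier G) h"] by (auto simp: P_def)
      qed
    qed
    fix h assume h: "h \<in> carrier G"
    define j where "j = to_nat_on (carrier G) h"
    have j: "?g j = h" using h countable by (simp add: j_def)
    show "(\<lambda>n. real (card (sym_diff (h <#\<^bsub>G\<^esub> F n) (F n))) / real (card (F n))) \<longlonglongrightarrow> 0"
    proof (rule Lim_null_comparison[OF _ LIMSEQ_Suc[OF lim_1_over_n]])
      show "\<forall>\<^sub>F n in sequentially. norm (real (card (sym_diff (h <#\<^bsub>G\<^esub> F n) (F n))) / real (card (F n))) \<le> 1 / real (Suc n)"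
        using eventually_ge_at_top[of j]
      proof eventually_elim
        fix n assume "j \<le> n"
        then have "real (card (sym_diff (h <#\<^bsub>G\<^esub> F n) (F n))) \<le> 1 / real (Suc n) * real (card (F n))"
          using F(1)[of n] j by (auto simp: P_def)
        moreover have "card (F n) > 0" using F(1)[of n] by (auto simp: P_def card_gt_0_iff)
        ultimately show "norm (real (card (sym_diff (h <#\<^bsub>G\<^esub> F n) (F n))) / real (card (F n))) \<le> 1 / real (Suc n)"
          by (simp add: divide_le_eq)
      qed
    qed
  qed
qed

section \<open>Entropy of finite labellings\<close>

text \<open>A finite partition is handled through a function whose fibres are its cells, so that joins
  of partitions become tuples of functions.\<close>

definition fibers :: "('x \<Rightarrow> 'l) \<Rightarrow> 'x set set" where
  "fibers X = range (\<lambda>x. X -` {X x})"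

lemma fibers_cong:
  assumes "\<And>x x'. X x = X x' \<longleftrightarrow> Y x = Y x'" shows "fibers X = fibers Y"
  unfolding fibers_def using assms by (intro arg_cong[where f=range] ext) auto

lemma entropy_summand_split_le:
  assumes "finite R" "\<And>z. z \<in> R \<Longrightarrow> 0 \<le> a z"
  shows "- sum a R * ln (sum a R) \<le> (\<Sum>z\<in>R. - a z * ln (a z :: real))"
proof -
  have "- sum a R * ln (sum a R) = (\<Sum>z\<in>R. - a z * ln (sum a R))"
    by (simp add: sum_distrib_right sum_negf)
  also have "\<dots> \<le> (\<Sum>z\<in>R. - a z * ln (a z))"
  proof (rule sum_mono)
    fix z assume z: "z \<in> R"
    show "- a z * ln (sum a R) \<le> - a z * ln (a z)"
    proof (cases "a z = 0")
      case False
      with assms(2)[OF z] have "a z > 0" by simp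
      moreover have "a z \<le> sum a R" using assms z by (intro member_le_sum) auto
      ultimately show ?thesis by (simp add: ln_mono)
    qed simp
  qed
  finally show ?thesis .
qed

text \<open>Gibbs' inequality for weights that need not sum to 1, from
  \<open>ln x \<le> x - 1\<close> at \<open>x = sum a R * q z / a z\<close>. The intended
  \<open>a\<close> is the distribution of a label on one cell, and \<open>q\<close> is a guess at
  its conditional law.\<close>

lemma entropy_summand_Gibbs:
  assumes "finite R" "\<And>z. z \<in> R \<Longrightarrow> 0 \<le> a z" "\<And>z. z \<in> R \<Longrightarrow> 0 < q z" "sum q R \<le> 1"
  shows "(\<Sum>z\<in>R. - a z * ln (a z :: real)) \<le> - sum a R * ln (sum a R) - (\<Sum>z\<in>R. a z * ln (q z))"
proof -
  let ?a = "sum a R"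
  have a: "?a \<ge> 0" using assms by (intro sum_nonneg)
  have "(\<Sum>z\<in>R. - a z * ln (a z)) \<le> (\<Sum>z\<in>R. - a z * ln ?a - a z * ln (q z) + (?a * q z - a z))"
  proof (rule sum_mono)
    fix z assume z: "z \<in> R"
    show "- a z * ln (a z) \<le> - a z * ln ?a - a z * ln (q z) + (?a * q z - a z)"
    proof (cases "a z = 0")
      case True
      then show ?thesis using a assms(3)[OF z] by simp
    next
      case False
      with assms(2)[OF z] have az: "a z > 0" by simp
      have "a z \<le> ?a" using assms z by (intro member_le_sum) auto
      with az have apos: "?a > 0" by simp
      note qz = assms(3)[OF z]
      have "ln (?a * q z / a z) \<le> ?a * q z / a z - 1"
        using az apos qz by (intro ln_le_minus_one) simp
      moreover have "ln (?a * q z / a z) = ln ?a + ln (q z) - ln (a z)"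
        using az apos qz by (simp add: ln_div ln_mult)
      ultimately have "a z * (ln ?a + ln (q z) - ln (a z)) \<le> a z * (?a * q z / a z - 1)"
        using az by (intro mult_left_mono) auto
      then show ?thesis using az by (simp add: algebra_simps)
    qed
  qed
  also have "\<dots> = - ?a * ln ?a - (\<Sum>z\<in>R. a z * ln (q z)) + ?a * (sum q R - 1)"
    by (simp add: sum.distrib sum_subtractf sum_negf sum_distrib_right[symmetric] sum_distrib_left[symmetric] algebra_simps)
  also have "\<dots> \<le> - ?a * ln ?a - (\<Sum>z\<in>R. a z * ln (q z))"
    using a assms(4) by (simp add: mult_nonneg_nonpos)
  finally show ?thesis .
qed

text \<open>With \<open>p = s / (s + t)\<close> this says that the binary entropy is at least
  \<open>min p (1 - p)\<close>. It passes through \<open>2 * p * (1 - p)\<close>, which comes from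
  \<open>ln x \<le> x - 1\<close> applied to both terms.\<close>

lemma entropy_summand_split_two:
  assumes "0 \<le> s" "0 \<le> t"
  shows "- (s + t) * ln (s + t) + min s t \<le> - s * ln s - t * ln (t :: real)"
proof (cases "s = 0 \<or> t = 0")
  case False
  with assms have st: "s > 0" "t > 0" by auto
  have *: "p * ln (s + t) - p * ln p \<ge> p - p\<^sup>2 / (s + t)" if "p > 0" for p
  proof -
    have "ln (p / (s + t)) \<le> p / (s + t) - 1" using st that by (intro ln_le_minus_one) simp
    then have "p * (ln p - ln (s + t)) \<le> p * (p / (s + t) - 1)"
      using st that by (intro mult_left_mono) (auto simp: ln_div)
    then show ?thesis by (simp add: algebra_simps power2_eq_square)
  qed
  have "min s t * (s + t) \<le> 2 * s * t"
    using st mult_left_mono[of s t s] mult_left_mono[of t s t] by (auto simp: min_def algebra_simps)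
  then have "min s t \<le> 2 * s * t / (s + t)" using st by (simp add: le_divide_eq)
  also have "\<dots> = (s - s\<^sup>2 / (s + t)) + (t - t\<^sup>2 / (s + t))"
  proof -
    have "(s\<^sup>2 + t\<^sup>2) / (s + t) = ((s + t) * (s + t) - 2 * s * t) / (s + t)"
      by (simp add: power2_eq_square algebra_simps)
    also have "\<dots> = (s + t) - 2 * s * t / (s + t)" using st by (simp add: diff_divide_distrib)
    finally show ?thesis by (simp add: add_divide_distrib)
  qed
  finally show ?thesis using *[OF st(1)] *[OF st(2)] by (simp add: algebra_simps)
qed (use assms in auto)

context G_MPS
begin

definition label_entropy :: "('x \<Rightarrow> 'l) \<Rightarrow> real" where
  "label_entropy X = partition_entropy M (fibers X)"

lemma label_entropy_cong:
  "(\<And>x x'. X x = X x' \<longleftrightarrow> Y x = Y x') \<Longrightarrow> label_entropy X = label_entropy Y"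
  unfolding label_entropy_def using fibers_cong[of X Y] by simp

text \<open>Labels in \<open>R\<close> that do not occur have empty fibres and contribute 0, so
  convenient label sets such as \<alpha> itself can be summed over.\<close>

lemma label_entropy_eq:
  assumes "finite R" "range X \<subseteq> R"
  shows "label_entropy X = (\<Sum>y\<in>R. - prob (X -` {y}) * ln (prob (X -` {y})))"
proof -
  have "fibers X = (\<lambda>y. X -` {y}) ` range X" by (auto simp: fibers_def)
  moreover have "inj_on (\<lambda>y. X -` {y}) (range X)" by (auto simp: inj_on_def)
  ultimately have "label_entropy X = (\<Sum>y\<in>range X. - prob (X -` {y}) * ln (prob (X -` {y})))"
    by (simp add: label_entropy_def partition_entropy_def sum.reindex sum_negf)
  also have "\<dots> = (\<Sum>y\<in>R. - prob (X -` {y}) * ln (prob (X -` {y})))"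
  proof (rule sum.mono_neutral_left[OF assms])
    have "X -` {y} = {}" if "y \<notin> range X" for y using that by auto
    then show "\<forall>y\<in>R - range X. - prob (X -` {y}) * ln (prob (X -` {y})) = 0" by simp
  qed
  finally show ?thesis .
qed

lemma label_entropy_nonneg:
  assumes "simple_function M X" shows "0 \<le> label_entropy X"
proof -
  have "0 \<le> (\<Sum>y\<in>range X. - prob (X -` {y}) * ln (prob (X -` {y})))"
  proof (rule sum_nonneg)
    fix y
    have "prob (X -` {y}) * ln (prob (X -` {y})) \<le> 0"
    proof (cases "prob (X -` {y}) = 0")
      case False
      then have "0 < prob (X -` {y})" using measure_nonneg[of M "X -` {y}"] by linarith
      then show ?thesis using prob_le_1 by (intro mult_nonneg_nonpos) auto
    qed simp
    then show "0 \<le> - prob (X -` {y}) * ln (prob (X -` {y}))" by simp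
  qed
  then show ?thesis using assms by (subst label_entropy_eq[of "range X"]) (auto simp: simple_function_def)
qed

lemma simple_function_fiber: "simple_function M X \<Longrightarrow> X -` {y} \<in> sets M"
  using simple_functionD(2)[of M X "{y}"] by simp

lemma simple_function_vimage: "simple_function M X \<Longrightarrow> X -` W \<in> sets M"
  using simple_functionD(2)[of M X W] by simp

lemma prob_split:
  assumes "A \<in> sets M" "simple_function M Y" "finite R" "range Y \<subseteq> R"
  shows "prob A = (\<Sum>z\<in>R. prob (A \<inter> Y -` {z}))"
proof -
  have "prob A = prob (\<Union>z\<in>R. A \<inter> Y -` {z})"
    using assms(4) by (intro arg_cong[where f=prob]) auto
  also have "\<dots> = (\<Sum>z\<in>R. prob (A \<inter> Y -` {z}))"
    using assms by (intro finite_measure_finite_Union) (auto simp: disjoint_family_on_def simple_function_fiber)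
  finally show ?thesis .
qed

lemma label_entropy_Pair:
  assumes "finite R" "range X \<subseteq> R" "finite R'" "range Y \<subseteq> R'"
  shows "label_entropy (\<lambda>x. (X x, Y x)) = (\<Sum>y\<in>R. \<Sum>z\<in>R'. - prob (X -` {y} \<inter> Y -` {z}) * ln (prob (X -` {y} \<inter> Y -` {z})))"
proof -
  have *: "(\<lambda>x. (X x, Y x)) -` {(y, z)} = X -` {y} \<inter> Y -` {z}" for y z by auto
  show ?thesis
    unfolding sum.cartesian_product *[symmetric]
    using assms by (subst label_entropy_eq[of "R \<times> R'"]) (auto intro!: sum.cong)
qed

lemma label_entropy_le_Pair:
  assumes X: "simple_function M X" and Y: "simple_function M Y"
  shows "label_entropy X \<le> label_entropy (\<lambda>x. (X x, Y x))"
proof -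
  have fin: "finite (range X)" "finite (range Y)" using X Y by (auto simp: simple_function_def)
  have "label_entropy X = (\<Sum>y\<in>range X. - prob (X -` {y}) * ln (prob (X -` {y})))"
    using fin by (intro label_entropy_eq) auto
  also have "\<dots> \<le> (\<Sum>y\<in>range X. \<Sum>z\<in>range Y. - prob (X -` {y} \<inter> Y -` {z}) * ln (prob (X -` {y} \<inter> Y -` {z})))"
    using prob_split[OF simple_function_fiber[OF X] Y fin(2)] entropy_summand_split_le[OF fin(2)]
    by (intro sum_mono) simp
  also have "\<dots> = label_entropy (\<lambda>x. (X x, Y x))"
    using fin by (intro label_entropy_Pair[symmetric]) auto
  finally show ?thesis .
qed

text \<open>A form of Fano's inequality: \<open>r\<close> predicts the label \<open>Y\<close> from
  \<open>X\<close>. Gibbs' inequality is applied to a guess giving weight \<open>1 - d\<close> to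
  the predicted label and \<open>d / k\<close> to each other one, so correct predictions cost
  \<open>- ln (1 - d)\<close> and mistakes \<open>ln (real k / d)\<close>.\<close>

lemma label_entropy_Pair_le:
  assumes X: "simple_function M X" and Y: "simple_function M Y" and R: "finite R" "range Y \<subseteq> R" "card R \<le> k"
    and r: "\<And>x. r (X x) \<in> R" and d: "0 < d" "d < 1"
  shows "label_entropy (\<lambda>x. (X x, Y x))
    \<le> label_entropy X - ln (1 - d) + prob {x. Y x \<noteq> r (X x)} * ln (real k / d)"
proof -
  have fin: "finite (range X)" using X by (auto simp: simple_function_def)
  have "R \<noteq> {}" using r by auto
  with R have k: "k > 0" by (metis card_gt_0_iff gr0I le_zero_eq not_gr_zero)
  define a where "a y z = prob (X -` {y} \<inter> Y -` {z})" for y z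
  define q where "q y z = (if z = r y then 1 - d else d / k)" for y z
  have qpos: "q y z > 0" for y z using d k by (simp add: q_def)
  have ln_nonneg: "0 \<le> ln (real k / d)" "0 \<le> - ln (1 - d)" using d k by (auto simp: le_divide_eq)
  have qsum: "sum (q y) R \<le> 1" if "y \<in> range X" for y
  proof -
    have ry: "r y \<in> R" using that r by auto
    have "sum (q y) R = q y (r y) + sum (q y) (R - {r y})" using R(1) ry by (rule sum.remove)
    also have "sum (q y) (R - {r y}) = (\<Sum>z\<in>R - {r y}. d / k)" by (intro sum.cong) (auto simp: q_def)
    also have "\<dots> = real (card (R - {r y})) * (d / k)" by simp
    also have "\<dots> \<le> real k * (d / k)"
      using R d k card_Diff1_le[of R "r y"] by (intro mult_right_mono) auto
    finally show ?thesis using k by (simp add: q_def)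
  qed
  have a_sum: "sum (a y) R = prob (X -` {y})" for y
    unfolding a_def using prob_split[OF simple_function_fiber[OF X] Y R(1,2)] by simp
  have "label_entropy (\<lambda>x. (X x, Y x)) = (\<Sum>y\<in>range X. \<Sum>z\<in>R. - a y z * ln (a y z))"
    unfolding a_def using fin R by (intro label_entropy_Pair) auto
  also have "\<dots> \<le> (\<Sum>y\<in>range X. - sum (a y) R * ln (sum (a y) R) - (\<Sum>z\<in>R. a y z * ln (q y z)))"
    using R(1) qpos qsum by (intro sum_mono entropy_summand_Gibbs) (auto simp: a_def)
  also have "\<dots> = label_entropy X + (\<Sum>y\<in>range X. \<Sum>z\<in>R. a y z * - ln (q y z))"
    unfolding a_sum using fin by (subst label_entropy_eq[of "range X"]) (auto simp: sum_subtractf sum_negf)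
  also have "(\<Sum>y\<in>range X. \<Sum>z\<in>R. a y z * - ln (q y z))
      \<le> (\<Sum>y\<in>range X. \<Sum>z\<in>R. a y z * - ln (1 - d) + (if z = r y then 0 else a y z) * ln (real k / d))"
  proof (intro sum_mono)
    fix y z
    show "a y z * - ln (q y z) \<le> a y z * - ln (1 - d) + (if z = r y then 0 else a y z) * ln (real k / d)"
    proof (cases "z = r y")
      case False
      have "- ln (d / real k) = ln (real k / d)" using d k by (simp add: ln_div)
      moreover have "0 \<le> a y z * - ln (1 - d)"
        using ln_nonneg(2) by (intro mult_nonneg_nonneg) (auto simp: a_def)
      ultimately show ?thesis using False by (simp add: q_def)
    qed (simp add: q_def)
  qed
  also have "\<dots> = (\<Sum>y\<in>range X. \<Sum>z\<in>R. a y z) * - ln (1 - d)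
      + (\<Sum>y\<in>range X. \<Sum>z\<in>R. if z = r y then 0 else a y z) * ln (real k / d)"
    by (simp add: sum.distrib sum_subtractf sum_distrib_right sum_negf)
  also have "(\<Sum>y\<in>range X. \<Sum>z\<in>R. a y z) = 1"
    using prob_split[OF sets.top X fin order_refl] prob_space by (simp add: a_sum)
  also have "(\<Sum>y\<in>range X. \<Sum>z\<in>R. if z = r y then 0 else a y z) = prob {x. Y x \<noteq> r (X x)}"
  proof -
    define D where "D = (\<lambda>x. (X x, Y x)) -` {p. snd p \<noteq> r (fst p)}"
    have XY: "simple_function M (\<lambda>x. (X x, Y x))" using X Y by (rule simple_function_Pair)
    have D: "D \<in> sets M" unfolding D_def by (rule simple_function_vimage[OF XY])
    have "prob D = (\<Sum>y\<in>range X. prob (D \<inter> X -` {y}))"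
      by (rule prob_split[OF D X fin order_refl])
    also have "\<dots> = (\<Sum>y\<in>range X. \<Sum>z\<in>R. prob (D \<inter> X -` {y} \<inter> Y -` {z}))"
      by (intro sum.cong refl prob_split sets.Int D simple_function_fiber X Y R)
    also have "\<dots> = (\<Sum>y\<in>range X. \<Sum>z\<in>R. if z = r y then 0 else a y z)"
    proof (intro sum.cong refl)
      fix y z
      have "D \<inter> X -` {y} \<inter> Y -` {z} = (if z = r y then {} else X -` {y} \<inter> Y -` {z})"
        by (auto simp: D_def)
      then show "prob (D \<inter> X -` {y} \<inter> Y -` {z}) = (if z = r y then 0 else a y z)" by (simp add: a_def)
    qed
    also have "D = {x. Y x \<noteq> r (X x)}" by (auto simp: D_def)
    finally show ?thesis by simp
  qed
  finally show ?thesis by simp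
qed

text \<open>The best approximation of \<open>A\<close> by cells of \<open>X\<close> takes those
  cells in which \<open>A\<close> has the majority. Its error on a cell is the smaller part into
  which \<open>A\<close> cuts the cell, and the split gains at least that much entropy.\<close>

lemma label_entropy_Pair_set_ge:
  assumes X: "simple_function M X" and A: "A \<in> sets M"
    and far: "\<And>W. e \<le> prob (sym_diff A (X -` W))"
  shows "label_entropy X + e \<le> label_entropy (\<lambda>x. (X x, x \<in> A))"
proof -
  have fin: "finite (range X)" using X by (auto simp: simple_function_def)
  define s where "s y = prob (X -` {y} \<inter> A)" for y
  define t where "t y = prob (X -` {y} - A)" for y
  define W where "W = {y. s y > t y}"
  have Y: "simple_function M (\<lambda>x. x \<in> A)"
  proof -
    have "(\<lambda>x. x \<in> A) -` {b} = (if b then A else UNIV - A)" for b by auto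
    then show ?thesis using A sets.compl_sets[of A M] by (auto simp: simple_function_def)
  qed
  have st: "prob (X -` {y}) = s y + t y" for y
  proof -
    have "prob (X -` {y}) = prob (X -` {y} \<inter> A) + prob (X -` {y} - X -` {y} \<inter> A)"
      using finite_measure_Diff[of "X -` {y}" "X -` {y} \<inter> A"] simple_function_fiber[OF X, of y] A by auto
    also have "X -` {y} - X -` {y} \<inter> A = X -` {y} - A" by auto
    finally show ?thesis by (simp add: s_def t_def)
  qed
  have "e \<le> prob (sym_diff A (X -` W))" by (rule far)
  also have "\<dots> = (\<Sum>y\<in>range X. prob (sym_diff A (X -` W) \<inter> X -` {y}))"
    by (intro prob_split fin sets.Un sets.Diff A simple_function_vimage X order_refl)
  also have "\<dots> = (\<Sum>y\<in>range X. min (s y) (t y))"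
  proof (intro sum.cong refl)
    fix y
    have "sym_diff A (X -` W) \<inter> X -` {y} = (if y \<in> W then X -` {y} - A else X -` {y} \<inter> A)" by auto
    then show "prob (sym_diff A (X -` W) \<inter> X -` {y}) = min (s y) (t y)"
      by (auto simp: W_def s_def t_def)
  qed
  finally have e: "e \<le> (\<Sum>y\<in>range X. min (s y) (t y))" .
  have "label_entropy X + (\<Sum>y\<in>range X. min (s y) (t y)) = (\<Sum>y\<in>range X. - (s y + t y) * ln (s y + t y) + min (s y) (t y))"
    using fin by (subst label_entropy_eq[of "range X"]) (auto simp: st sum.distrib)
  also have "\<dots> \<le> (\<Sum>y\<in>range X. - s y * ln (s y) - t y * ln (t y))"
    by (intro sum_mono entropy_summand_split_two) (auto simp: s_def t_def)
  also have "\<dots> = (\<Sum>y\<in>range X. \<Sum>z\<in>UNIV. - prob (X -` {y} \<inter> (\<lambda>x. x \<in> A) -` {z}) * ln (prob (X -` {y} \<inter> (\<lambda>x. x \<in> A) -` {z})))"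
  proof (intro sum.cong refl)
    fix y
    have "X -` {y} \<inter> (\<lambda>x. x \<in> A) -` {True} = X -` {y} \<inter> A" "X -` {y} \<inter> (\<lambda>x. x \<in> A) -` {False} = X -` {y} - A"
      by auto
    then show "- s y * ln (s y) - t y * ln (t y) = (\<Sum>z\<in>UNIV. - prob (X -` {y} \<inter> (\<lambda>x. x \<in> A) -` {z}) * ln (prob (X -` {y} \<inter> (\<lambda>x. x \<in> A) -` {z})))"
      by (simp add: UNIV_bool s_def t_def)
  qed
  also have "\<dots> = label_entropy (\<lambda>x. (X x, x \<in> A))"
    using fin by (intro label_entropy_Pair[symmetric]) auto
  finally show ?thesis using e by linarith
qed

end

section \<open>Sequence entropy\<close>

definition cell :: "'x set set \<Rightarrow> 'x \<Rightarrow> 'x set" where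
  "cell \<alpha> x = (THE A. A \<in> \<alpha> \<and> x \<in> A)"

lemma cell_eq:
  assumes "partition_on UNIV \<alpha>" "A \<in> \<alpha>" "x \<in> A" shows "cell \<alpha> x = A"
  unfolding cell_def using assms partition_onD2[OF assms(1)] by (intro the_equality) (auto simp: disjoint_def)

lemma cell_mem:
  assumes "partition_on UNIV \<alpha>" shows "cell \<alpha> x \<in> \<alpha>" "x \<in> cell \<alpha> x"
proof -
  obtain A where "A \<in> \<alpha>" "x \<in> A" using partition_onD1[OF assms] by blast
  then show "cell \<alpha> x \<in> \<alpha>" "x \<in> cell \<alpha> x" using cell_eq[OF assms] by auto
qed

lemma cell_eq_iff: "partition_on UNIV \<alpha> \<Longrightarrow> A \<in> \<alpha> \<Longrightarrow> cell \<alpha> x = A \<longleftrightarrow> x \<in> A"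
  using cell_eq cell_mem(2) by metis

lemma finite_exhausting_sequence_card_at_top:
  assumes F: "incseq F" "\<And>n. finite (F n)" and S: "S \<subseteq> (\<Union>n. F n)" "infinite S"
  shows "filterlim (\<lambda>n. card (S \<inter> F n)) at_top sequentially"
  unfolding filterlim_at_top
proof
  fix N :: nat
  obtain T where T: "finite T" "card T = N" "T \<subseteq> S" using infinite_arbitrarily_large[OF S(2)] by blast
  have "\<exists>n. T \<subseteq> F n" using T(1) T(3)
  proof (induction T rule: finite_induct)
    case (insert x T)
    then obtain n m where "T \<subseteq> F n" "x \<in> F m" using S(1) by blast
    then have "insert x T \<subseteq> F (max n m)"
      using incseqD[OF F(1), of n "max n m"] incseqD[OF F(1), of m "max n m"] by auto
    then show ?case by blast
  qed simp
  then obtain n where n: "T \<subseteq> F n" by blast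
  show "\<forall>\<^sub>F n in sequentially. N \<le> card (S \<inter> F n)"
    using eventually_ge_at_top[of n]
  proof eventually_elim
    fix m assume "n \<le> m"
    then have "T \<subseteq> S \<inter> F m" using T(3) n incseqD[OF F(1)] by blast
    then show "N \<le> card (S \<inter> F m)" using T(2) F(2) by (metis card_mono finite_Int)
  qed
qed

context G_MPS
begin

text \<open>Restriction to \<open>I\<close> gives the joins over all index sets one common type and
  a finite range.\<close>

definition join_labels :: "('x \<Rightarrow> 'l) \<Rightarrow> 'g set \<Rightarrow> 'x \<Rightarrow> 'g \<Rightarrow> 'l" where
  "join_labels L I x = (\<lambda>g\<in>I. L (\<phi> g x))"

lemma join_labels_eq_iff:
  "join_labels L I x = join_labels L I x' \<longleftrightarrow> (\<forall>g\<in>I. L (\<phi> g x) = L (\<phi> g x'))"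
  by (simp add: join_labels_def restrict_def fun_eq_iff) meson

lemma simple_function_join_labels:
  assumes L: "simple_function M L" and I: "finite I" "I \<subseteq> carrier G"
  shows "simple_function M (join_labels L I)"
  unfolding simple_function_def
proof
  have "range (join_labels L I) \<subseteq> (\<Pi>\<^sub>E g\<in>I. range L)" by (auto simp: join_labels_def)
  moreover have "finite (\<Pi>\<^sub>E g\<in>I. range L)"
    using L I by (intro finite_PiE) (auto simp: simple_function_def)
  ultimately show "finite (join_labels L I ` space M)" by (simp add: finite_subset)
  show "\<forall>y\<in>join_labels L I ` space M. join_labels L I -` {y} \<inter> space M \<in> sets M"
  proof
    fix y assume "y \<in> join_labels L I ` space M"
    then obtain x0 where y: "y = join_labels L I x0" by auto
    have "{x \<in> space M. \<forall>g\<in>I. L (\<phi> g x) = L (\<phi> g x0)} \<in> sets M"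
    proof (rule sets.sets_Collect_finite_All[OF _ I(1)])
      fix g assume "g \<in> I"
      then have "\<phi> g -` (L -` {L (\<phi> g x0)}) \<in> sets M"
        using I simple_function_fiber[OF L] by (intro sets_action) auto
      then show "{x \<in> space M. L (\<phi> g x) = L (\<phi> g x0)} \<in> sets M" by (simp add: vimage_def)
    qed
    then show "join_labels L I -` {y} \<inter> space M \<in> sets M"
      by (simp add: y vimage_def join_labels_eq_iff)
  qed
qed

lemma simple_function_cell:
  assumes "finite_measurable_partition M \<alpha>" shows "simple_function M (cell \<alpha>)"
proof -
  have \<alpha>: "finite \<alpha>" "\<alpha> \<subseteq> sets M" "partition_on UNIV \<alpha>"
    using assms by (auto simp: finite_measurable_partition_def)
  have sub: "range (cell \<alpha>) \<subseteq> \<alpha>" using cell_mem[OF \<alpha>(3)] by auto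
  moreover have "cell \<alpha> -` {cell \<alpha> x} \<in> sets M" for x
  proof -
    have "cell \<alpha> -` {cell \<alpha> x} = cell \<alpha> x" using cell_eq_iff[OF \<alpha>(3) cell_mem(1)[OF \<alpha>(3)]] by auto
    then show ?thesis using \<alpha>(2) cell_mem(1)[OF \<alpha>(3)] by auto
  qed
  ultimately show ?thesis using \<alpha> by (auto simp: simple_function_def finite_subset)
qed

text \<open>An atom of the refinement is nonempty, so it contains some \<open>x\<close>, and the
  member chosen from each partition must be the one containing \<open>x\<close>. Several
  \<open>g\<close> may induce the same preimage partition; this repeats coordinates of the tuple but
  leaves its fibres unchanged.\<close>

lemma common_refinement_eq_fibers:
  assumes \<alpha>: "partition_on UNIV \<alpha>"
  shows "common_refinement ((\<lambda>g. preimage_partition (\<phi> g) \<alpha>) ` I) = fibers (join_labels (cell \<alpha>) I)"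
    (is "common_refinement ?P = _")
proof
  have fiber: "join_labels (cell \<alpha>) I -` {join_labels (cell \<alpha>) I x}
      = {x'. \<forall>g\<in>I. cell \<alpha> (\<phi> g x') = cell \<alpha> (\<phi> g x)}" for x
    by (auto simp: join_labels_eq_iff)
  have pre: "x' \<in> B \<longleftrightarrow> cell \<alpha> (\<phi> g x') = cell \<alpha> (\<phi> g x)"
    if "B \<in> preimage_partition (\<phi> g) \<alpha>" "x \<in> B" for B g x x'
  proof -
    obtain A where A: "A \<in> \<alpha>" "B = \<phi> g -` A" using \<open>B \<in> _\<close> by (auto simp: preimage_partition_def)
    with \<open>x \<in> B\<close> have cx: "cell \<alpha> (\<phi> g x) = A" by (simp add: cell_eq_iff[OF \<alpha> A(1)])
    show ?thesis unfolding cx A(2) vimage_eq cell_eq_iff[OF \<alpha> A(1)] ..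
  qed
  show "common_refinement ?P \<subseteq> fibers (join_labels (cell \<alpha>) I)"
  proof
    fix C assume "C \<in> common_refinement ?P"
    then obtain f x where f: "f \<in> (\<Pi> Q\<in>?P. Q)" "C = \<Inter>(f ` ?P)" "x \<in> C"
      unfolding common_refinement by blast
    have "x' \<in> C \<longleftrightarrow> (\<forall>g\<in>I. cell \<alpha> (\<phi> g x') = cell \<alpha> (\<phi> g x))" for x'
    proof -
      have "x' \<in> f (preimage_partition (\<phi> g) \<alpha>) \<longleftrightarrow> cell \<alpha> (\<phi> g x') = cell \<alpha> (\<phi> g x)" if "g \<in> I" for g
        using f that by (intro pre) auto
      then show ?thesis unfolding f(2) by auto
    qed
    then have "C = join_labels (cell \<alpha>) I -` {join_labels (cell \<alpha>) I x}" unfolding fiber by auto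
    then show "C \<in> fibers (join_labels (cell \<alpha>) I)" by (auto simp: fibers_def)
  qed
  show "fibers (join_labels (cell \<alpha>) I) \<subseteq> common_refinement ?P"
  proof
    fix C assume "C \<in> fibers (join_labels (cell \<alpha>) I)"
    then obtain x where C: "C = {x'. \<forall>g\<in>I. cell \<alpha> (\<phi> g x') = cell \<alpha> (\<phi> g x)}"
      unfolding fibers_def fiber by auto
    define f where "f Q = (SOME B. B \<in> Q \<and> x \<in> B)" for Q :: "'x set set"
    have f: "f Q \<in> Q \<and> x \<in> f Q" if "Q \<in> ?P" for Q
    proof -
      from that obtain g where g: "Q = preimage_partition (\<phi> g) \<alpha>" by auto
      have "\<phi> g -` cell \<alpha> (\<phi> g x) \<in> Q \<and> x \<in> \<phi> g -` cell \<alpha> (\<phi> g x)"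
        using cell_mem[OF \<alpha>] by (auto simp: g preimage_partition_def)
      then show ?thesis unfolding f_def by (rule someI)
    qed
    have "x' \<in> C \<longleftrightarrow> x' \<in> \<Inter>(f ` ?P)" for x'
      using f pre[of "f (preimage_partition (\<phi> g) \<alpha>)" g x x' for g] by (auto simp: C)
    then have "C = \<Inter>(f ` ?P)" by blast
    moreover have "f \<in> (\<Pi> Q\<in>?P. Q)" using f by blast
    moreover have "x \<in> C" by (simp add: C)
    ultimately show "C \<in> common_refinement ?P" unfolding common_refinement by blast
  qed
qed

section \<open>Slow entropy growth for almost periodic sets\<close>

lemma L2_norm_indicator_diff:
  assumes "g \<in> carrier G" "h \<in> carrier G" "A \<in> sets M"
  shows "L2_norm M (\<lambda>x. indicator A (\<phi> g x) - indicator A (\<phi> h x)) = sqrt (prob (sym_diff (\<phi> g -` A) (\<phi> h -` A)))"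
proof -
  have "(cmod (indicator A (\<phi> g x) - indicator A (\<phi> h x)))\<^sup>2 = indicator (sym_diff (\<phi> g -` A) (\<phi> h -` A)) x" for x
    by (auto simp: indicator_def)
  then have "(\<integral>x. (cmod (indicator A (\<phi> g x) - indicator A (\<phi> h x)))\<^sup>2 \<partial>M) = prob (sym_diff (\<phi> g -` A) (\<phi> h -` A))"
    by simp
  then show ?thesis by (simp only: L2_norm_def)
qed

text \<open>Once the join contains the finite net \<open>K\<close>, a further coordinate
  \<open>g\<close> is predicted by the coordinate of a nearby member of \<open>K\<close>, and Fano
  bounds the increase. The constant \<open>C\<close> is the entropy of the join over
  \<open>K\<close>.\<close>

lemma join_entropy_growth_le:
  assumes ap: "\<And>A. A \<in> sets M \<Longrightarrow> almost_periodic (indicator A)"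
    and \<alpha>: "finite_measurable_partition M \<alpha>" and e: "(0::real) < e"
  obtains C :: real where "\<And>I. finite I \<Longrightarrow> I \<subseteq> carrier G \<Longrightarrow>
    label_entropy (join_labels (cell \<alpha>) I) \<le> C + e * real (card I)"
proof -
  let ?L = "cell \<alpha>"
  have part: "finite \<alpha>" "\<alpha> \<subseteq> sets M" "partition_on UNIV \<alpha>"
    using \<alpha> by (auto simp: finite_measurable_partition_def)
  note L = simple_function_cell[OF \<alpha>]
  have range_L: "range ?L \<subseteq> \<alpha>" using cell_mem[OF part(3)] by auto
  define k where "k = card \<alpha>"
  have k: "k > 0" using part range_L by (auto simp: k_def card_gt_0_iff)
  \<comment> \<open>The two terms of Fano's bound get \<open>e / 2\<close> each: \<open>d\<close>
    settles the cost of correct predictions, and \<open>t\<close> is an error probability small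
    enough for the cost of mistakes. The added 1 in \<open>t\<close> keeps its denominator
    positive.\<close>
  define d where "d = 1 - exp (- e / 2)"
  have d: "0 < d" "d < 1" "- ln (1 - d) = e / 2" using e by (auto simp: d_def)
  have ln_nonneg: "0 \<le> ln (real k / d)" using d k by (auto simp: le_divide_eq)
  define t where "t = e / 2 / (ln (real k / d) + 1)"
  have t: "t > 0" "t * ln (real k / d) \<le> e / 2"
    using e ln_nonneg by (auto simp: t_def field_simps)
  have "\<exists>c::'g \<Rightarrow> nat. finite (c ` carrier G) \<and> (\<forall>g\<in>carrier G. \<forall>h\<in>carrier G. c g = c h \<longrightarrow>
      prob (sym_diff (\<phi> g -` A) (\<phi> h -` A)) \<le> t / k)" if "A \<in> \<alpha>" for A
  proof -
    have A: "A \<in> sets M" using that part by auto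
    have pos: "sqrt (t / k) > 0" using t k by simp
    obtain c :: "'g \<Rightarrow> nat" where c: "finite (c ` carrier G)"
      "\<And>g h. g \<in> carrier G \<Longrightarrow> h \<in> carrier G \<Longrightarrow> c g = c h \<Longrightarrow>
        L2_norm M (\<lambda>x. indicator A (\<phi> g x) - indicator A (\<phi> h x)) < sqrt (t / k)"
      using ap[OF A] pos by (rule almost_periodicD) blast
    then show ?thesis using L2_norm_indicator_diff[OF _ _ A] by (intro exI[of _ c]) fastforce
  qed
  then obtain c :: "'x set \<Rightarrow> 'g \<Rightarrow> nat" where c: "\<And>A. A \<in> \<alpha> \<Longrightarrow> finite (c A ` carrier G)"
    "\<And>A g h. A \<in> \<alpha> \<Longrightarrow> g \<in> carrier G \<Longrightarrow> h \<in> carrier G \<Longrightarrow> c A g = c A h \<Longrightarrow>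
      prob (sym_diff (\<phi> g -` A) (\<phi> h -` A)) \<le> t / k"
    by metis
  \<comment> \<open>One colour for all cells at once; \<open>K\<close> picks an element of each
    combined colour. The tolerance \<open>t / k\<close> per cell adds up to \<open>t\<close> over
    the \<open>k\<close> cells.\<close>
  define b where "b g = (\<lambda>A\<in>\<alpha>. c A g)" for g
  have "b ` carrier G \<subseteq> (\<Pi>\<^sub>E A\<in>\<alpha>. c A ` carrier G)" by (auto simp: b_def)
  then have fin_b: "finite (b ` carrier G)"
    by (rule finite_subset) (intro finite_PiE part(1) c(1))
  then obtain K where K: "K \<subseteq> carrier G" "finite K" "b ` carrier G = b ` K"
    using finite_subset_image[OF fin_b, of b "carrier G"] by auto
  have near: "\<exists>h\<in>K. prob {x. ?L (\<phi> g x) \<noteq> ?L (\<phi> h x)} \<le> t" if g: "g \<in> carrier G" for g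
  proof -
    obtain h where h: "h \<in> K" "b g = b h" using K(3) g by (metis imageE imageI)
    then have hc: "h \<in> carrier G" using K by auto
    have meas: "sym_diff (\<phi> g -` A) (\<phi> h -` A) \<in> sets M" if "A \<in> \<alpha>" for A
      using sets_action g hc that part(2) by blast
    have "{x. ?L (\<phi> g x) \<noteq> ?L (\<phi> h x)} \<subseteq> (\<Union>A\<in>\<alpha>. sym_diff (\<phi> g -` A) (\<phi> h -` A))"
    proof
      fix x assume "x \<in> {x. ?L (\<phi> g x) \<noteq> ?L (\<phi> h x)}"
      then have "\<phi> h x \<notin> ?L (\<phi> g x)"
        using cell_eq[OF part(3) cell_mem(1)[OF part(3)], of "\<phi> h x" "\<phi> g x"] by auto
      then have "x \<in> sym_diff (\<phi> g -` ?L (\<phi> g x)) (\<phi> h -` ?L (\<phi> g x))"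
        using cell_mem(2)[OF part(3)] by simp
      then show "x \<in> (\<Union>A\<in>\<alpha>. sym_diff (\<phi> g -` A) (\<phi> h -` A))"
        by (rule UN_I[OF cell_mem(1)[OF part(3)]])
    qed
    then have "prob {x. ?L (\<phi> g x) \<noteq> ?L (\<phi> h x)} \<le> prob (\<Union>A\<in>\<alpha>. sym_diff (\<phi> g -` A) (\<phi> h -` A))"
      using meas part(1) by (intro finite_measure_mono) auto
    also have "\<dots> \<le> (\<Sum>A\<in>\<alpha>. prob (sym_diff (\<phi> g -` A) (\<phi> h -` A)))"
      using meas part(1) by (intro finite_measure_subadditive_finite) auto
    also have "\<dots> \<le> of_nat (card \<alpha>) * (t / k)"
    proof (rule sum_bounded_above)
      fix A assume A: "A \<in> \<alpha>"
      then have "c A g = c A h" using h(2) by (metis b_def restrict_apply')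
      with A g hc show "prob (sym_diff (\<phi> g -` A) (\<phi> h -` A)) \<le> t / k" by (intro c(2))
    qed
    also have "\<dots> = t" using k by (simp add: k_def)
    finally show ?thesis using h by blast
  qed
  have step: "label_entropy (join_labels ?L (insert g I)) \<le> label_entropy (join_labels ?L I) + e"
    if g: "g \<in> carrier G" and I: "finite I" "I \<subseteq> carrier G" "K \<subseteq> I" for g I
  proof -
    obtain h where h: "h \<in> K" "prob {x. ?L (\<phi> g x) \<noteq> ?L (\<phi> h x)} \<le> t" using near[OF g] by blast
    have hI: "join_labels ?L I x h = ?L (\<phi> h x)" for x using h I by (auto simp: join_labels_def)
    have Y: "simple_function M (\<lambda>x. ?L (\<phi> g x))"
      using simple_function_comp[OF action_measurable[OF g] L] by (simp add: comp_def)
    have "label_entropy (join_labels ?L (insert g I)) = label_entropy (\<lambda>x. (join_labels ?L I x, ?L (\<phi> g x)))"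
      by (rule label_entropy_cong) (auto simp: join_labels_eq_iff)
    also have "\<dots> \<le> label_entropy (join_labels ?L I) - ln (1 - d)
        + prob {x. ?L (\<phi> g x) \<noteq> (\<lambda>y. y h) (join_labels ?L I x)} * ln (real k / d)"
      using I d part(1) range_L
      by (intro label_entropy_Pair_le[where R = \<alpha>] simple_function_join_labels L Y) (auto simp: k_def hI)
    also have "prob {x. ?L (\<phi> g x) \<noteq> (\<lambda>y. y h) (join_labels ?L I x)} * ln (real k / d) \<le> t * ln (real k / d)"
      using h(2) ln_nonneg by (intro mult_right_mono) (simp_all add: hI)
    also have "label_entropy (join_labels ?L I) - ln (1 - d) + t * ln (real k / d) \<le> label_entropy (join_labels ?L I) + e"
      using t(2) d(3) by linarith
    finally show ?thesis by simp
  qed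
  show thesis
  proof (rule that[of "label_entropy (join_labels ?L K)"])
    fix I :: "'g set" assume I: "finite I" "I \<subseteq> carrier G"
    have "label_entropy (join_labels ?L I) \<le> label_entropy (\<lambda>x. (join_labels ?L I x, join_labels ?L K x))"
      using I K by (intro label_entropy_le_Pair simple_function_join_labels L)
    also have "\<dots> = label_entropy (join_labels ?L (I \<union> K))"
      by (rule label_entropy_cong) (auto simp: join_labels_eq_iff)
    also have "\<dots> \<le> label_entropy (join_labels ?L K) + e * card I"
      using I
    proof (induction I rule: finite_induct)
      case (insert g I)
      then have "label_entropy (join_labels ?L (insert g (I \<union> K))) \<le> label_entropy (join_labels ?L (I \<union> K)) + e"
        using K by (intro step) auto
      then show ?case using insert by (simp add: algebra_simps)
    qed simp
    finally show "label_entropy (join_labels ?L I) \<le> label_entropy (join_labels ?L K) + e * card I" .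
  qed
qed

lemma partition_entropy_join:
  assumes "finite_measurable_partition M \<alpha>"
  shows "partition_entropy M (common_refinement ((\<lambda>g. preimage_partition (\<phi> g) \<alpha>) ` I))
    = label_entropy (join_labels (cell \<alpha>) I)"
  using assms common_refinement_eq_fibers[of \<alpha> I]
  by (simp add: finite_measurable_partition_def label_entropy_def)

lemma null_if_almost_periodic_sets:
  assumes ap: "\<And>A. A \<in> sets M \<Longrightarrow> almost_periodic (indicator A)" and F: "folner_sequence G F"
  shows "null_wrt G \<phi> M F"
  unfolding null_wrt_def
proof (intro allI impI)
  fix S assume S: "S \<subseteq> carrier G \<and> infinite S"
  have Fin: "finite (F n)" "F n \<subseteq> carrier G" for n using F by (auto simp: folner_sequence_def)
  have top: "filterlim (\<lambda>n. card (S \<inter> F n)) at_top sequentially"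
    using F S by (intro finite_exhausting_sequence_card_at_top) (auto simp: folner_sequence_def)
  have nonneg: "0 \<le> sequence_entropy_partition \<phi> M S F \<alpha>" if \<alpha>: "finite_measurable_partition M \<alpha>" for \<alpha>
    unfolding sequence_entropy_partition_def partition_entropy_join[OF \<alpha>]
  proof (rule le_Limsup)
    show "\<forall>\<^sub>F n in sequentially. 0 \<le> ereal (label_entropy (join_labels (cell \<alpha>) (S \<inter> F n)) / real (card (S \<inter> F n)))"
      using S Fin simple_function_cell[OF \<alpha>]
      by (intro always_eventually allI) (auto intro!: divide_nonneg_nonneg label_entropy_nonneg simple_function_join_labels)
  qed simp
  have le: "sequence_entropy_partition \<phi> M S F \<alpha> \<le> ereal e"
    if \<alpha>: "finite_measurable_partition M \<alpha>" and e: "e > 0" for \<alpha> e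
  proof -
    have "e/2 > 0" using e by simp
    from join_entropy_growth_le[OF ap \<alpha> this] obtain C where C: "\<And>I. finite I \<Longrightarrow> I \<subseteq> carrier G \<Longrightarrow>
        label_entropy (join_labels (cell \<alpha>) I) \<le> C + e/2 * card I" by blast
    have "filterlim (\<lambda>n. real (card (S \<inter> F n))) at_top sequentially"
      by (rule filterlim_compose[OF filterlim_real_sequentially top])
    \<comment> \<open>Beyond \<open>2 * C / e\<close> elements the constant \<open>C\<close> costs
      at most \<open>e / 2\<close> per element; the 1 makes the denominator positive.\<close>
    then have "\<forall>\<^sub>F n in sequentially. max 1 (2 * C / e) \<le> real (card (S \<inter> F n))"
      unfolding filterlim_at_top by blast
    then have "\<forall>\<^sub>F n in sequentially. ereal (label_entropy (join_labels (cell \<alpha>) (S \<inter> F n)) / real (card (S \<inter> F n))) \<le> ereal e"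
    proof eventually_elim
      fix n assume n: "max 1 (2 * C / e) \<le> real (card (S \<inter> F n))"
      let ?m = "real (card (S \<inter> F n))"
      have "C \<le> e / 2 * ?m" using n e by (simp add: field_simps)
      moreover have "label_entropy (join_labels (cell \<alpha>) (S \<inter> F n)) \<le> C + e / 2 * ?m"
        using S Fin by (intro C) auto
      ultimately have "label_entropy (join_labels (cell \<alpha>) (S \<inter> F n)) \<le> e * ?m" by simp
      then show "ereal (label_entropy (join_labels (cell \<alpha>) (S \<inter> F n)) / ?m) \<le> ereal e"
        using n by (simp add: divide_le_eq)
    qed
    then show ?thesis
      unfolding sequence_entropy_partition_def partition_entropy_join[OF \<alpha>] by (rule Limsup_bounded)
  qed
  \<comment> \<open>The trivial partition shows that the supremum is over a nonempty family, hence
    at least 0.\<close>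
  have "finite_measurable_partition M {UNIV}"
    using sets.top[of M] by (simp add: finite_measurable_partition_def partition_on_def disjoint_def)
  then have "0 \<le> sequence_entropy \<phi> M S F"
    unfolding sequence_entropy_def using nonneg by (intro SUP_upper2[of "{UNIV}"]) auto
  moreover have "sequence_entropy \<phi> M S F \<le> 0"
    unfolding sequence_entropy_def
  proof (rule SUP_least)
    fix \<alpha> assume "\<alpha> \<in> {\<alpha>. finite_measurable_partition M \<alpha>}"
    then have "\<forall>e>0. sequence_entropy_partition \<phi> M S F \<alpha> \<le> 0 + ereal e" using le by simp
    then show "sequence_entropy_partition \<phi> M S F \<alpha> \<le> 0"
      using ereal_le_epsilon2 by blast
  qed
  ultimately show "sequence_entropy \<phi> M S F = 0" by simp
qed

end

section \<open>Positive sequence entropy from a set that is not almost periodic\<close>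

context G_MPS
begin

text \<open>If translates outside a finite \<open>D\<close> were all close to sets built from the
  fibres of one simple function, the approximating set would be a finite colouring of them.
  Excluding an arbitrary finite \<open>D\<close> lets the greedy construction avoid a prescribed
  Folner set.\<close>

lemma sets_far_from_finite_algebras:
  assumes A: "A \<in> sets M" and nap: "\<not> almost_periodic (indicator A)"
  shows "\<exists>e::real>0. \<forall>(X :: 'x \<Rightarrow> 'l) D. simple_function M X \<longrightarrow> finite D \<longrightarrow>
    (\<exists>g\<in>carrier G - D. \<forall>W. e \<le> prob (sym_diff (\<phi> g -` A) (X -` W)))"
proof (rule ccontr)
  assume "\<not> ?thesis"
  then have neg: "\<exists>(X :: 'x \<Rightarrow> 'l) D. simple_function M X \<and> finite D \<and>
      (\<forall>g\<in>carrier G - D. \<exists>W. prob (sym_diff (\<phi> g -` A) (X -` W)) < e)" if "e > 0" for e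
    using that by (meson not_le)
  have "almost_periodic (indicator A)"
  proof (rule almost_periodicI)
    fix e :: real assume e: "e > 0"
    \<comment> \<open>Two translates near the same set are within \<open>e\<^sup>2\<close> in
      measure, that is, within \<open>e\<close> in norm.\<close>
    then have "e\<^sup>2 / 2 > 0" by simp
    from neg[OF this] obtain X :: "'x \<Rightarrow> 'l" and D where sX: "simple_function M X"
      and D: "finite D" "\<forall>g\<in>carrier G - D. \<exists>W. prob (sym_diff (\<phi> g -` A) (X -` W)) < e\<^sup>2 / 2"
      by blast
    have X: "finite (range X)" "simple_function M X" using sX by (simp_all add: simple_function_def)
    from D(2) obtain W where W: "\<And>g. g \<in> carrier G - D \<Longrightarrow> prob (sym_diff (\<phi> g -` A) (X -` W g)) < e\<^sup>2 / 2"
      by metis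
    define Z where "Z g = X -` W g" for g
    \<comment> \<open>Elements of \<open>D\<close> need not be approximable, so each of them is a
      colour of its own.\<close>
    define c where "c g = (if g \<in> D then Inl g else Inr (Z g))" for g
    show "\<exists>c::'g \<Rightarrow> 'g + 'x set. finite (c ` carrier G) \<and>
       (\<forall>g\<in>carrier G. \<forall>h\<in>carrier G. c g = c h \<longrightarrow>
         L2_norm M (\<lambda>x. indicator A (\<phi> g x) - indicator A (\<phi> h x)) < e)"
    proof (intro exI[of _ c] conjI ballI impI)
      have "Z g \<in> (\<lambda>V. X -` V) ` Pow (range X)" for g
        by (rule image_eqI[of _ _ "W g \<inter> range X"]) (auto simp: Z_def)
      then have "c ` carrier G \<subseteq> Inl ` D \<union> Inr ` (\<lambda>V. X -` V) ` Pow (range X)"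
        unfolding c_def by auto
      then show "finite (c ` carrier G)" by (rule finite_subset) (use D(1) X(1) in auto)
      fix g h assume gh: "g \<in> carrier G" "h \<in> carrier G" "c g = c h"
      have "prob (sym_diff (\<phi> g -` A) (\<phi> h -` A)) < e\<^sup>2"
      proof (cases "g \<in> D")
        case True
        then have "g = h" using gh by (auto simp: c_def split: if_splits)
        then show ?thesis using e by simp
      next
        case False
        then have Z: "h \<notin> D" "Z g = Z h" using gh by (auto simp: c_def split: if_splits)
        note meas = sets_action[OF gh(1) A] sets_action[OF gh(2) A] simple_function_vimage[OF X(2)]
        have "prob (sym_diff (\<phi> g -` A) (\<phi> h -` A))
            \<le> prob (sym_diff (\<phi> g -` A) (Z g) \<union> sym_diff (\<phi> h -` A) (Z h))"
          unfolding Z_def using meas Z(2) by (intro finite_measure_mono) (auto simp: Z_def)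
        also have "\<dots> \<le> prob (sym_diff (\<phi> g -` A) (Z g)) + prob (sym_diff (\<phi> h -` A) (Z h))"
          unfolding Z_def using meas by (intro measure_subadditive) auto
        also have "\<dots> < e\<^sup>2" using W[of g] W[of h] gh False Z(1) by (simp add: Z_def)
        finally show ?thesis .
      qed
      then have "sqrt (prob (sym_diff (\<phi> g -` A) (\<phi> h -` A))) < sqrt (e\<^sup>2)" by (rule real_sqrt_less_mono)
      then show "L2_norm M (\<lambda>x. indicator A (\<phi> g x) - indicator A (\<phi> h x)) < e"
        using L2_norm_indicator_diff[OF gh(1,2) A] e by simp
    qed
  qed
  with nap show False by simp
qed

text \<open>The set \<open>S\<close> is built greedily: each new element lies outside some \<open>F m\<close> that contains the
  previous ones, so that every \<open>S \<inter> F n\<close> consists of the elements chosen up to some stage.\<close>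

lemma almost_periodic_sets_if_null:
  assumes null: "null_wrt G \<phi> M F" and F: "folner_sequence G F" and A: "A \<in> sets M"
  shows "almost_periodic (indicator A)"
proof (rule ccontr)
  assume nap: "\<not> almost_periodic (indicator A)"
  define \<alpha> where "\<alpha> = {A, UNIV - A}"
  \<comment> \<open>Constant indicators are almost periodic, so \<open>A\<close> and its complement
    are nonempty, as the cells of a partition must be.\<close>
  have "almost_periodic (indicator B)" if "B = {} \<or> B = UNIV" for B
    by (rule almost_periodicI[where 'c = unit]) (use that in \<open>auto simp: L2_norm_def\<close>)
  with nap have "A \<noteq> {}" "A \<noteq> UNIV" by auto
  then have \<alpha>: "finite_measurable_partition M \<alpha>" "partition_on UNIV \<alpha>"
    using A sets.compl_sets[OF A]
    by (auto simp: \<alpha>_def finite_measurable_partition_def partition_on_def disjoint_def)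
  have cell: "cell \<alpha> x = cell \<alpha> y \<longleftrightarrow> (x \<in> A \<longleftrightarrow> y \<in> A)" for x y
    using cell_eq[OF \<alpha>(2), of A] cell_eq[OF \<alpha>(2), of "UNIV - A"] \<open>A \<noteq> {}\<close> \<open>A \<noteq> UNIV\<close>
    by (cases "x \<in> A"; cases "y \<in> A") (auto simp: \<alpha>_def)
  define J where "J = join_labels (cell \<alpha>)"
  have J: "simple_function M (J I)" if "finite I" "I \<subseteq> carrier G" for I
    unfolding J_def using that \<alpha> by (intro simple_function_join_labels simple_function_cell)
  \<comment> \<open>The label type is that of \<open>J I\<close>, so one gain \<open>e\<close>
    serves every stage of the construction.\<close>
  obtain e :: real where e: "e > 0"
    "\<And>(X :: 'x \<Rightarrow> 'g \<Rightarrow> 'x set) D. simple_function M X \<Longrightarrow> finite D \<Longrightarrow>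
      \<exists>g\<in>carrier G - D. \<forall>W. e \<le> prob (sym_diff (\<phi> g -` A) (X -` W))"
    using sets_far_from_finite_algebras[OF A nap] by metis
  have Fin: "finite (F n)" "F n \<subseteq> carrier G" for n using F by (auto simp: folner_sequence_def)
  have inc: "incseq F" and cover: "(\<Union>n. F n) = carrier G" using F by (auto simp: folner_sequence_def)
  have grow: "\<exists>g\<in>carrier G - F m. label_entropy (J I) + e \<le> label_entropy (J (insert g I))"
    if I: "finite I" "I \<subseteq> carrier G" for I m
  proof -
    from e(2)[OF J[OF I] Fin(1)[of m]] obtain g where g: "g \<in> carrier G - F m"
      "\<And>W. e \<le> prob (sym_diff (\<phi> g -` A) (J I -` W))" by blast
    have "label_entropy (J I) + e \<le> label_entropy (\<lambda>x. (J I x, x \<in> \<phi> g -` A))"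
      using g sets_action[OF _ A] by (intro label_entropy_Pair_set_ge J I) auto
    also have "\<dots> = label_entropy (J (insert g I))"
      by (rule label_entropy_cong) (auto simp: J_def join_labels_eq_iff cell)
    finally show ?thesis using g(1) by blast
  qed
  have "\<exists>m. I \<subseteq> F m" if "finite I" "I \<subseteq> carrier G" for I
    using that
  proof (induction I rule: finite_induct)
    case (insert x I)
    then obtain n m where "I \<subseteq> F n" "x \<in> F m" using cover by blast
    then have "insert x I \<subseteq> F (max n m)"
      using incseqD[OF inc, of n "max n m"] incseqD[OF inc, of m "max n m"] by auto
    then show ?case by blast
  qed simp
  note cofinal = this
  define nxt where "nxt I I' \<longleftrightarrow> (\<exists>g m. I \<subseteq> F m \<and> g \<notin> F m \<and> I' = insert g I \<and>
      label_entropy (J I) + e \<le> label_entropy (J I'))" for I I'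
  have step: "\<exists>I'. finite I' \<and> I' \<subseteq> carrier G \<and> nxt I I'" if I: "finite I" "I \<subseteq> carrier G" for I
  proof -
    obtain m where m: "I \<subseteq> F m" using cofinal[OF I] by blast
    obtain g where "g \<in> carrier G" "g \<notin> F m" "label_entropy (J I) + e \<le> label_entropy (J (insert g I))"
      using grow[OF I, of m] by blast
    with I m show ?thesis unfolding nxt_def by (intro exI[of _ "insert g I"]) auto
  qed
  have "\<exists>I. \<forall>n. (finite (I n) \<and> I n \<subseteq> carrier G \<and> (n = 0 \<longrightarrow> I n = {})) \<and> nxt (I n) (I (Suc n))"
  proof (rule dependent_nat_choice)
    show "\<exists>I. finite I \<and> I \<subseteq> carrier G \<and> (0 = (0::nat) \<longrightarrow> I = {})" by (intro exI[of _ "{}"]) simp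
    show "\<exists>I'. (finite I' \<and> I' \<subseteq> carrier G \<and> (Suc n = 0 \<longrightarrow> I' = {})) \<and> nxt I I'"
      if "finite I \<and> I \<subseteq> carrier G \<and> (n = 0 \<longrightarrow> I = {})" for I n
      using step[of I] that by simp
  qed
  then obtain I where I: "\<And>n. finite (I n)" "\<And>n. I n \<subseteq> carrier G" "I 0 = {}"
    and "\<And>n. nxt (I n) (I (Suc n))"
    by auto
  then have next_I: "\<exists>g m. I n \<subseteq> F m \<and> g \<notin> F m \<and> I (Suc n) = insert g (I n) \<and>
      label_entropy (J (I n)) + e \<le> label_entropy (J (I (Suc n)))" for n
    unfolding nxt_def by simp
  have card: "card (I n) = n" for n
  proof (induction n)
    case (Suc n)
    obtain g m where g: "I n \<subseteq> F m" "g \<notin> F m" "I (Suc n) = insert g (I n)" using next_I[of n] by blast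
    then have "g \<notin> I n" by blast
    with g(3) Suc I(1) show ?case by simp
  qed (simp add: I)
  have entropy: "n * e \<le> label_entropy (J (I n))" for n
  proof (induction n)
    case 0
    then show ?case using label_entropy_nonneg[OF J[OF I(1,2), of 0]] by simp
  next
    case (Suc n)
    then show ?case using next_I[of n] by (auto simp: algebra_simps)
  qed
  have mono: "incseq I"
  proof (rule incseq_SucI)
    show "I n \<subseteq> I (Suc n)" for n using next_I[of n] by blast
  qed
  define S where "S = (\<Union>n. I n)"
  have S: "S \<subseteq> carrier G" "infinite S"
  proof -
    show "S \<subseteq> carrier G" using I by (auto simp: S_def)
    show "infinite S"
    proof
      assume "finite S"
      then have "card (I n) \<le> card S" for n by (rule card_mono) (auto simp: S_def)
      from this[of "Suc (card S)"] show False by (simp add: card)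
    qed
  qed
  \<comment> \<open>Let \<open>I j\<close> be the largest stage inside \<open>F n\<close>, which
    exists because stage \<open>j\<close> has \<open>j\<close> elements. The next element lies
    outside \<open>F n\<close> by maximality. A later stage is no longer inside \<open>F n\<close>,
    so the \<open>F m\<close> containing it has \<open>m > n\<close>, and the new element avoids
    \<open>F m\<close>, which includes \<open>F n\<close>.\<close>
  have initial: "\<exists>j. S \<inter> F n = I j" for n
  proof -
    have "j < Suc (card (F n))" if "I j \<subseteq> F n" for j using card_mono[OF Fin(1) that] by (simp add: card)
    moreover have "I 0 \<subseteq> F n" by (simp add: I)
    ultimately have "\<exists>j. I j \<subseteq> F n \<and> (\<forall>i. I i \<subseteq> F n \<longrightarrow> i \<le> j)"
      using ex_has_greatest_nat[of "\<lambda>j. I j \<subseteq> F n" 0 "\<lambda>j. j"] by blast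
    then obtain j where j: "I j \<subseteq> F n" "\<And>i. I i \<subseteq> F n \<Longrightarrow> i \<le> j" by blast
    have later: "S \<inter> F n \<inter> I i \<subseteq> I j" if "j \<le> i" for i
      using that
    proof (induction i rule: dec_induct)
      case (step i)
      obtain g m where g: "I i \<subseteq> F m" "g \<notin> F m" "I (Suc i) = insert g (I i)" using next_I[of i] by blast
      have "g \<notin> F n \<or> g \<in> I j"
      proof (cases "i = j")
        case True
        then show ?thesis using j(2)[of "Suc j"] j(1) g(3) by auto
      next
        case False
        then have "\<not> I i \<subseteq> F n" using j(2)[of i] step(1) by auto
        then have "\<not> m \<le> n" using g(1) incseqD[OF inc, of m n] by blast
        then have "F n \<subseteq> F m" using incseqD[OF inc, of n m] by simp
        with g(2) show ?thesis by blast
      qed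
      then show ?case using step(3) unfolding g(3) by blast
    qed blast
    have "S \<inter> F n \<subseteq> I j"
    proof
      fix x assume x: "x \<in> S \<inter> F n"
      then obtain i where "x \<in> I i" by (auto simp: S_def)
      then have "x \<in> I (max i j)" using incseqD[OF mono, of i "max i j"] by auto
      with x show "x \<in> I j" using later[of "max i j"] by auto
    qed
    moreover have "I j \<subseteq> S \<inter> F n" using j(1) by (auto simp: S_def)
    ultimately show ?thesis by blast
  qed
  have top: "filterlim (\<lambda>n. card (S \<inter> F n)) at_top sequentially"
    using Fin S inc cover by (intro finite_exhausting_sequence_card_at_top) auto
  have "ereal e \<le> sequence_entropy_partition \<phi> M S F \<alpha>"
    unfolding sequence_entropy_partition_def partition_entropy_join[OF \<alpha>(1)] J_def[symmetric]
  proof (rule le_Limsup)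
    have "\<forall>\<^sub>F n in sequentially. 1 \<le> card (S \<inter> F n)" using top unfolding filterlim_at_top by blast
    then show "\<forall>\<^sub>F n in sequentially. ereal e \<le> ereal (label_entropy (J (S \<inter> F n)) / real (card (S \<inter> F n)))"
    proof eventually_elim
      fix n assume n: "1 \<le> card (S \<inter> F n)"
      obtain j where j: "S \<inter> F n = I j" using initial by blast
      show "ereal e \<le> ereal (label_entropy (J (S \<inter> F n)) / real (card (S \<inter> F n)))"
        using n entropy[of j] by (simp add: j card le_divide_eq mult.commute)
    qed
  qed simp
  also have "\<dots> \<le> sequence_entropy \<phi> M S F"
    unfolding sequence_entropy_def using \<alpha>(1) by (intro SUP_upper) auto
  also have "\<dots> = 0" using null S by (auto simp: null_wrt_def)
  finally show False using e(1) by simp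
qed

text \<open>The right-hand side does not mention \<open>F\<close>: nullness for one Folner sequence
  is therefore nullness for any other.\<close>

lemma null_iff_discrete_spectrum:
  assumes "folner_sequence G F" "countable (carrier G)"
  shows "null_wrt G \<phi> M F \<longleftrightarrow> discrete_spectrum G \<phi> M"
proof
  assume "null_wrt G \<phi> M F"
  note sets = almost_periodic_sets_if_null[OF this assms(1)]
  show "discrete_spectrum G \<phi> M"
    by (rule discrete_spectrum_if_almost_periodic[OF assms almost_periodic_if_sets[OF sets]])
next
  assume "discrete_spectrum G \<phi> M"
  note ap = almost_periodic_if_discrete_spectrum[OF this indicator_L2]
  show "null_wrt G \<phi> M F" by (rule null_if_almost_periodic_sets[OF ap assms(1)])
qed

end

theorem theorem3p5:
  fixes G :: "('g, 'b) monoid_scheme"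
    and \<phi> :: "'g \<Rightarrow> 'x::metric_space \<Rightarrow> 'x"
    and M :: "'x measure"
  assumes "infinite (carrier G)" and "countable (carrier G)" and "amenable_group G"
    and "G_MPS G \<phi> M"
  shows "(discrete_spectrum G \<phi> M \<longleftrightarrow> (\<forall>F. folner_sequence G F \<longrightarrow> null_wrt G \<phi> M F))
    \<and> (discrete_spectrum G \<phi> M \<longleftrightarrow> (\<exists>F. folner_sequence G F \<and> null_wrt G \<phi> M F))
    \<and> (\<forall>F F'. folner_sequence G F \<and> folner_sequence G F' \<longrightarrow>
         (null_wrt G \<phi> M F \<longleftrightarrow> null_wrt G \<phi> M F'))"
proof -
  \<comment> \<open>Existence ties the two quantified conditions together: were there no Folner
    sequence, the universal one would hold vacuously and the existential one would fail.\<close>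
  obtain F0 where "folner_sequence G F0"
    using amenable_group.folner_sequence_exists[OF assms(3,1,2)] by blast
  moreover note G_MPS.null_iff_discrete_spectrum[OF assms(4) _ assms(2)]
  ultimately show ?thesis by blast
qed

end
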